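(* Suppose the following holds: for any integer-valued function $a=a(n)$, along any sequence of $n$ for which $\mu_a(n)=\Theta(n/\log^2 n)$, with high probability $\chi_{a-1}(G_{n,1/2})=k_{a-1}(n)+O(n^{0.99})$. Then there is a constant $c>0$ such that for any sequence of intervals $[s_n,t_n]$ with $\Pr\big(\chi(G_{n,1/2})\in[s_n,t_n]\big)\ge0.9$ for all $n$, there is a sequence of integers $n^*$ (tending to infinity) such that \[ t_{n^*}-s_{n^*}\ge c\,\frac{\sqrt{n^*}\,\log\log n^*}{\log^3 n^*}. \]
   Context: $G_{n,1/2}$ is the uniformly random graph on $n$ labelled vertices; $\chi$ denotes chromatic number. $\mu_a(n)=\binom{n}{a}2^{-\binom a2}$. A vertex colouring is $t$-bounded if every colour class has size at most $t$; $\chi_t(G)$ is the minimum number of colours in a $t$-bounded colouring of $G$. An unordered $t$-bounded $k$-colouring of $G$ is a partition of $V(G)$ into $k$ independent sets each of size at most $t$. $E_{n,k,t}$ is the expected number of unordered $t$-bounded $k$-colourings of $G_{n,1/2}$, and $k_t(n)=\min\{k: E_{n,k,t}\ge1\}$. "With high probability" means with probability tending to $1$ as $n\to\infty$. Logarithms are natural. *)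

theory Defs
  imports Complex_Main "HOL-Library.Disjoint_Sets" "HOL-Library.Landau_Symbols"
begin

text \<open>Simple graphs on the labelled vertex set {0..<n}, represented by their edge sets.
  G(n,1/2) is the uniform distribution on all such graphs.\<close>

definition all_edges :: "nat \<Rightarrow> nat set set" where
  "all_edges n = {e. \<exists>u v. u < n \<and> v < n \<and> u \<noteq> v \<and> e = {u, v}}"

definition graphs :: "nat \<Rightarrow> nat set set set" where
  "graphs n = Pow (all_edges n)"

definition gnp_prob :: "nat \<Rightarrow> (nat set set \<Rightarrow> bool) \<Rightarrow> real" where
  "gnp_prob n P = real (card {E \<in> graphs n. P E}) / real (card (graphs n))"

definition indep :: "nat set set \<Rightarrow> nat set \<Rightarrow> bool" where
  "indep E S \<longleftrightarrow> (\<forall>u\<in>S. \<forall>v\<in>S. u \<noteq> v \<longrightarrow> {u, v} \<notin> E)"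

definition ucols :: "nat \<Rightarrow> nat set set \<Rightarrow> nat \<Rightarrow> nat \<Rightarrow> nat set set set" where
  "ucols n E k t = {P. partition_on {..<n} P \<and> card P = k \<and> (\<forall>S\<in>P. indep E S \<and> card S \<le> t)}"

definition chromatic :: "nat \<Rightarrow> nat set set \<Rightarrow> nat" where
  "chromatic n E = (LEAST k. \<exists>P. partition_on {..<n} P \<and> card P = k \<and> (\<forall>S\<in>P. indep E S))"

definition chi_bounded :: "nat \<Rightarrow> nat \<Rightarrow> nat set set \<Rightarrow> nat" where
  "chi_bounded t n E = (LEAST k. ucols n E k t \<noteq> {})"

definition E_nkt :: "nat \<Rightarrow> nat \<Rightarrow> nat \<Rightarrow> real" where
  "E_nkt n k t = (\<Sum>E\<in>graphs n. real (card (ucols n E k t))) / real (card (graphs n))"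

definition k_t :: "nat \<Rightarrow> nat \<Rightarrow> nat" where
  "k_t t n = (LEAST k. E_nkt n k t \<ge> 1)"

definition mu :: "nat \<Rightarrow> nat \<Rightarrow> real" where
  "mu a n = real (n choose a) * 2 powr (- real (a choose 2))"

end

theory Submission
  imports Defs "HOL-Analysis.Analysis" "HOL-Real_Asymp.Real_Asymp"
begin

text \<open>
  Planting an independent \<open>a\<close>-set into \<open>G(n, 1/2)\<close> gives a graph on \<open>n + a\<close> vertices whose chromatic
  number went up by at most one and whose distance in total variation from \<open>G(n + a, 1/2)\<close> is
  \<open>O(mu a n powr (-1/2))\<close>. After about \<open>sqrt (mu a n)\<close> plantings the distance is still below \<open>1/4\<close>,
  so the lower end of the interval at \<open>n + r * a\<close> exceeds the upper end at \<open>n\<close> by at most \<open>r\<close>. If all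
  intervals were short, then over a stretch of \<open>N\<close> of order \<open>n / ln n\<close> vertices the chromatic number
  would typically grow at a rate hardly above \<open>1 / a\<close>.

  Take \<open>mu a n\<close> to be a small multiple of \<open>n / (ln n)^2\<close>. By hypothesis the chromatic number at \<open>n\<close> is
  at most \<open>k_t (a - 1) n\<close> up to a small error. At \<open>n + N\<close> there are few independent \<open>a\<close>-sets and no larger
  ones, and the first moment, evaluated at the saddle point belonging to \<open>n\<close>, forces a growth rate of
  \<open>1 / a + c * ln (ln n) / (ln n)^3\<close>. The logarithmic gain arises because, without a restriction on their
  number, the optimal colouring would use about \<open>n / ln n\<close> independent \<open>a\<close>-sets, which is
  \<open>ln n\<close> times more than exist.
\<close>

text \<open>Why the bound has this size: over \<open>N\<close> of order n / ln n vertices the extra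
  growth adds up to n * ln (ln n) / (ln n)^4 colours. Plantings are grouped in blocks of
  \<open>r\<close>, of order sqrt (mu a n); a block adds r * a vertices and gives away at most one
  interval length, so N / (r * a), of order sqrt n / ln n, interval lengths must pay for the extra
  colours. The quotient is sqrt n * ln (ln n) / (ln n)^3.

  The size of \<open>mu a n\<close> is a compromise. More independent a-sets allow longer blocks,
  but the gain is proportional to N / a minus the number of a-sets at n + N, so this number has to
  stay well below N / a. And \<open>N\<close> is limited to n / a, because \<open>mu a\<close> grows
  like the a-th power of its argument and changes only by a bounded factor over such a stretch. This
  leaves n / (ln n)^2 as the largest order that the argument permits.

  Two events with probabilities 0.9 and more than 0.1 have a graph in common, so it suffices that a
  block of plantings keeps 0.9 - 1/4. The error n^0.99 of the hypothesis is far below the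
  accumulated gain.\<close>

section \<open>Edge sets and the uniform random graph\<close>

definition edges :: "nat set \<Rightarrow> nat set set" where
  "edges V = {e. e \<subseteq> V \<and> card e = 2}"

lemma all_edges_eq: "all_edges n = edges {..<n}"
  unfolding all_edges_def edges_def by (auto simp: card_2_iff)

lemma finite_edges [simp]: "finite V \<Longrightarrow> finite (edges V)"
  unfolding edges_def by simp

lemma card_edges: "finite V \<Longrightarrow> card (edges V) = card V choose 2"
  unfolding edges_def by (rule n_subsets)

lemma edges_mono: "V \<subseteq> W \<Longrightarrow> edges V \<subseteq> edges W"
  unfolding edges_def by auto

lemma edges_Int: "edges V \<inter> edges W = edges (V \<inter> W)"
  unfolding edges_def by auto

lemma indep_iff_edges: "indep E S \<longleftrightarrow> E \<inter> edges S = {}"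
proof
  assume a: "indep E S"
  show "E \<inter> edges S = {}"
  proof (rule ccontr)
    assume "E \<inter> edges S \<noteq> {}"
    then obtain e where e: "e \<in> E" "e \<subseteq> S" "card e = 2" unfolding edges_def by auto
    then obtain u v where "e = {u,v}" "u \<noteq> v" by (auto simp: card_2_iff)
    with a e show False unfolding indep_def by auto
  qed
next
  assume a: "E \<inter> edges S = {}"
  show "indep E S" unfolding indep_def
  proof (intro ballI impI)
    fix u v assume "u \<in> S" "v \<in> S" "u \<noteq> v"
    then have "{u,v} \<in> edges S" unfolding edges_def by auto
    with a show "{u,v} \<notin> E" by auto
  qed
qed

lemma graphs_eq: "graphs n = Pow (edges {..<n})"
  unfolding graphs_def all_edges_eq ..

lemma finite_graphs [simp]: "finite (graphs n)"
  unfolding graphs_eq by simp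

lemma card_graphs: "card (graphs n) = 2 ^ (n choose 2)"
  unfolding graphs_eq by (simp add: card_Pow card_edges)

lemma card_graphs_pos: "card (graphs n) > 0"
  by (simp add: card_graphs)

section \<open>Expectation and elementary inequalities\<close>

definition mean :: "nat \<Rightarrow> (nat set set \<Rightarrow> real) \<Rightarrow> real" where
  "mean n f = (\<Sum>E\<in>graphs n. f E) / real (card (graphs n))"

lemma gnp_prob_eq_mean: "gnp_prob n Q = mean n (\<lambda>E. of_bool (Q E))"
proof -
  have "(\<Sum>E\<in>graphs n. of_bool (Q E) :: real) = real (card {E \<in> graphs n. Q E})"
    by (simp add: Collect_conj_eq)
  then show ?thesis unfolding gnp_prob_def mean_def by simp
qed

lemma mean_add: "mean n (\<lambda>E. f E + g E) = mean n f + mean n g"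
  unfolding mean_def by (simp add: sum.distrib add_divide_distrib)

lemma mean_cmult: "mean n (\<lambda>E. c * f E) = c * mean n f"
  unfolding mean_def by (simp add: sum_distrib_left[symmetric])

lemma mean_const: "mean n (\<lambda>E. c) = c"
  unfolding mean_def using card_graphs_pos[of n] by (simp add: card_graphs)

lemma mean_mono: "(\<And>E. E \<in> graphs n \<Longrightarrow> f E \<le> g E) \<Longrightarrow> mean n f \<le> mean n g"
  unfolding mean_def by (intro divide_right_mono sum_mono) auto

lemma mean_sum: "mean n (\<lambda>E. \<Sum>i\<in>I. f i E) = (\<Sum>i\<in>I. mean n (f i))"
  unfolding mean_def by (subst sum.swap) (simp add: sum_divide_distrib)

lemma gnp_prob_mono: "(\<And>E. E \<in> graphs n \<Longrightarrow> Q E \<Longrightarrow> R E) \<Longrightarrow> gnp_prob n Q \<le> gnp_prob n R"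
  unfolding gnp_prob_eq_mean by (rule mean_mono) auto

lemma gnp_prob_compl: "gnp_prob n (\<lambda>E. \<not> Q E) = 1 - gnp_prob n Q"
proof -
  have "gnp_prob n (\<lambda>E. \<not> Q E) + gnp_prob n Q = mean n (\<lambda>E. 1)"
    unfolding gnp_prob_eq_mean mean_add[symmetric] by (rule arg_cong[where f="mean n"]) auto
  then show ?thesis by (simp add: mean_const)
qed

lemma gnp_prob_disj_le: "gnp_prob n (\<lambda>E. Q E \<or> R E) \<le> gnp_prob n Q + gnp_prob n R"
  unfolding gnp_prob_eq_mean mean_add[symmetric] by (rule mean_mono) auto

lemma gnp_prob_both:
  assumes "gnp_prob n Q + gnp_prob n R > 1"
  shows "\<exists>E\<in>graphs n. Q E \<and> R E"
proof (rule ccontr)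
  assume "\<not> ?thesis"
  then have "gnp_prob n Q \<le> gnp_prob n (\<lambda>E. \<not> R E)"
    by (intro gnp_prob_mono) auto
  with assms show False by (simp add: gnp_prob_compl)
qed

lemma markov:
  assumes "\<And>E. E \<in> graphs n \<Longrightarrow> f E \<ge> 0" "c > 0"
  shows "gnp_prob n (\<lambda>E. f E \<ge> c) \<le> mean n f / c"
proof -
  have "mean n (\<lambda>E. c * of_bool (f E \<ge> c)) \<le> mean n f"
    by (rule mean_mono) (use assms in auto)
  then show ?thesis using assms unfolding mean_cmult gnp_prob_eq_mean
    by (simp add: field_simps)
qed

lemma mean_abs_le_sqrt: "mean n (\<lambda>E. \<bar>f E\<bar>) \<le> sqrt (mean n (\<lambda>E. (f E)\<^sup>2))"
proof -
  let ?G = "graphs n" and ?N = "real (card (graphs n))"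
  have N: "?N > 0" using card_graphs_pos by simp
  have "(\<Sum>E\<in>?G. \<bar>f E\<bar>)\<^sup>2 \<le> (\<Sum>E\<in>?G. (1::real)\<^sup>2) * (\<Sum>E\<in>?G. \<bar>f E\<bar>\<^sup>2)"
    using Cauchy_Schwarz_ineq_sum[of "\<lambda>_. 1" "\<lambda>E. \<bar>f E\<bar>" ?G] by simp
  then have "(mean n (\<lambda>E. \<bar>f E\<bar>))\<^sup>2 \<le> mean n (\<lambda>E. (f E)\<^sup>2)"
    unfolding mean_def using N by (simp add: power_divide field_simps power2_eq_square)
  then show ?thesis by (rule real_le_rsqrt)
qed

text \<open>The edges in \<open>Z\<close>, in \<open>D\<close> and elsewhere are chosen
  independently: those in \<open>Z\<close> are forced to be absent, those in \<open>D\<close> carry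
  the event \<open>Q\<close>, and each remaining edge contributes a factor 2. Independence is thus
  expressed by counting, without a product measure.\<close>

lemma card_Pow_avoid:
  assumes "finite U" "Z \<subseteq> U" "D \<subseteq> U" "Z \<inter> D = {}"
  shows "card {E \<in> Pow U. E \<inter> Z = {} \<and> Q (E \<inter> D)} = card {F \<in> Pow D. Q F} * 2 ^ (card U - card Z - card D)"
proof -
  let ?R = "U - Z - D"
  have "bij_betw (\<lambda>(F, G). F \<union> G) ({F \<in> Pow D. Q F} \<times> Pow ?R) {E \<in> Pow U. E \<inter> Z = {} \<and> Q (E \<inter> D)}"
  proof (rule bij_betw_byWitness[where f' = "\<lambda>E. (E \<inter> D, E - D)"])
    have *: "(F \<union> G) \<inter> D = F" if "F \<subseteq> D" "G \<subseteq> ?R" for F G using that by auto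
    show "\<forall>a\<in>{F \<in> Pow D. Q F} \<times> Pow ?R. (\<lambda>E. (E \<inter> D, E - D)) ((\<lambda>(F, G). F \<union> G) a) = a"
      by auto
    show "(\<lambda>(F, G). F \<union> G) ` ({F \<in> Pow D. Q F} \<times> Pow ?R) \<subseteq> {E \<in> Pow U. E \<inter> Z = {} \<and> Q (E \<inter> D)}"
    proof
      fix E assume "E \<in> (\<lambda>(F, G). F \<union> G) ` ({F \<in> Pow D. Q F} \<times> Pow ?R)"
      then obtain F G where FG: "F \<subseteq> D" "Q F" "G \<subseteq> ?R" "E = F \<union> G" by auto
      then show "E \<in> {E \<in> Pow U. E \<inter> Z = {} \<and> Q (E \<inter> D)}"
        using assms *[OF FG(1,3)] by auto
    qed
    show "(\<lambda>E. (E \<inter> D, E - D)) ` {E \<in> Pow U. E \<inter> Z = {} \<and> Q (E \<inter> D)} \<subseteq> {F \<in> Pow D. Q F} \<times> Pow ?R"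
      by auto
  qed auto
  from bij_betw_same_card[OF this]
  have "card {E \<in> Pow U. E \<inter> Z = {} \<and> Q (E \<inter> D)} = card {F \<in> Pow D. Q F} * card (Pow ?R)"
    by (simp only: card_cartesian_product)
  moreover have "card ?R = card U - card Z - card D"
  proof -
    have "finite Z" "finite D" using assms(1-3) by (auto intro: finite_subset)
    then show ?thesis using assms by (subst card_Diff_subset) (auto simp: card_Diff_subset)
  qed
  ultimately show ?thesis using assms by (simp add: card_Pow)
qed

lemma gnp_prob_avoid:
  assumes "Z \<subseteq> edges {..<n}"
  shows "gnp_prob n (\<lambda>E. E \<inter> Z = {}) = 2 powr - real (card Z)"
proof -
  let ?U = "edges {..<n}"
  have fin: "finite ?U" by simp
  have "card {E \<in> Pow ?U. E \<inter> Z = {} \<and> True} = card {F \<in> Pow {}. True} * 2 ^ (card ?U - card Z - card {})"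
    using card_Pow_avoid[of ?U Z "{}" "\<lambda>_. True"] assms by simp
  then have "card {E \<in> graphs n. E \<inter> Z = {}} = 2 ^ (card ?U - card Z)"
    unfolding graphs_eq by simp
  moreover have "card Z \<le> card ?U" by (rule card_mono[OF fin assms])
  ultimately have "card {E \<in> graphs n. E \<inter> Z = {}} * 2 ^ card Z = 2 ^ (n choose 2)"
    by (simp only: power_add[symmetric] le_add_diff_inverse2) (simp add: card_edges)
  from arg_cong[OF this, of real]
  have "real (card {E \<in> graphs n. E \<inter> Z = {}}) * 2 ^ card Z = 2 ^ (n choose 2)"
    by simp
  then show ?thesis
    unfolding gnp_prob_def by (simp add: card_graphs powr_minus powr_realpow field_simps)
qed

section \<open>Colourability of arbitrary vertex sets\<close>

text \<open>Allowing fewer than \<open>m\<close> classes makes the notion monotone, and the vertex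
  set is free because the complement of a planted set is not an initial segment.\<close>

definition colourable :: "nat set \<Rightarrow> nat set set \<Rightarrow> nat \<Rightarrow> bool" where
  "colourable V E m \<longleftrightarrow> (\<exists>P. partition_on V P \<and> card P \<le> m \<and> (\<forall>S\<in>P. indep E S))"

lemma chromatic_le_iff: "chromatic n E \<le> m \<longleftrightarrow> colourable {..<n} E m"
proof -
  let ?R = "\<lambda>k. \<exists>P. partition_on {..<n} P \<and> card P = k \<and> (\<forall>S\<in>P. indep E S)"
  have "?R (card ((\<lambda>v. {v}) ` {..<n}))"
    using partition_on_singletons[of "{..<n}"] by (intro exI conjI) (auto simp: indep_def)
  then have "?R (chromatic n E)" unfolding chromatic_def by (rule LeastI)
  moreover have "chromatic n E \<le> k" if "?R k" for k
    unfolding chromatic_def using that by (rule Least_le)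
  ultimately show ?thesis unfolding colourable_def by (metis le_trans)
qed

lemma chromatic_le_chi_bounded:
  assumes "t \<ge> 1"
  shows "chromatic n E \<le> chi_bounded t n E"
proof -
  let ?P = "(\<lambda>v. {v}) ` {..<n}"
  have "?P \<in> ucols n E (card ?P) t"
    using partition_on_singletons[of "{..<n}"] assms unfolding ucols_def by (auto simp: indep_def)
  then have "ucols n E (card ?P) t \<noteq> {}" by auto
  then have "ucols n E (chi_bounded t n E) t \<noteq> {}"
    unfolding chi_bounded_def by (rule LeastI)
  then show ?thesis unfolding chromatic_le_iff colourable_def ucols_def by auto
qed

text \<open>Makes colourability of \<open>W\<close> an event about the edges inside
  \<open>W\<close>, hence independent of the edges inside a set disjoint from
  \<open>W\<close>.\<close>

lemma colourable_restrict:
  "colourable W E m \<longleftrightarrow> colourable W (E \<inter> edges W) m"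
proof -
  have "indep E S \<longleftrightarrow> indep (E \<inter> edges W) S" if "partition_on W P" "S \<in> P" for P S
  proof -
    have "S \<subseteq> W" using that by (auto simp: partition_on_def)
    then show ?thesis using edges_mono[of S W] unfolding indep_iff_edges by auto
  qed
  then show ?thesis unfolding colourable_def by metis
qed

lemma colourable_Suc:
  assumes "finite V" "S \<subseteq> V" "S \<noteq> {}" "indep E S" "colourable (V - S) E m"
  shows "colourable V E (Suc m)"
proof -
  obtain P where P: "partition_on (V - S) P" "card P \<le> m" "\<forall>S\<in>P. indep E S"
    using assms unfolding colourable_def by auto
  have "partition_on V (insert S P)"
    using P(1) assms(2,3) by (auto simp: partition_on_def disjoint_def)
  moreover have "card (insert S P) \<le> Suc m"
    using P(2) card_insert_le_m1[of "Suc m" P S] by simp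
  ultimately show ?thesis unfolding colourable_def using P(3) assms(4) by auto
qed

lemma colourable_image:
  assumes f: "inj_on f W" and F: "F \<subseteq> edges W" and c: "colourable W F m"
  shows "colourable (f ` W) ((`) f ` F) m"
proof -
  obtain P where P: "partition_on W P" "card P \<le> m" "\<forall>S\<in>P. indep F S"
    using c unfolding colourable_def by auto
  let ?Q = "(`) f ` P - {{}}"
  have 1: "partition_on (f ` W) ?Q"
    by (rule partition_on_inj_image[OF P(1) f])
  have ne: "{} \<notin> P" using P(1) by (rule partition_onD3)
  then have Q: "?Q = (`) f ` P" by auto
  have inj: "inj_on ((`) f) P"
    using f P(1) by (intro inj_on_subset[OF inj_on_image_Pow[OF f]]) (auto simp: partition_on_def)
  have 2: "card ?Q \<le> m" unfolding Q using P(2) by (simp add: card_image inj)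
  have 3: "indep ((`) f ` F) T" if "T \<in> ?Q" for T
  proof -
    have "T \<in> (`) f ` P" using that by blast
    then obtain S where S: "S \<in> P" "T = f ` S" by blast
    have SW: "S \<subseteq> W" using S P(1) by (auto simp: partition_on_def)
    show ?thesis unfolding indep_iff_edges
    proof (rule ccontr)
      assume "(`) f ` F \<inter> edges T \<noteq> {}"
      then obtain e where e: "e \<in> F" "f ` e \<subseteq> f ` S" "card (f ` e) = 2"
        unfolding S edges_def by auto
      have eW: "e \<subseteq> W" "card e = 2" using e F unfolding edges_def by auto
      have "e \<subseteq> S" using e(2) f eW SW by (meson inj_on_image_subset_iff)
      then show False using P(3) S e(1) eW unfolding indep_iff_edges edges_def by auto
    qed
  qed
  show ?thesis unfolding colourable_def using 1 2 3 by blast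
qed

text \<open>A bijection of \<open>{..<n}\<close> with \<open>W\<close> carries colourable graphs
  injectively to colourable graphs. One inequality is enough, since planting bounds a probability
  from below.\<close>

lemma card_colourable_le:
  assumes "finite W" "card W = n"
  shows "card {F \<in> graphs n. colourable {..<n} F m} \<le> card {F \<in> Pow (edges W). colourable W F m}"
proof -
  obtain f where f: "bij_betw f {..<n} W"
    using assms by (metis bij_betw_iff_card card_lessThan finite_lessThan)
  then have inj: "inj_on f {..<n}" and im: "f ` {..<n} = W" by (auto simp: bij_betw_def)
  have *: "card (f ` e) = card e" if "e \<subseteq> {..<n}" for e
    using card_image inj_on_subset[OF inj that] by blast
  show ?thesis
  proof (rule card_inj_on_le[where f = "(`) ((`) f)"])
    have "inj_on ((`) f) (edges {..<n})"
      by (rule inj_on_subset[OF inj_on_image_Pow[OF inj]]) (auto simp: edges_def)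
    from inj_on_image_Pow[OF this]
    show "inj_on ((`) ((`) f)) {F \<in> graphs n. colourable {..<n} F m}"
      by (rule inj_on_subset) (auto simp: graphs_eq)
    have "(`) f ` F \<in> Pow (edges W)" if "F \<subseteq> edges {..<n}" for F
      using that im unfolding edges_def by (fastforce simp: *)
    then show "(`) ((`) f) ` {F \<in> graphs n. colourable {..<n} F m} \<subseteq> {F \<in> Pow (edges W). colourable W F m}"
      using colourable_image[OF inj, of _ m] unfolding im by (auto simp: graphs_eq)
  qed (use assms in auto)
qed

section \<open>Planting an independent set\<close>

definition subsets_of :: "nat \<Rightarrow> nat \<Rightarrow> nat set set" where
  "subsets_of n a = {S. S \<subseteq> {..<n} \<and> card S = a}"

lemma finite_subsets_of [simp]: "finite (subsets_of n a)"
  unfolding subsets_of_def by (rule finite_subset[of _ "Pow {..<n}"]) auto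

lemma card_subsets_of: "card (subsets_of n a) = n choose a"
  unfolding subsets_of_def using n_subsets[of "{..<n}" a] by simp

definition num_indep :: "nat \<Rightarrow> nat \<Rightarrow> nat set set \<Rightarrow> nat" where
  "num_indep n a E = card {S \<in> subsets_of n a. indep E S}"

lemma num_indep_eq_sum: "real (num_indep n a E) = (\<Sum>S\<in>subsets_of n a. of_bool (indep E S))"
  unfolding num_indep_def by (simp add: Collect_conj_eq)

lemma gnp_prob_indep:
  assumes "S \<subseteq> {..<n}"
  shows "gnp_prob n (\<lambda>E. indep E S) = 2 powr - real (card S choose 2)"
  using gnp_prob_avoid[of "edges S" n] edges_mono[OF assms] finite_subset[OF assms]
  by (simp add: indep_iff_edges card_edges)

lemma mean_num_indep: "mean n (\<lambda>E. real (num_indep n a E)) = mu a n"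
proof -
  have "mean n (\<lambda>E. real (num_indep n a E)) = (\<Sum>S\<in>subsets_of n a. gnp_prob n (\<lambda>E. indep E S))"
    unfolding num_indep_eq_sum mean_sum gnp_prob_eq_mean ..
  also have "\<dots> = (\<Sum>S\<in>subsets_of n a. 2 powr - real (a choose 2))"
    by (intro sum.cong refl) (auto simp: subsets_of_def gnp_prob_indep)
  finally show ?thesis by (simp add: card_subsets_of mu_def)
qed

lemma choose_two_add: "(n + a) choose 2 = (n choose 2) + (a choose 2) + n * a"
  by (induction n) (auto simp: numeral_2_eq_2 algebra_simps)

text \<open>No edge lies both inside \<open>S\<close> and inside its complement, so the two events
  are independent; the \<open>n * a\<close> edges between the two sides are free.\<close>

lemma planted_prob:
  assumes "S \<in> subsets_of (n + a) a"
  shows "gnp_prob (n + a) (\<lambda>E. indep E S \<and> colourable ({..<n+a} - S) E m)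
          \<ge> 2 powr - real (a choose 2) * gnp_prob n (\<lambda>E. chromatic n E \<le> m)"
proof -
  let ?V = "{..<n+a}" let ?W = "?V - S"
  have S: "S \<subseteq> ?V" "card S = a" "finite S" using assms by (auto simp: subsets_of_def intro: finite_subset)
  have W: "finite ?W" "card ?W = n" using S by (auto simp: card_Diff_subset)
  have disj: "edges S \<inter> edges ?W = {}"
    using edges_Int[of S ?W] by (auto simp: edges_def)
  have "{E \<in> graphs (n+a). indep E S \<and> colourable ?W E m} =
        {E \<in> Pow (edges ?V). E \<inter> edges S = {} \<and> colourable ?W (E \<inter> edges ?W) m}"
    using colourable_restrict[of ?W _ m] by (auto simp: graphs_eq indep_iff_edges)
  also have "card \<dots> = card {F \<in> Pow (edges ?W). colourable ?W F m} * 2 ^ (n * a)"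
    by (subst card_Pow_avoid[where Q="\<lambda>F. colourable ?W F m"])
       (use S W disj in \<open>auto intro: edges_mono[THEN subsetD, rotated] simp: card_edges choose_two_add\<close>)
  finally have "card {E \<in> graphs (n+a). indep E S \<and> colourable ?W E m} \<ge>
        card {F \<in> graphs n. colourable {..<n} F m} * 2 ^ (n * a)" (is "?A \<ge> ?B * _")
    using card_colourable_le[OF W, of m] by simp
  then have "real ?A \<ge> real (?B * 2 ^ (n * a))" by (simp only: of_nat_le_iff)
  then have "real ?A \<ge> real ?B * 2 ^ (n * a)" by simp
  then show ?thesis unfolding gnp_prob_def chromatic_le_iff card_graphs choose_two_add
    by (simp add: power_add powr_minus powr_realpow field_simps)
qed

text \<open>Summing over all \<open>S\<close> turns planting into size bias: a graph with a
  uniformly placed planted set has density \<open>num_indep (n+a) a E / mu a (n+a)\<close> with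
  respect to the uniform graph. The extra colour is spent on \<open>S\<close>.\<close>

lemma mean_planted:
  assumes "a \<ge> 1"
  shows "mean (n+a) (\<lambda>E. real (num_indep (n+a) a E) * of_bool (chromatic (n+a) E \<le> Suc m))
    \<ge> mu a (n+a) * gnp_prob n (\<lambda>E. chromatic n E \<le> m)"
proof -
  let ?V = "{..<n+a}"
  have "mu a (n+a) * gnp_prob n (\<lambda>E. chromatic n E \<le> m) =
     (\<Sum>S\<in>subsets_of (n+a) a. 2 powr - real (a choose 2) * gnp_prob n (\<lambda>E. chromatic n E \<le> m))"
    by (simp add: card_subsets_of mu_def)
  also have "\<dots> \<le> (\<Sum>S\<in>subsets_of (n+a) a. gnp_prob (n + a) (\<lambda>E. indep E S \<and> colourable (?V - S) E m))"
    by (intro sum_mono planted_prob)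
  also have "\<dots> \<le> (\<Sum>S\<in>subsets_of (n+a) a. gnp_prob (n + a) (\<lambda>E. indep E S \<and> chromatic (n+a) E \<le> Suc m))"
  proof (intro sum_mono gnp_prob_mono)
    fix S E assume S: "S \<in> subsets_of (n+a) a" and E: "indep E S \<and> colourable (?V - S) E m"
    have "S \<noteq> {}" using S assms by (auto simp: subsets_of_def)
    then show "indep E S \<and> chromatic (n+a) E \<le> Suc m"
      using E S colourable_Suc[of ?V S E m] by (auto simp: subsets_of_def chromatic_le_iff)
  qed
  also have "\<dots> = mean (n+a) (\<lambda>E. real (num_indep (n+a) a E) * of_bool (chromatic (n+a) E \<le> Suc m))"
    unfolding num_indep_eq_sum gnp_prob_eq_mean sum_distrib_right mean_sum
    by (simp add: of_bool_conj)
  finally show ?thesis .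
qed

text \<open>Replacing the size-biased measure by the uniform one costs at most the mean of |X - mu|
  divided by mu, where X is the number of independent sets; Cauchy-Schwarz bounds that mean by the
  standard deviation.\<close>

lemma planting:
  assumes "a \<ge> 1" "mu a (n+a) > 0"
  shows "gnp_prob (n+a) (\<lambda>E. chromatic (n+a) E \<le> Suc m) \<ge> gnp_prob n (\<lambda>E. chromatic n E \<le> m)
    - sqrt (mean (n+a) (\<lambda>E. (real (num_indep (n+a) a E) - mu a (n+a))\<^sup>2)) / mu a (n+a)"
proof -
  let ?X = "\<lambda>E. real (num_indep (n+a) a E)" and ?I = "\<lambda>E. of_bool (chromatic (n+a) E \<le> Suc m) :: real"
  let ?\<mu> = "mu a (n+a)"
  have "mean (n+a) (\<lambda>E. ?X E * ?I E) \<le> mean (n+a) (\<lambda>E. ?\<mu> * ?I E + \<bar>?X E - ?\<mu>\<bar>)"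
    by (rule mean_mono) auto
  also have "\<dots> = ?\<mu> * gnp_prob (n+a) (\<lambda>E. chromatic (n+a) E \<le> Suc m) + mean (n+a) (\<lambda>E. \<bar>?X E - ?\<mu>\<bar>)"
    unfolding mean_add mean_cmult gnp_prob_eq_mean ..
  also have "\<dots> \<le> ?\<mu> * gnp_prob (n+a) (\<lambda>E. chromatic (n+a) E \<le> Suc m) + sqrt (mean (n+a) (\<lambda>E. (?X E - ?\<mu>)\<^sup>2))"
    using mean_abs_le_sqrt by (rule add_left_mono)
  finally show ?thesis using mean_planted[OF assms(1), of n m] assms(2) by (simp add: field_simps)
qed

section \<open>Second moment of the number of independent a-sets\<close>

lemma gnp_prob_indep2:
  assumes "S \<in> subsets_of n a" "T \<in> subsets_of n a"
  shows "gnp_prob n (\<lambda>E. indep E S \<and> indep E T) = 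
    2 powr - real (a choose 2) * 2 powr - real (a choose 2) * 2 ^ (card (S \<inter> T) choose 2)"
proof -
  have fin: "finite S" "finite T" using assms by (auto simp: subsets_of_def intro: finite_subset)
  have "card (edges S \<union> edges T) + card (edges (S \<inter> T)) = card (edges S) + card (edges T)"
    using card_Un_Int[of "edges S" "edges T"] fin by (simp add: edges_Int)
  then have "card (edges S \<union> edges T) + (card (S \<inter> T) choose 2) = (a choose 2) + (a choose 2)"
    using fin assms by (simp add: card_edges subsets_of_def)
  then have c: "real (card (edges S \<union> edges T)) = real (a choose 2) + real (a choose 2) - real (card (S \<inter> T) choose 2)"
    by linarith
  have "gnp_prob n (\<lambda>E. E \<inter> (edges S \<union> edges T) = {}) = 2 powr - real (card (edges S \<union> edges T))"
    by (rule gnp_prob_avoid) (use assms in \<open>auto simp: subsets_of_def dest: edges_mono\<close>)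
  moreover have "(\<lambda>E. E \<inter> (edges S \<union> edges T) = {}) = (\<lambda>E. indep E S \<and> indep E T)"
    by (auto simp: indep_iff_edges fun_eq_iff)
  ultimately show ?thesis unfolding c
    by (simp add: powr_realpow[symmetric] powr_add[symmetric] del: powr_realpow)
qed


lemma card_intersecting_le:
  assumes "S \<in> subsets_of n a"
  shows "card {T \<in> subsets_of n a. card (S \<inter> T) = l} \<le> (a choose l) * ((n - a) choose (a - l))"
proof -
  have S: "S \<subseteq> {..<n}" "card S = a" "finite S" using assms by (auto simp: subsets_of_def intro: finite_subset)
  let ?A = "{K. K \<subseteq> S \<and> card K = l}" and ?B = "{K. K \<subseteq> {..<n} - S \<and> card K = a - l}"
  have "card {T \<in> subsets_of n a. card (S \<inter> T) = l} \<le> card (?A \<times> ?B)"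
  proof (rule card_inj_on_le[where f = "\<lambda>T. (S \<inter> T, T - S)"])
    show "inj_on (\<lambda>T. (S \<inter> T, T - S)) {T \<in> subsets_of n a. card (S \<inter> T) = l}"
      by (auto simp: inj_on_def)
    have "card (T - S) = a - card (S \<inter> T)" if "T \<in> subsets_of n a" for T
      using that S by (subst card_Diff_subset_Int) (auto simp: subsets_of_def Int_commute)
    then show "(\<lambda>T. (S \<inter> T, T - S)) ` {T \<in> subsets_of n a. card (S \<inter> T) = l} \<subseteq> ?A \<times> ?B"
      by (auto simp: subsets_of_def)
    show "finite (?A \<times> ?B)" using S by (intro finite_cartesian_product) (auto intro: finite_subset[of _ "Pow S"] finite_subset[of _ "Pow {..<n}"])
  qed
  also have "\<dots> = (a choose l) * ((n - a) choose (a - l))"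
    using S n_subsets[of S l] n_subsets[of "{..<n} - S" "a - l"]
    by (simp add: card_cartesian_product card_Diff_subset)
  finally show ?thesis .
qed

text \<open>Two sets that meet in at most one vertex share no edge and have covariance 0. This is
  why the sum starts at overlap \<open>l = 2\<close>.\<close>

lemma variance_num_indep_le:
  "mean n (\<lambda>E. (real (num_indep n a E) - mu a n)\<^sup>2) \<le> mu a n *
    (\<Sum>l=2..a. real (a choose l) * real ((n - a) choose (a - l)) * 2 ^ (l choose 2) * 2 powr - real (a choose 2))"
proof -
  let ?I = "subsets_of n a" and ?p = "2 powr - real (a choose 2)"
  let ?X = "\<lambda>E. real (num_indep n a E)" and ?\<mu> = "mu a n"
  let ?c = "\<lambda>S T. card (S \<inter> T) choose 2"
  have X2: "mean n (\<lambda>E. (?X E)\<^sup>2) = (\<Sum>S\<in>?I. \<Sum>T\<in>?I. ?p * ?p * 2 ^ ?c S T)"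
  proof -
    have "mean n (\<lambda>E. (?X E)\<^sup>2) = (\<Sum>S\<in>?I. \<Sum>T\<in>?I. gnp_prob n (\<lambda>E. indep E S \<and> indep E T))"
      unfolding num_indep_eq_sum power2_eq_square sum_product mean_sum gnp_prob_eq_mean
      by (simp add: of_bool_conj)
    also have "\<dots> = (\<Sum>S\<in>?I. \<Sum>T\<in>?I. ?p * ?p * 2 ^ ?c S T)"
      by (intro sum.cong refl gnp_prob_indep2) auto
    finally show ?thesis .
  qed
  have "mean n (\<lambda>E. (?X E - ?\<mu>)\<^sup>2) = mean n (\<lambda>E. (?X E)\<^sup>2 + ((- 2 * ?\<mu>) * ?X E + ?\<mu>\<^sup>2))"
    by (simp add: power2_eq_square algebra_simps)
  also have "\<dots> = mean n (\<lambda>E. (?X E)\<^sup>2) - ?\<mu>\<^sup>2"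
    unfolding mean_add mean_cmult mean_const mean_num_indep by (simp add: power2_eq_square)
  also have "\<dots> = (\<Sum>S\<in>?I. \<Sum>T\<in>?I. ?p * ?p * (2 ^ ?c S T - 1))"
    unfolding X2 by (simp add: mu_def card_subsets_of power2_eq_square right_diff_distrib sum_subtractf algebra_simps)
  also have "\<dots> \<le> (\<Sum>S\<in>?I. \<Sum>l=2..a. ?p * ?p * (real (a choose l) * real ((n - a) choose (a - l)) * 2 ^ (l choose 2)))"
  proof (intro sum_mono)
    fix S assume S: "S \<in> ?I"
    then have fS: "finite S" "card S = a" by (auto simp: subsets_of_def intro: finite_subset)
    have le: "card (S \<inter> T) \<le> a" for T using card_mono[of S "S \<inter> T"] fS by auto
    have "(\<Sum>T\<in>?I. ?p * ?p * (2 ^ ?c S T - 1)) = (\<Sum>l=0..a. \<Sum>T\<in>{T\<in>?I. card (S \<inter> T) = l}. ?p * ?p * (2 ^ ?c S T - 1))"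
      by (rule sum.group[symmetric]) (use le in auto)
    also have "\<dots> = (\<Sum>l=0..a. real (card {T\<in>?I. card (S \<inter> T) = l}) * (?p * ?p * (2 ^ (l choose 2) - 1)))"
      by (intro sum.cong refl) simp
    also have "\<dots> = (\<Sum>l=2..a. real (card {T\<in>?I. card (S \<inter> T) = l}) * (?p * ?p * (2 ^ (l choose 2) - 1)))"
    proof (rule sum.mono_neutral_right)
      show "\<forall>l\<in>{0..a} - {2..a}. real (card {T\<in>?I. card (S \<inter> T) = l}) * (?p * ?p * (2 ^ (l choose 2) - 1)) = 0"
      proof
        fix l assume "l \<in> {0..a} - {2..a}"
        then have "l < 2" by auto
        then have "(2::real) ^ (l choose 2) = 1" by (subst binomial_eq_0) auto
        then show "real (card {T\<in>?I. card (S \<inter> T) = l}) * (?p * ?p * (2 ^ (l choose 2) - 1)) = 0" by simp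
      qed
    qed auto
    also have "\<dots> \<le> (\<Sum>l=2..a. ?p * ?p * (real (a choose l) * real ((n - a) choose (a - l)) * 2 ^ (l choose 2)))"
    proof (intro sum_mono)
      fix l
      have "real (card {T\<in>?I. card (S \<inter> T) = l}) \<le> real (a choose l) * real ((n - a) choose (a - l))"
        using card_intersecting_le[OF S, of l] by (simp only: of_nat_le_iff flip: of_nat_mult)
      then have "real (card {T\<in>?I. card (S \<inter> T) = l}) * (?p * ?p * (2 ^ (l choose 2) - 1)) \<le> 
        (real (a choose l) * real ((n - a) choose (a - l))) * (?p * ?p * 2 ^ (l choose 2))"
        by (intro mult_mono mult_left_mono) auto
      then show "real (card {T\<in>?I. card (S \<inter> T) = l}) * (?p * ?p * (2 ^ (l choose 2) - 1)) \<le> 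
        ?p * ?p * (real (a choose l) * real ((n - a) choose (a - l)) * 2 ^ (l choose 2))" by (simp only: mult_ac)
    qed
    finally show "(\<Sum>T\<in>?I. ?p * ?p * (2 ^ ?c S T - 1)) \<le> 
       (\<Sum>l=2..a. ?p * ?p * (real (a choose l) * real ((n - a) choose (a - l)) * 2 ^ (l choose 2)))" .
  qed
  also have "\<dots> = ?\<mu> * (\<Sum>l=2..a. real (a choose l) * real ((n - a) choose (a - l)) * 2 ^ (l choose 2) * ?p)"
    by (simp add: mu_def card_subsets_of sum_distrib_left mult_ac)
  finally show ?thesis .
qed

lemma choose_times_diff: "(n choose k) * (n - k) = Suc k * (n choose Suc k)"
proof (cases n)
  case (Suc m)
  then show ?thesis using binomial_absorb_comp[of n k] Suc_times_binomial[of k m] by (simp add: mult.commute)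
qed simp

text \<open>Each step down from \<open>a\<close> to \<open>a - l\<close> multiplies the binomial
  coefficient by (k + 1) / (n - k), which is at most a / (n - a).\<close>

lemma choose_diff_le:
  assumes "l \<le> a" "a \<le> n"
  shows "(n choose (a - l)) * (n - a) ^ l \<le> (n choose a) * a ^ l"
  using assms
proof (induction l)
  case (Suc l)
  obtain k where k: "a - l = Suc k" "a - Suc l = k" using Suc.prems by (cases "a - l") auto
  note choose_times_diff[of n k]
  moreover have "n - a \<le> n - k" "Suc k \<le> a" using k by auto
  ultimately have "(n choose k) * (n - a) \<le> a * (n choose Suc k)"
    by (metis le_trans mult_le_mono1 mult_le_mono2)
  then have "(n choose k) * (n - a) * (n - a) ^ l \<le> a * (n choose Suc k) * (n - a) ^ l" by (rule mult_le_mono1)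
  also have "\<dots> \<le> a * ((n choose a) * a ^ l)" using Suc k by simp
  finally show ?case by (simp add: k mult_ac)
qed simp

lemma choose_two_real: "real (a choose 2) = real a * (real a - 1) / 2"
  by (induction a) (auto simp: numeral_2_eq_2 field_simps)

lemma sum_geometric_le:
  fixes q :: real
  assumes "0 \<le> q" "q \<le> 1/2"
  shows "(\<Sum>i\<in>{m..<n}. q ^ i) \<le> 2 * q ^ m"
proof (cases "m < n")
  case True
  have "(\<Sum>i\<in>{m..<n}. q ^ i) * (1 - q) = q ^ m - q ^ n"
    using True assms sum_gp[of q m "n-1"] by (cases n) (auto simp: atLeastLessThanSuc_atLeastAtMost)
  also have "\<dots> \<le> q ^ m" using assms by simp
  finally have *: "(\<Sum>i\<in>{m..<n}. q ^ i) * (1 - q) \<le> q ^ m" .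
  have "(\<Sum>i\<in>{m..<n}. q ^ i) * (1/2) \<le> (\<Sum>i\<in>{m..<n}. q ^ i) * (1 - q)"
    using assms by (intro mult_left_mono sum_nonneg) auto
  with * show ?thesis by simp
qed (use assms in auto)

text \<open>Overlaps are split at a / 3. Below, \<open>2 ^ (l choose 2)\<close> costs at most
  2^(a/6) per common vertex and the terms are dominated by \<open>mu a n * q ^ l\<close>; above,
  counted by \<open>u = a - l\<close>, they are dominated by \<open>z ^ u\<close>. The diagonal
  \<open>u = 0\<close> contributes 1 and the rest a bounded amount, so the variance is of the order
  of the mean, as for a Poisson variable.\<close>

lemma variance_num_indep_le_four_mu:
  fixes a n :: nat
  defines "q \<equiv> real a ^ 2 / real (n - a) * 2 powr (real a / 6)"
    and "z \<equiv> real a * real n * 2 powr (1/2 - 2 * real a / 3)"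
  assumes an: "a < n" and q: "q \<le> 1/2" "2 * mu a n * q\<^sup>2 \<le> 1" and z: "z \<le> 1/2"
  shows "mean n (\<lambda>E. (real (num_indep n a E) - mu a n)\<^sup>2) \<le> 4 * mu a n"
proof -
  let ?p = "2 powr - real (a choose 2)" and ?\<mu> = "mu a n"
  let ?f = "\<lambda>l. real (a choose l) * real ((n - a) choose (a - l)) * 2 ^ (l choose 2) * ?p"
  have q0: "q \<ge> 0" and z0: "z \<ge> 0" unfolding q_def z_def by auto
  have \<mu>0: "?\<mu> \<ge> 0" unfolding mu_def by auto
  have small: "?f l \<le> ?\<mu> * q ^ l" if l: "real l \<le> real a / 3" for l
  proof (cases "l = 0")
    case True
    have "real ((n - a) choose a) \<le> real (n choose a)"
      by (simp add: binomial_right_mono)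
    then show ?thesis using True by (simp add: mu_def mult_right_mono binomial_eq_0)
  next
    case False
    have l': "l \<le> a" using l by auto
    have 1: "real (a choose l) \<le> real a ^ l"
      using binomial_le_pow[OF l'] by (simp only: of_nat_le_iff flip: of_nat_power)
    have "(n choose (a - l)) * (n - a) ^ l \<le> (n choose a) * a ^ l"
      by (rule choose_diff_le) (use l' an in auto)
    then have "real (n choose (a - l)) * real (n - a) ^ l \<le> real (n choose a) * real a ^ l"
      by (simp only: of_nat_le_iff flip: of_nat_mult of_nat_power)
    then have "real (n choose (a - l)) \<le> real (n choose a) * (real a / real (n - a)) ^ l"
      using an by (simp add: field_simps)
    moreover have "real ((n - a) choose (a - l)) \<le> real (n choose (a - l))"
      by (simp add: binomial_right_mono)
    ultimately have 2: "real ((n - a) choose (a - l)) \<le> real (n choose a) * (real a / real (n - a)) ^ l" by linarith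
    have "(2::real) ^ (l choose 2) = 2 powr (real l * ((real l - 1) / 2))"
      by (simp add: powr_realpow[symmetric] choose_two_real)
    also have "\<dots> \<le> 2 powr (real l * (real a / 6))"
      using l by (intro powr_mono mult_left_mono) auto
    also have "\<dots> = (2 powr (real a / 6)) ^ l"
      by (subst powr_realpow[symmetric]) (simp_all add: powr_powr mult.commute)
    finally have 3: "(2::real) ^ (l choose 2) \<le> (2 powr (real a / 6)) ^ l" .
    have "?f l \<le> real a ^ l * (real (n choose a) * (real a / real (n - a)) ^ l) * (2 powr (real a / 6)) ^ l * ?p"
      by (intro mult_mono 1 2 3) auto
    also have "\<dots> = ?\<mu> * q ^ l" unfolding mu_def q_def
      by (simp add: power_mult_distrib power_divide power2_eq_square field_simps)
    finally show ?thesis .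
  qed
  have large: "?f l \<le> z ^ (a - l)" if l: "real l > real a / 3" "l \<le> a" for l
  proof -
    define u where "u = a - l"
    have u: "l = a - u" "u \<le> a" "real l = real a - real u" using l by (auto simp: u_def)
    have 1: "real (a choose l) \<le> real a ^ u"
    proof -
      have "a choose l \<le> a ^ u"
        using binomial_le_pow[OF u(2)] binomial_symmetric[OF l(2)] by (simp only: u_def)
      then show ?thesis by (simp only: of_nat_le_iff flip: of_nat_power)
    qed
    have "(n - a) choose u \<le> (n - a) ^ u" by (cases "u \<le> n - a") (auto simp: binomial_le_pow binomial_eq_0)
    also have "\<dots> \<le> n ^ u" by (intro power_mono) auto
    finally have 2: "real ((n - a) choose u) \<le> real n ^ u"
      by (simp only: of_nat_le_iff flip: of_nat_power)
    have e: "real (l choose 2) + - real (a choose 2) = real u * (- (real a - (real u + 1) / 2))"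
      by (simp add: choose_two_real u(3) field_simps)
    have "2 ^ (l choose 2) * ?p = 2 powr (real u * (- (real a - (real u + 1) / 2)))"
      unfolding e[symmetric] by (simp only: powr_add powr_realpow zero_less_numeral)
    also have "\<dots> \<le> 2 powr (real u * (1/2 - 2 * real a / 3))"
    proof (intro powr_mono mult_left_mono)
      \<comment> \<open>From \<open>l > a / 3\<close> follows u < 2a/3, so (u + 1) / 2 is below a/3
        + 1/2.\<close>
      show "- (real a - (real u + 1) / 2) \<le> 1/2 - 2 * real a / 3"
      proof -
        have "- (x - (y + 1) / 2) \<le> 1/2 - 2 * x / 3" if "x / 3 < x - y" for x y :: real
          using that by (simp add: field_simps)
        then show ?thesis using l(1) u(3) by simp
      qed
    qed auto
    also have "\<dots> = (2 powr (1/2 - 2 * real a / 3)) ^ u"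
      by (subst powr_realpow[symmetric]) (simp_all add: powr_powr mult.commute)
    finally have 3: "2 ^ (l choose 2) * ?p \<le> (2 powr (1/2 - 2 * real a / 3)) ^ u" .
    have "?f l = real (a choose l) * real ((n - a) choose u) * (2 ^ (l choose 2) * ?p)" by (simp add: u_def)
    also have "\<dots> \<le> real a ^ u * real n ^ u * (2 powr (1/2 - 2 * real a / 3)) ^ u"
      by (intro mult_mono 1 2 3) auto
    also have "\<dots> = z ^ u" unfolding z_def by (simp add: power_mult_distrib)
    finally show ?thesis unfolding u_def .
  qed
  have "(\<Sum>l=2..a. ?f l) \<le> (\<Sum>l=2..a. ?\<mu> * q ^ l + z ^ (a - l))"
  proof (intro sum_mono)
    fix l assume "l \<in> {2..a}"
    then show "?f l \<le> ?\<mu> * q ^ l + z ^ (a - l)"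
      using small[of l] large[of l] q0 z0 \<mu>0 
      by (cases "real l \<le> real a / 3") (auto intro: add_increasing add_increasing2)
  qed
  also have "\<dots> = ?\<mu> * (\<Sum>l\<in>{2..<Suc a}. q ^ l) + (\<Sum>l=2..a. z ^ (a - l))"
    by (simp add: sum.distrib sum_distrib_left atLeastLessThanSuc_atLeastAtMost)
  also have "(\<Sum>l=2..a. z ^ (a - l)) \<le> (\<Sum>l=0..a. z ^ (a - l))"
    using z0 by (intro sum_mono2) auto
  also have "(\<Sum>l=0..a. z ^ (a - l)) = (\<Sum>u\<in>{0..<Suc a}. z ^ u)"
    by (rule sum.reindex_bij_witness[of _ "\<lambda>u. a - u" "\<lambda>l. a - l"]) auto
  also have "\<dots> \<le> 2" using sum_geometric_le[OF z0 z, of 0 "Suc a"] by simp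
  also have "?\<mu> * (\<Sum>l\<in>{2..<Suc a}. q ^ l) \<le> ?\<mu> * (2 * q ^ 2)"
    by (intro mult_left_mono sum_geometric_le q0 q \<mu>0)
  finally have "(\<Sum>l=2..a. ?f l) \<le> 4" using q(2) by (simp add: mult_ac)
  then have "?\<mu> * (\<Sum>l=2..a. ?f l) \<le> ?\<mu> * 4" using \<mu>0 by (rule mult_left_mono)
  then show ?thesis using variance_num_indep_le[of n a] by simp
qed

section \<open>Sums over partitions\<close>

lemma finite_parts [simp]: "finite V \<Longrightarrow> finite {P. partition_on V P}"
  by (rule finitely_many_partition_on)

text \<open>Double counting: a partition with one marked class is a nonempty set together with a
  partition of its complement. Both weight computations below are inductions that remove a marked
  class.\<close>

lemma sum_partition_class:
  fixes h :: "'a set \<Rightarrow> 'a set set \<Rightarrow> real"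
  assumes "finite V"
  shows "(\<Sum>P | partition_on V P. \<Sum>S\<in>P. h S (P - {S})) =
    (\<Sum>S\<in>Pow V - {{}}. \<Sum>Q | partition_on (V - S) Q. h S Q)"
proof -
  have fP: "finite P" if "partition_on V P" for P
    using assms that by (rule finite_elements)
  have fQ: "finite {Q. partition_on (V - S) Q}" for S using assms by simp
  have rem: "partition_on (V - S) (P - {S})" if "partition_on V P" "S \<in> P" for P S
    using that unfolding partition_on_def disjoint_def by auto
  have ins: "partition_on V (insert S Q)" "S \<notin> Q"
    if "S \<subseteq> V" "S \<noteq> {}" "partition_on (V - S) Q" for S Q
    using that unfolding partition_on_def disjoint_def by auto
  have "(\<Sum>P | partition_on V P. \<Sum>S\<in>P. h S (P - {S})) =
     (\<Sum>(P, S)\<in>Sigma {P. partition_on V P} (\<lambda>P. P). h S (P - {S}))"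
    by (rule sum.Sigma) (use assms fP in auto)
  also have "\<dots> = (\<Sum>(S, Q)\<in>Sigma (Pow V - {{}}) (\<lambda>S. {Q. partition_on (V - S) Q}). h S Q)"
  proof (rule sum.reindex_bij_witness[where i = "\<lambda>(S, Q). (insert S Q, S)" and j = "\<lambda>(P, S). (S, P - {S})"])
    fix x assume "x \<in> Sigma {P. partition_on V P} (\<lambda>P. P)"
    then obtain P S where x: "x = (P, S)" "partition_on V P" "S \<in> P" by auto
    show "(case case x of (P, S) \<Rightarrow> (S, P - {S}) of (S, Q) \<Rightarrow> (insert S Q, S)) = x"
      using x by auto
    show "(case x of (P, S) \<Rightarrow> (S, P - {S})) \<in> (SIGMA S:Pow V - {{}}. {Q. partition_on (V - S) Q})"
      using x rem by (auto dest: partition_onD3 partition_onD1)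
    show "(case case x of (P, S) \<Rightarrow> (S, P - {S}) of (S, Q) \<Rightarrow> h S Q) = (case x of (P, S) \<Rightarrow> h S (P - {S}))"
      using x by auto
  next
    fix y assume "y \<in> (SIGMA S:Pow V - {{}}. {Q. partition_on (V - S) Q})"
    then obtain S Q where y: "y = (S, Q)" "S \<subseteq> V" "S \<noteq> {}" "partition_on (V - S) Q" by auto
    show "(case case y of (S, Q) \<Rightarrow> (insert S Q, S) of (P, S) \<Rightarrow> (S, P - {S})) = y"
      using y ins[OF y(2-4)] by auto
    show "(case y of (S, Q) \<Rightarrow> (insert S Q, S)) \<in> Sigma {P. partition_on V P} (\<lambda>P. P)"
      using y ins[OF y(2-4)] by auto
  qed
  also have "\<dots> = (\<Sum>S\<in>Pow V - {{}}. \<Sum>Q | partition_on (V - S) Q. h S Q)"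
    by (rule sum.Sigma[symmetric]) (use assms fQ in auto)
  finally show ?thesis .
qed

lemma sum_Pow_card:
  fixes \<phi> :: "nat \<Rightarrow> real"
  assumes "finite V"
  shows "(\<Sum>S\<in>Pow V - {{}}. \<phi> (card S)) = (\<Sum>i=1..card V. real (card V choose i) * \<phi> i)"
proof -
  have "(\<Sum>S\<in>Pow V - {{}}. \<phi> (card S)) =
      (\<Sum>i=1..card V. \<Sum>S\<in>{S \<in> Pow V - {{}}. card S = i}. \<phi> (card S))"
  proof (rule sum.group[symmetric])
    show "card ` (Pow V - {{}}) \<subseteq> {1..card V}"
      using assms finite_subset[OF _ assms] by (auto simp: card_mono Suc_le_eq card_gt_0_iff)
  qed (use assms in auto)
  also have "\<dots> = (\<Sum>i=1..card V. real (card V choose i) * \<phi> i)"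
  proof (rule sum.cong[OF refl])
    fix i assume "i \<in> {1..card V}"
    then have "{S \<in> Pow V - {{}}. card S = i} = {S. S \<subseteq> V \<and> card S = i}" by auto
    then have "card {S \<in> Pow V - {{}}. card S = i} = card V choose i"
      using n_subsets[OF assms, of i] by simp
    then show "(\<Sum>S\<in>{S \<in> Pow V - {{}}. card S = i}. \<phi> (card S)) = real (card V choose i) * \<phi> i"
      by simp
  qed
  finally show ?thesis .
qed

definition weight :: "(nat \<Rightarrow> real) \<Rightarrow> 'a set set \<Rightarrow> real" where
  "weight g P = (\<Prod>S\<in>P. g (card S))"

lemma weight_nonneg: "(\<And>i. g i \<ge> 0) \<Longrightarrow> weight g P \<ge> 0"
  unfolding weight_def by (simp add: prod_nonneg)

lemma weight_remove: "finite P \<Longrightarrow> S \<in> P \<Longrightarrow> weight g P = g (card S) * weight g (P - {S})"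
  unfolding weight_def by (rule prod.remove)

text \<open>The exponential formula, as an inequality between coefficients.\<close>

lemma sum_weight_card_le:
  fixes g :: "nat \<Rightarrow> real" and x :: real
  assumes g: "\<And>i. g i \<ge> 0" and x: "x > 0" and "finite V" "card V \<le> b"
  shows "(\<Sum>P | partition_on V P \<and> card P = k. weight g P)
     \<le> fact (card V) / x ^ card V * ((\<Sum>i=1..b. g i * x ^ i / fact i) ^ k / fact k)"
  using assms(3,4)
proof (induction k arbitrary: V)
  case 0
  show ?case
  proof (cases "V = {}")
    case True
    then have "{P. partition_on V P \<and> card P = 0} = {{}}"
      by (auto simp: partition_on_empty)
    then show ?thesis using True by (simp add: weight_def)
  next
    case False
    have "card P \<noteq> 0" if "partition_on V P" for P
      using finite_elements[OF 0(1) that] that False by (auto simp: partition_on_def)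
    then have "{P. partition_on V P \<and> card P = 0} = {}" by blast
    then show ?thesis using x by (simp only: sum.empty) simp
  qed
next
  case (Suc k)
  \<comment> \<open>The range ends at the fixed bound \<open>b\<close> and not at
    \<open>card V\<close>, so that the induction hypothesis for \<open>V - S\<close> speaks of the
    same \<open>?F\<close>.\<close>
  let ?F = "\<Sum>i=1..b. g i * x ^ i / fact i"
  let ?N = "card V"
  have F: "?F \<ge> 0" using g x by (intro sum_nonneg) auto
  have fin: "finite {P. partition_on V P}" using Suc by simp
  let ?h = "\<lambda>S Q. if card Q = k then g (card S) * weight g Q else 0"
  \<comment> \<open>Each partition into \<open>Suc k\<close> classes is counted once for every
    choice of the marked class; dividing by \<open>Suc k\<close> builds up the factorial.\<close>
  have "real (Suc k) * (\<Sum>P | partition_on V P \<and> card P = Suc k. weight g P) =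
     (\<Sum>P | partition_on V P \<and> card P = Suc k. \<Sum>S\<in>P. ?h S (P - {S}))"
    unfolding sum_distrib_left
  proof (rule sum.cong[OF refl])
    fix P assume "P \<in> {P. partition_on V P \<and> card P = Suc k}"
    then have P: "finite P" "card P = Suc k" using Suc by (auto dest: finite_elements)
    have "(\<Sum>S\<in>P. ?h S (P - {S})) = (\<Sum>S\<in>P. weight g P)"
      using P by (intro sum.cong refl) (simp add: weight_remove[OF P(1)])
    then show "real (Suc k) * weight g P = (\<Sum>S\<in>P. ?h S (P - {S}))" using P by simp
  qed
  also have "\<dots> = (\<Sum>P | partition_on V P. \<Sum>S\<in>P. ?h S (P - {S}))"
  proof (rule sum.mono_neutral_left[OF fin])
    show "\<forall>P\<in>{P. partition_on V P} - {P. partition_on V P \<and> card P = Suc k}. (\<Sum>S\<in>P. ?h S (P - {S})) = 0"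
    proof (intro ballI sum.neutral)
      fix P S assume "P \<in> {P. partition_on V P} - {P. partition_on V P \<and> card P = Suc k}" "S \<in> P"
      then have P: "card P \<noteq> Suc k" "finite P" "S \<in> P" using Suc by (auto dest: finite_elements)
      then have "card P > 0" by (auto simp: card_gt_0_iff)
      then have "card (P - {S}) \<noteq> k" using P by (simp add: card_Diff_singleton)
      then show "?h S (P - {S}) = 0" by simp
    qed
  qed auto
  also have "\<dots> = (\<Sum>S\<in>Pow V - {{}}. \<Sum>Q | partition_on (V - S) Q. ?h S Q)"
    by (rule sum_partition_class) (rule Suc.prems)
  also have "\<dots> = (\<Sum>S\<in>Pow V - {{}}. g (card S) * (\<Sum>Q | partition_on (V - S) Q \<and> card Q = k. weight g Q))"
  proof (rule sum.cong[OF refl])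
    fix S
    have "(\<Sum>Q | partition_on (V - S) Q. ?h S Q) = (\<Sum>Q\<in>{Q \<in> {Q. partition_on (V - S) Q}. card Q = k}. g (card S) * weight g Q)"
      using Suc.prems by (subst sum.inter_filter) auto
    then show "(\<Sum>Q | partition_on (V - S) Q. ?h S Q) = g (card S) * (\<Sum>Q | partition_on (V - S) Q \<and> card Q = k. weight g Q)"
      by (simp add: sum_distrib_left)
  qed
  also have "\<dots> \<le> (\<Sum>S\<in>Pow V - {{}}. g (card S) * (fact (?N - card S) / x ^ (?N - card S) * (?F ^ k / fact k)))"
  proof (intro sum_mono mult_left_mono g)
    fix S assume S: "S \<in> Pow V - {{}}"
    then have "card (V - S) = ?N - card S" using Suc.prems by (auto intro: card_Diff_subset finite_subset)
    then show "(\<Sum>Q | partition_on (V - S) Q \<and> card Q = k. weight g Q) \<le> fact (?N - card S) / x ^ (?N - card S) * (?F ^ k / fact k)"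
      using Suc.IH[of "V - S"] Suc.prems by simp
  qed
  also have "\<dots> = (\<Sum>i=1..?N. real (?N choose i) * (g i * (fact (?N - i) / x ^ (?N - i) * (?F ^ k / fact k))))"
    by (rule sum_Pow_card) (rule Suc.prems)
  also have "\<dots> = (\<Sum>i=1..?N. g i * x ^ i / fact i) * (fact ?N / x ^ ?N * (?F ^ k / fact k))"
    unfolding sum_distrib_right
  proof (rule sum.cong[OF refl])
    fix i assume i: "i \<in> {1..?N}"
    then have "real (?N choose i) = fact ?N / (fact i * fact (?N - i))"
      by (intro binomial_fact) auto
    moreover have "x ^ ?N = x ^ i * x ^ (?N - i)" using i by (simp flip: power_add)
    ultimately show "real (?N choose i) * (g i * (fact (?N - i) / x ^ (?N - i) * (?F ^ k / fact k))) = 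
       g i * x ^ i / fact i * (fact ?N / x ^ ?N * (?F ^ k / fact k))"
      using x by (simp add: divide_simps mult.commute[of "fact i" "fact (?N - i)"])
  qed
  also have "\<dots> \<le> ?F * (fact ?N / x ^ ?N * (?F ^ k / fact k))"
    using F x g Suc.prems by (intro mult_right_mono sum_mono2 mult_nonneg_nonneg) auto
  finally have "real (Suc k) * (\<Sum>P | partition_on V P \<and> card P = Suc k. weight g P) \<le> 
    ?F * (fact ?N / x ^ ?N * (?F ^ k / fact k))" .
  then have "(\<Sum>P | partition_on V P \<and> card P = Suc k. weight g P) \<le> 
    ?F * (fact ?N / x ^ ?N * (?F ^ k / fact k)) / real (Suc k)"
    by (subst pos_le_divide_eq) (auto simp: mult.commute)
  also have "\<dots> = fact ?N / x ^ ?N * (?F ^ Suc k / fact (Suc k))"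
    by (simp add: field_simps)
  finally show ?case .
qed

lemma sum_power_div_fact_le_exp:
  fixes x :: real
  assumes "finite I" "x \<ge> 0"
  shows "(\<Sum>k\<in>I. x ^ k / fact k) \<le> exp x"
proof -
  have "(\<lambda>k. x ^ k / fact k) sums exp x"
    using exp_converges[of x] by (simp add: scaleR_conv_of_real field_simps)
  from sum_le_suminf[OF sums_summable[OF this] assms(1)] sums_unique[OF this] assms(2)
  show ?thesis by simp
qed

text \<open>Adding the bounds for the different numbers of classes produces a partial sum of the
  exponential series.\<close>

lemma sum_weight_le_exp:
  fixes g :: "nat \<Rightarrow> real" and x :: real
  assumes g: "\<And>i. g i \<ge> 0" and x: "x > 0" and V: "finite V"
  shows "(\<Sum>P | partition_on V P. weight g P) \<le> fact (card V) / x ^ card V * exp (\<Sum>i=1..card V. g i * x ^ i / fact i)"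
proof -
  let ?F = "\<Sum>i=1..card V. g i * x ^ i / fact i"
  have F: "?F \<ge> 0" using g x by (intro sum_nonneg) auto
  have fin: "finite {P. partition_on V P}" using V by simp
  define m where "m = Max (card ` {P. partition_on V P})"
  have m: "card P \<le> m" if "partition_on V P" for P
    unfolding m_def using that fin by (intro Max_ge) auto
  have "(\<Sum>P | partition_on V P. weight g P) = (\<Sum>k\<le>m. \<Sum>P\<in>{P\<in>{P. partition_on V P}. card P = k}. weight g P)"
    by (rule sum.group[symmetric]) (use fin m in auto)
  also have "\<dots> \<le> (\<Sum>k\<le>m. fact (card V) / x ^ card V * (?F ^ k / fact k))"
    using sum_weight_card_le[OF g x V le_refl] by (intro sum_mono) simp
  also have "\<dots> = fact (card V) / x ^ card V * (\<Sum>k\<le>m. ?F ^ k / fact k)"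
    by (simp add: sum_distrib_left)
  also have "\<dots> \<le> fact (card V) / x ^ card V * exp ?F"
    using x F by (intro mult_left_mono sum_power_div_fact_le_exp) auto
  finally show ?thesis .
qed

definition sizes :: "'a set set \<Rightarrow> nat multiset" where
  "sizes P = image_mset card (mset_set P)"

lemma sizes_remove: "finite P \<Longrightarrow> S \<in> P \<Longrightarrow> sizes P = add_mset (card S) (sizes (P - {S}))"
  unfolding sizes_def by (simp add: mset_set.remove)

text \<open>With prescribed class sizes the partitions are counted exactly, by the multinomial
  coefficient divided by the permutations of classes of equal size. The induction peels off a class
  whose size is the element of \<open>K\<close> added last.\<close>

lemma sum_weight_sizes:
  fixes g :: "nat \<Rightarrow> real"
  assumes "finite I" "set_mset K \<subseteq> I" "0 \<notin># K" "finite V" "sum_mset K = card V"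
  shows "(\<Sum>P | partition_on V P \<and> sizes P = K. weight g P) =
    fact (card V) * (\<Prod>i\<in>I. (g i / fact i) ^ count K i / fact (count K i))"
  using assms(2-)
proof (induction K arbitrary: V)
  case empty
  then have "V = {}" by simp
  then have "{P. partition_on V P \<and> sizes P = {#}} = {{}}"
    by (auto simp: partition_on_empty sizes_def)
  then show ?case using \<open>V = {}\<close> by (simp add: weight_def)
next
  case (add i K)
  let ?K = "add_mset i K"
  let ?N = "card V"
  have i: "i > 0" "i \<in> I" using add.prems by (auto intro: gr0I)
  have iN: "i \<le> ?N" "sum_mset K = ?N - i" using add.prems by auto
  have fin: "finite {P. partition_on V P}" using add.prems by simp
  let ?h = "\<lambda>S Q. if card S = i \<and> sizes Q = K then g i * weight g Q else 0"
  \<comment> \<open>Only classes of size \<open>i\<close> may be marked, and every partition with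
    sizes \<open>?K\<close> has \<open>count ?K i\<close> of them.\<close>
  have "real (count ?K i) * (\<Sum>P | partition_on V P \<and> sizes P = ?K. weight g P) =
     (\<Sum>P | partition_on V P \<and> sizes P = ?K. \<Sum>S\<in>P. ?h S (P - {S}))"
    unfolding sum_distrib_left
  proof (rule sum.cong[OF refl])
    fix P assume "P \<in> {P. partition_on V P \<and> sizes P = ?K}"
    then have P: "finite P" "sizes P = ?K" using add.prems by (auto dest: finite_elements)
    have "sizes (P - {S}) = K" if "S \<in> P" "card S = i" for S
      using sizes_remove[OF P(1) that(1)] P(2) that(2) by simp
    then have "(\<Sum>S\<in>P. ?h S (P - {S})) = (\<Sum>S\<in>P. if card S = i then weight g P else 0)"
      using P by (intro sum.cong refl) (auto simp: weight_remove[OF P(1)])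
    also have "\<dots> = (\<Sum>S\<in>{S\<in>P. card S = i}. weight g P)"
      using P by (subst sum.inter_filter) auto
    also have "\<dots> = real (count ?K i) * weight g P"
    proof -
      have "card {S\<in>P. card S = i} = count (sizes P) i"
        unfolding sizes_def count_image_mset' using P(1)
        by (simp add: sum.inter_filter[symmetric] eq_commute[of i])
      then show ?thesis using P by simp
    qed
    finally show "real (count ?K i) * weight g P = (\<Sum>S\<in>P. ?h S (P - {S}))" by simp
  qed
  also have "\<dots> = (\<Sum>P | partition_on V P. \<Sum>S\<in>P. ?h S (P - {S}))"
  proof (rule sum.mono_neutral_left[OF fin])
    show "\<forall>P\<in>{P. partition_on V P} - {P. partition_on V P \<and> sizes P = ?K}. (\<Sum>S\<in>P. ?h S (P - {S})) = 0"
    proof (intro ballI sum.neutral)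
      fix P S assume "P \<in> {P. partition_on V P} - {P. partition_on V P \<and> sizes P = ?K}" "S \<in> P"
      then have P: "sizes P \<noteq> ?K" "finite P" "S \<in> P" using add.prems by (auto dest: finite_elements)
      then show "?h S (P - {S}) = 0" using sizes_remove[OF P(2,3)] by auto
    qed
  qed auto
  also have "\<dots> = (\<Sum>S\<in>Pow V - {{}}. \<Sum>Q | partition_on (V - S) Q. ?h S Q)"
    by (rule sum_partition_class) (rule add.prems)
  also have "\<dots> = (\<Sum>S\<in>Pow V - {{}}. if card S = i then g i * (fact (?N - i) * (\<Prod>j\<in>I. (g j / fact j) ^ count K j / fact (count K j))) else 0)"
  proof (rule sum.cong[OF refl])
    fix S assume S: "S \<in> Pow V - {{}}"
    show "(\<Sum>Q | partition_on (V - S) Q. ?h S Q) =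
       (if card S = i then g i * (fact (?N - i) * (\<Prod>j\<in>I. (g j / fact j) ^ count K j / fact (count K j))) else 0)"
    proof (cases "card S = i")
      case True
      have c: "card (V - S) = ?N - i" using S True add.prems by (auto intro: card_Diff_subset finite_subset)
      have "(\<Sum>Q | partition_on (V - S) Q. ?h S Q) = (\<Sum>Q\<in>{Q \<in> {Q. partition_on (V - S) Q}. sizes Q = K}. g i * weight g Q)"
        using add.prems True by (subst sum.inter_filter) auto
      also have "\<dots> = g i * (\<Sum>Q | partition_on (V - S) Q \<and> sizes Q = K. weight g Q)"
        by (simp add: sum_distrib_left)
      also have "\<dots> = g i * (fact (?N - i) * (\<Prod>j\<in>I. (g j / fact j) ^ count K j / fact (count K j)))"
        by (subst add.IH) (use add.prems iN c in auto)
      finally show ?thesis using True by simp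
    qed auto
  qed
  also have "\<dots> = (\<Sum>j=1..?N. real (?N choose j) * (if j = i then g i * (fact (?N - i) * (\<Prod>j\<in>I. (g j / fact j) ^ count K j / fact (count K j))) else 0))"
    by (rule sum_Pow_card) (rule add.prems)
  also have "\<dots> = real (?N choose i) * (g i * (fact (?N - i) * (\<Prod>j\<in>I. (g j / fact j) ^ count K j / fact (count K j))))"
    using i iN by (simp add: if_distrib[of "\<lambda>x. _ * x"] sum.delta' cong: if_cong)
  also have "\<dots> = fact ?N * (g i / fact i * (\<Prod>j\<in>I. (g j / fact j) ^ count K j / fact (count K j)))"
    using iN by (simp add: binomial_fact)
  also have "(\<Prod>j\<in>I. (g j / fact j) ^ count K j / fact (count K j)) = 
     (g i / fact i) ^ count K i / fact (count K i) * (\<Prod>j\<in>I - {i}. (g j / fact j) ^ count K j / fact (count K j))"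
    using assms(1) i(2) by (rule prod.remove)
  also have "(\<Prod>j\<in>I - {i}. (g j / fact j) ^ count K j / fact (count K j)) =
      (\<Prod>j\<in>I - {i}. (g j / fact j) ^ count ?K j / fact (count ?K j))"
    by (intro prod.cong) auto
  finally have "real (count ?K i) * (\<Sum>P | partition_on V P \<and> sizes P = ?K. weight g P) =
     fact ?N * (g i / fact i * ((g i / fact i) ^ count K i / fact (count K i) * (\<Prod>j\<in>I - {i}. (g j / fact j) ^ count ?K j / fact (count ?K j))))" .
  then have "(\<Sum>P | partition_on V P \<and> sizes P = ?K. weight g P) =
     fact ?N * ((g i / fact i) ^ count ?K i / fact (count ?K i) * (\<Prod>j\<in>I - {i}. (g j / fact j) ^ count ?K j / fact (count ?K j)))"
    by (simp add: field_simps del: of_nat_Suc)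
  then show ?case using prod.remove[OF assms(1) i(2), of "\<lambda>j. (g j / fact j) ^ count ?K j / fact (count ?K j)"] by simp
qed

section \<open>Expected numbers of colourings\<close>

definition colour_weight :: "nat \<Rightarrow> real" where
  "colour_weight i = 2 powr - real (i choose 2)"

lemma gnp_prob_all_indep:
  assumes "partition_on {..<n} P"
  shows "gnp_prob n (\<lambda>E. \<forall>S\<in>P. indep E S) = weight colour_weight P"
proof -
  let ?Z = "\<Union>(edges ` P)"
  have fin: "finite P" using assms by (auto intro: finite_elements)
  have sub: "S \<subseteq> {..<n}" "finite S" if "S \<in> P" for S
    using that assms by (auto simp: partition_on_def intro: finite_subset[of _ "{..<n}"])
  have disj: "edges S \<inter> edges T = {}" if "S \<in> P" "T \<in> P" "S \<noteq> T" for S T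
  proof -
    have "S \<inter> T = {}" using that assms by (auto simp: partition_on_def disjoint_def)
    then show ?thesis unfolding edges_Int by (simp add: edges_def)
  qed
  have "card ?Z = (\<Sum>S\<in>P. card (edges S))"
    by (rule card_UN_disjoint) (use fin sub disj in auto)
  also have "\<dots> = (\<Sum>S\<in>P. card S choose 2)" using sub by (simp add: card_edges)
  finally have c: "card ?Z = (\<Sum>S\<in>P. card S choose 2)" .
  have "gnp_prob n (\<lambda>E. E \<inter> ?Z = {}) = 2 powr - real (card ?Z)"
    by (rule gnp_prob_avoid) (use sub edges_mono in blast)
  also have "\<dots> = weight colour_weight P"
    unfolding c weight_def colour_weight_def using fin by (simp add: powr_sum flip: sum_negf)
  also have "(\<lambda>E. E \<inter> ?Z = {}) = (\<lambda>E. \<forall>S\<in>P. indep E S)"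
    by (auto simp: indep_iff_edges fun_eq_iff)
  finally show ?thesis .
qed

lemma mean_card_colourings:
  "mean n (\<lambda>E. real (card {P. partition_on {..<n} P \<and> R P \<and> (\<forall>S\<in>P. indep E S)})) =
    (\<Sum>P | partition_on {..<n} P \<and> R P. weight colour_weight P)"
proof -
  let ?A = "{P. partition_on {..<n} P \<and> R P}"
  have fin: "finite ?A" by (rule finite_subset[of _ "{P. partition_on {..<n} P}"]) auto
  have "real (card {P. partition_on {..<n} P \<and> R P \<and> (\<forall>S\<in>P. indep E S)}) =
      (\<Sum>P\<in>?A. of_bool (\<forall>S\<in>P. indep E S))" for E
  proof -
    have "{P. partition_on {..<n} P \<and> R P \<and> (\<forall>S\<in>P. indep E S)} = ?A \<inter> {P. \<forall>S\<in>P. indep E S}" by auto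
    then show ?thesis using fin by simp
  qed
  then have "mean n (\<lambda>E. real (card {P. partition_on {..<n} P \<and> R P \<and> (\<forall>S\<in>P. indep E S)})) = 
     (\<Sum>P\<in>?A. gnp_prob n (\<lambda>E. \<forall>S\<in>P. indep E S))"
    by (simp only: mean_sum gnp_prob_eq_mean)
  also have "\<dots> = (\<Sum>P\<in>?A. weight colour_weight P)"
    by (intro sum.cong refl gnp_prob_all_indep) auto
  finally show ?thesis .
qed

lemma E_nkt_eq: "E_nkt n k t = (\<Sum>P | partition_on {..<n} P \<and> card P = k \<and> (\<forall>S\<in>P. card S \<le> t). weight colour_weight P)"
proof -
  have "ucols n E k t = {P. partition_on {..<n} P \<and> (card P = k \<and> (\<forall>S\<in>P. card S \<le> t)) \<and> (\<forall>S\<in>P. indep E S)}" for E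
    unfolding ucols_def by auto
  then show ?thesis
    unfolding E_nkt_def using mean_card_colourings[of n "\<lambda>P. card P = k \<and> (\<forall>S\<in>P. card S \<le> t)"] by (simp add: mean_def)
qed

text \<open>The coefficient of \<open>x ^ i\<close> in the exponential generating function of a
  single colour class.\<close>

definition dens :: "nat \<Rightarrow> real" where
  "dens i = colour_weight i / fact i"

lemma dens_pos [simp]: "dens i > 0"
  unfolding dens_def colour_weight_def by simp

lemma dens_nonneg [simp]: "dens i \<ge> 0"
  by (simp add: less_imp_le)

lemma dens_neq_0 [simp]: "dens i \<noteq> 0"
  using dens_pos[of i] by linarith

lemma dens_Suc_0 [simp]: "dens (Suc 0) = 1"
  unfolding dens_def colour_weight_def by simp

text \<open>A Chernoff bound in two variables: as \<theta> and \<eta> are at most 1, the factors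
  \<open>\<theta> powr (card P - K)\<close> and
  \<open>\<eta> powr (card {S\<in>P. card S = a} - J)\<close> are at least 1 on the partitions in
  question. Once they are inserted, the sum is extended to all partitions and the exponential
  formula applies.\<close>

lemma gnp_prob_colouring_le:
  fixes x \<theta> \<eta> J K :: real
  assumes "1 \<le> a" "a \<le> n" "x > 0" "0 < \<theta>" "\<theta> \<le> 1" "0 < \<eta>" "\<eta> \<le> 1"
  shows "gnp_prob n (\<lambda>E. \<exists>P. partition_on {..<n} P \<and> real (card P) \<le> K \<and> (\<forall>S\<in>P. card S \<le> a) \<and>
            real (card {S\<in>P. card S = a}) \<le> J \<and> (\<forall>S\<in>P. indep E S))
    \<le> fact n / x ^ n * \<theta> powr (-K) * \<eta> powr (-J) * exp (\<theta> * ((\<Sum>i\<in>{1..<a}. dens i * x ^ i) + \<eta> * dens a * x ^ a))"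
proof -
  define R where "R = (\<lambda>P :: nat set set. real (card P) \<le> K \<and> (\<forall>S\<in>P. card S \<le> a) \<and> real (card {S\<in>P. card S = a}) \<le> J)"
  let ?A = "{P. partition_on {..<n} P \<and> R P}"
  define g where "g = (\<lambda>i. if i \<le> a then \<theta> * (if i = a then \<eta> else 1) * colour_weight i else 0)"
  have cw: "colour_weight i \<ge> 0" for i unfolding colour_weight_def by simp
  have g: "g i \<ge> 0" for i unfolding g_def using assms cw by auto
  have fin: "finite ?A" by (rule finite_subset[of _ "{P. partition_on {..<n} P}"]) auto
  have "gnp_prob n (\<lambda>E. \<exists>P. partition_on {..<n} P \<and> real (card P) \<le> K \<and> (\<forall>S\<in>P. card S \<le> a) \<and>
            real (card {S\<in>P. card S = a}) \<le> J \<and> (\<forall>S\<in>P. indep E S))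
     \<le> mean n (\<lambda>E. real (card {P. partition_on {..<n} P \<and> R P \<and> (\<forall>S\<in>P. indep E S)}))"
    unfolding gnp_prob_eq_mean
  proof (rule mean_mono)
    fix E
    let ?B = "{P. partition_on {..<n} P \<and> R P \<and> (\<forall>S\<in>P. indep E S)}"
    have finB: "finite ?B" by (rule finite_subset[of _ "{P. partition_on {..<n} P}"]) auto
    show "of_bool (\<exists>P. partition_on {..<n} P \<and> real (card P) \<le> K \<and> (\<forall>S\<in>P. card S \<le> a) \<and>
            real (card {S\<in>P. card S = a}) \<le> J \<and> (\<forall>S\<in>P. indep E S)) \<le> real (card ?B)"
    proof (cases "?B = {}")
      case False
      then have "card ?B \<ge> 1" using finB by (simp add: Suc_le_eq card_gt_0_iff)
      then show ?thesis by (simp add: of_bool_def)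
    next
      case True
      then show ?thesis unfolding R_def by (auto simp: of_bool_def)
    qed
  qed
  also have "\<dots> = (\<Sum>P\<in>?A. weight colour_weight P)" by (rule mean_card_colourings)
  also have "\<dots> \<le> (\<Sum>P\<in>?A. \<theta> powr (-K) * \<eta> powr (-J) * weight g P)"
  proof (rule sum_mono)
    fix P assume P: "P \<in> ?A"
    then have fP: "finite P" by (auto intro: finite_elements)
    have "weight g P = (\<Prod>S\<in>P. \<theta> * (if card S = a then \<eta> else 1) * colour_weight (card S))"
      unfolding weight_def by (rule prod.cong) (use P in \<open>auto simp: g_def R_def\<close>)
    also have "\<dots> = \<theta> ^ card P * (\<Prod>S\<in>P. (if card S = a then \<eta> else 1)) * weight colour_weight P"
      by (simp add: prod.distrib weight_def)
    also have "(\<Prod>S\<in>P. (if card S = a then \<eta> else 1)) = \<eta> ^ card {S\<in>P. card S = a}"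
      using fP by (subst prod.inter_filter[symmetric]) auto
    finally have w: "weight g P = \<theta> ^ card P * \<eta> ^ card {S\<in>P. card S = a} * weight colour_weight P" .
    have "1 \<le> \<theta> powr (real (card P) - K)"
      using powr_mono'[of "real (card P) - K" 0 \<theta>] P assms by (auto simp: R_def)
    moreover have "1 \<le> \<eta> powr (real (card {S\<in>P. card S = a}) - J)"
      using powr_mono'[of "real (card {S\<in>P. card S = a}) - J" 0 \<eta>] P assms by (auto simp: R_def)
    ultimately have "1 * 1 \<le> \<theta> powr (real (card P) - K) * \<eta> powr (real (card {S\<in>P. card S = a}) - J)"
      by (intro mult_mono) auto
    also have "\<dots> = \<theta> powr (-K) * \<eta> powr (-J) * (\<theta> ^ card P * \<eta> ^ card {S\<in>P. card S = a})"
      using assms by (simp add: powr_diff powr_minus powr_realpow field_simps)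
    finally have "1 * weight colour_weight P \<le> 
       \<theta> powr (-K) * \<eta> powr (-J) * (\<theta> ^ card P * \<eta> ^ card {S\<in>P. card S = a}) * weight colour_weight P"
      by (intro mult_right_mono weight_nonneg cw) simp
    then show "weight colour_weight P \<le> \<theta> powr (-K) * \<eta> powr (-J) * weight g P"
      unfolding w by (simp add: mult_ac)
  qed
  also have "\<dots> = \<theta> powr (-K) * \<eta> powr (-J) * (\<Sum>P\<in>?A. weight g P)"
    by (simp add: sum_distrib_left)
  also have "\<dots> \<le> \<theta> powr (-K) * \<eta> powr (-J) * (\<Sum>P | partition_on {..<n} P. weight g P)"
    by (intro mult_left_mono sum_mono2 weight_nonneg g) auto
  also have "\<dots> \<le> \<theta> powr (-K) * \<eta> powr (-J) * (fact n / x ^ n * exp (\<Sum>i=1..n. g i * x ^ i / fact i))"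
    using sum_weight_le_exp[of g x "{..<n}", OF g assms(3)] by (intro mult_left_mono) auto
  also have "(\<Sum>i=1..n. g i * x ^ i / fact i) = (\<Sum>i\<in>{1..<Suc a}. g i * x ^ i / fact i)"
    by (rule sum.mono_neutral_right) (use assms in \<open>auto simp: g_def\<close>)
  also have "\<dots> = (\<Sum>i\<in>{1..<a}. g i * x ^ i / fact i) + g a * x ^ a / fact a"
    using assms by (simp add: sum.atLeastLessThan_Suc)
  also have "(\<Sum>i\<in>{1..<a}. g i * x ^ i / fact i) = \<theta> * (\<Sum>i\<in>{1..<a}. dens i * x ^ i)"
    unfolding sum_distrib_left by (rule sum.cong) (auto simp: g_def dens_def)
  also have "g a * x ^ a / fact a = \<theta> * (\<eta> * dens a * x ^ a)"
    by (simp add: g_def dens_def)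
  finally show ?thesis by (simp add: algebra_simps)
qed

section \<open>Lower bound from a single profile of class sizes\<close>

lemma ln_fact_ge: "n \<ge> 1 \<Longrightarrow> ln (fact n) \<ge> real n * ln (real n) - real n"
proof -
  assume n: "n \<ge> 1"
  have "real n ^ n / fact n \<le> exp (real n)"
    using sum_power_div_fact_le_exp[of "{n}" "real n"] by simp
  then have "real n ^ n \<le> exp (real n) * fact n" by (simp add: field_simps)
  then have "ln (real n ^ n) \<le> ln (exp (real n) * fact n)" using n by (subst ln_le_cancel_iff) auto
  then show ?thesis using n by (simp add: ln_mult ln_realpow)
qed

text \<open>The induction step is (n + 1) * ln (1 + 1 / n) \<ge> 1. The additional
  \<open>1 + ln n\<close> is later paid once per class size, so it stays polylogarithmic.\<close>

lemma ln_fact_le: "n \<ge> 1 \<Longrightarrow> ln (fact n) \<le> 1 + ln (real n) + real n * ln (real n) - real n"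
proof (induction n rule: dec_induct)
  case (step n)
  have n: "real n > 0" using step by simp
  have "ln (real n / (real n + 1)) \<le> real n / (real n + 1) - 1"
    using n by (intro ln_le_minus_one) auto
  also have "\<dots> = - 1 / (real n + 1)" by (simp add: field_simps)
  finally have "ln (real n) + 1 / (real n + 1) \<le> ln (real n + 1)" using n by (simp add: ln_div)
  then have "(real n + 1) * (ln (real n) + 1 / (real n + 1)) \<le> (real n + 1) * ln (real n + 1)"
    by (intro mult_left_mono) auto
  then have *: "(real n + 1) * ln (real n) + 1 \<le> (real n + 1) * ln (real n + 1)"
    using n by (simp add: distrib_left[of _ "ln (real n)"])
  have "ln (fact (Suc n)) = ln (real n + 1) + ln (fact n)"
    by (simp add: ln_mult add.commute)
  also have "\<dots> \<le> ln (real n + 1) + (1 + ln (real n) + real n * ln (real n) - real n)" using step by simp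
  also have "\<dots> \<le> 1 + ln (real (Suc n)) + real (Suc n) * ln (real (Suc n)) - real (Suc n)"
    using * by (simp add: algebra_simps)
  finally show ?case .
qed simp

text \<open>Dropping all partitions except those with the one size multiset \<open>K\<close> leaves
  a sum that is known exactly.\<close>

lemma E_nkt_ge_profile:
  fixes \<kappa> :: "nat \<Rightarrow> nat"
  assumes "(\<Sum>i=1..b. i * \<kappa> i) = n"
  shows "E_nkt n (\<Sum>i=1..b. \<kappa> i) b \<ge> fact n * (\<Prod>i=1..b. dens i ^ \<kappa> i / fact (\<kappa> i))"
proof -
  define K where "K = (\<Sum>i=1..b. replicate_mset (\<kappa> i) i)"
  have cw: "colour_weight i \<ge> 0" for i unfolding colour_weight_def by simp
  have cnt: "count K i = (if i \<in> {1..b} then \<kappa> i else 0)" for i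
    unfolding K_def count_sum by (simp add: if_distrib cong: if_cong)
  have set: "set_mset K \<subseteq> {1..b}"
    using cnt by (auto simp: set_mset_def split: if_splits)
  have size: "size K = (\<Sum>i=1..b. \<kappa> i)"
  proof -
    have "size (\<Sum>i\<in>I. replicate_mset (\<kappa> i) i) = (\<Sum>i\<in>I. \<kappa> i)" if "finite I" for I
      using that by induction auto
    then show ?thesis unfolding K_def by simp
  qed
  have summ: "sum_mset K = n"
  proof -
    have "sum_mset (\<Sum>i\<in>I. replicate_mset (\<kappa> i) i) = (\<Sum>i\<in>I. i * \<kappa> i)" if "finite I" for I
      using that by induction (auto simp: sum_mset_replicate_mset mult.commute)
    then show ?thesis using assms unfolding K_def by simp
  qed
  have fin: "finite {P. partition_on {..<n} P \<and> card P = (\<Sum>i=1..b. \<kappa> i) \<and> (\<forall>S\<in>P. card S \<le> b)}"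
    by (rule finite_subset[of _ "{P. partition_on {..<n} P}"]) auto
  have "(\<Sum>P | partition_on {..<n} P \<and> sizes P = K. weight colour_weight P) \<le> E_nkt n (\<Sum>i=1..b. \<kappa> i) b"
    unfolding E_nkt_eq
  proof (rule sum_mono2[OF fin])
    show "{P. partition_on {..<n} P \<and> sizes P = K} \<subseteq> {P. partition_on {..<n} P \<and> card P = (\<Sum>i=1..b. \<kappa> i) \<and> (\<forall>S\<in>P. card S \<le> b)}"
    proof clarify
      fix P assume P: "partition_on {..<n} P" "K = sizes P"
      then have fP: "finite P" by (auto intro: finite_elements)
      have "card P = size K" unfolding P sizes_def by simp
      moreover have "card S \<le> b" if "S \<in> P" for S
      proof -
        have "card S \<in># K" unfolding P sizes_def using that fP by simp
        then show ?thesis using set by auto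
      qed
      ultimately show "card P = (\<Sum>i=1..b. \<kappa> i) \<and> (\<forall>S\<in>P. card S \<le> b)" using size by simp
    qed
  qed (use weight_nonneg[OF cw] in auto)
  moreover have "(\<Sum>P | partition_on {..<n} P \<and> sizes P = K. weight colour_weight P) =
     fact (card {..<n}) * (\<Prod>i\<in>{1..b}. (colour_weight i / fact i) ^ count K i / fact (count K i))"
    by (rule sum_weight_sizes) (use set summ in auto)
  moreover have "(\<Prod>i\<in>{1..b}. (colour_weight i / fact i) ^ count K i / fact (count K i)) = (\<Prod>i=1..b. dens i ^ \<kappa> i / fact (\<kappa> i))"
    by (rule prod.cong) (auto simp: cnt dens_def)
  ultimately show ?thesis by simp
qed

lemma fact_add_le_pow: "fact (k + s) \<le> fact k * (k + s) ^ s"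
proof (induction s)
  case (Suc s)
  have "fact (k + Suc s) = (k + Suc s) * fact (k + s)" by simp
  also have "\<dots> \<le> (k + Suc s) * (fact k * (k + s) ^ s)" using Suc by (intro mult_left_mono) auto
  also have "\<dots> \<le> (k + Suc s) * (fact k * (k + Suc s) ^ s)" by (intro mult_left_mono power_mono) auto
  finally show ?case by (simp add: mult_ac)
qed simp

text \<open>The profile rounds down the optimal one, \<open>M\<close> times the distribution with weights
  \<open>dens i * x ^ i\<close>; the vertices that are left over become singleton classes.\<close>

lemma E_nkt_ge_exp:
  fixes x :: real and b n :: nat
  defines "Q \<equiv> (\<Sum>i=1..b. dens i * x ^ i)"
  defines "M \<equiv> real n * Q / (\<Sum>i=1..b. real i * (dens i * x ^ i))"
  assumes b: "b \<ge> 1" and n: "n \<ge> 1" and x: "x \<ge> 1" and QM: "Q \<ge> M"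
  shows "\<exists>k. real k \<le> M + real b ^ 2 \<and> E_nkt n k b \<ge> exp (real n * ln (real n) - real n - real n * ln x
     + M * (ln (Q / M) + 1) - real b ^ 2 * ln (real n) - real b * (1 + ln (real n)) - real b * (ln (Q / M) + 1))"
proof -
  let ?I = "{1..b}"
  have fs: "(\<Sum>i\<in>?I. f i) > (0::real)" if "\<And>i. i \<in> ?I \<Longrightarrow> f i > 0" for f
    using that b by (intro sum_pos) auto
  have Q: "Q > 0" unfolding Q_def using x by (intro fs) auto
  have D: "(\<Sum>i=1..b. real i * (dens i * x ^ i)) > 0" using x by (intro fs) auto
  have M: "M > 0" unfolding M_def using n Q D by auto
  \<comment> \<open>The real-valued optimal profile. Its total is \<open>M\<close> by the definition
    of \<open>Q\<close>, and \<open>M\<close> is chosen such that it covers exactly \<open>n\<close>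
    vertices.\<close>
  define l where "l = (\<lambda>i. M * (dens i * x ^ i) / Q)"
  define \<kappa> where "\<kappa> = (\<lambda>i. nat \<lfloor>l i\<rfloor>)"
  have l0: "l i > 0" for i unfolding l_def using M Q x by simp
  have \<kappa>: "real (\<kappa> i) \<le> l i" "l i - 1 \<le> real (\<kappa> i)" for i
    using l0[of i] unfolding \<kappa>_def by linarith+
  have suml: "(\<Sum>i\<in>?I. l i) = M"
    unfolding l_def using Q by (simp add: Q_def flip: sum_divide_distrib sum_distrib_left)
  have sumil: "(\<Sum>i\<in>?I. real i * l i) = real n"
  proof -
    have "(\<Sum>i\<in>?I. real i * l i) = M * (\<Sum>i\<in>?I. real i * (dens i * x ^ i)) / Q"
      unfolding l_def by (simp add: sum_distrib_left sum_divide_distrib mult_ac)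
    also have "\<dots> = real n" unfolding M_def using Q D by simp
    finally show ?thesis .
  qed
  define m where "m = (\<Sum>i\<in>?I. i * \<kappa> i)"
  have rm: "real m = (\<Sum>i\<in>?I. real i * real (\<kappa> i))" unfolding m_def by simp
  have "real m \<le> real n" unfolding rm sumil[symmetric] by (intro sum_mono mult_left_mono \<kappa>) auto
  then have mn: "m \<le> n" by simp
  \<comment> \<open>Rounding down loses at most one class of each size \<open>i \<le> b\<close>,
    hence at most b^2 vertices.\<close>
  define s where "s = n - m"
  have s: "real s \<le> real b ^ 2"
  proof -
    have "real s = (\<Sum>i\<in>?I. real i * (l i - real (\<kappa> i)))"
      unfolding s_def using mn sumil rm by (simp add: right_diff_distrib sum_subtractf of_nat_diff)
    also have "\<dots> \<le> (\<Sum>i\<in>?I. real b * 1)"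
      using \<kappa> by (intro sum_mono mult_mono) (auto simp: algebra_simps)
    also have "\<dots> = real b ^ 2" by (simp add: power2_eq_square)
    finally show ?thesis .
  qed
  define \<kappa>' where "\<kappa>' = (\<lambda>i. \<kappa> i + (if i = 1 then s else 0))"
  have sum\<kappa>': "(\<Sum>i\<in>?I. f i * \<kappa>' i) = (\<Sum>i\<in>?I. f i * \<kappa> i) + f 1 * s" for f :: "nat \<Rightarrow> nat"
    unfolding \<kappa>'_def distrib_left sum.distrib using b by (simp add: if_distrib cong: if_cong)
  have tot: "(\<Sum>i\<in>?I. i * \<kappa>' i) = n"
    using sum\<kappa>'[of "\<lambda>i. i"] mn by (simp add: m_def s_def)
  have k: "real (\<Sum>i\<in>?I. \<kappa>' i) \<le> M + real b ^ 2"
  proof -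
    have "real (\<Sum>i\<in>?I. \<kappa>' i) = (\<Sum>i\<in>?I. real (\<kappa> i)) + real s" using sum\<kappa>'[of "\<lambda>_. 1"] by simp
    also have "(\<Sum>i\<in>?I. real (\<kappa> i)) \<le> M" unfolding suml[symmetric] by (intro sum_mono \<kappa>)
    finally show ?thesis using s by linarith
  qed
  have \<kappa>n: "\<kappa>' i \<le> n" if "i \<in> ?I" for i
  proof -
    have "\<kappa>' i \<le> i * \<kappa>' i" using that by simp
    also have "\<dots> \<le> n" unfolding tot[symmetric] using that by (intro member_le_sum) auto
    finally show ?thesis .
  qed
  let ?L = "ln (Q / M)"
  have L: "?L \<ge> 0" using QM M Q by (intro ln_ge_zero) (simp add: field_simps)
  have lnn: "ln (real n) \<ge> 0" using n by simp
  \<comment> \<open>Stirling's bound together with \<open>ln (\<kappa> i) \<le> ln (l i)\<close>: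
    the term \<open>ln (dens i)\<close> cancels and the rest is affine in \<open>i\<close>, so the
    sum depends only on the numbers of classes and of vertices.\<close>
  have term_ge: "ln (dens i ^ \<kappa>' i / fact (\<kappa>' i)) \<ge> real (\<kappa> i) * (?L - real i * ln x + 1) - (1 + ln (real n)) - (if i = 1 then real s * ln (real n) else 0)"
    if i: "i \<in> ?I" for i
  proof -
    have base: "real (\<kappa> i) * ln (dens i) - ln (fact (\<kappa> i)) \<ge> real (\<kappa> i) * (?L - real i * ln x + 1) - (1 + ln (real n))"
    proof (cases "\<kappa> i = 0")
      case False
      then have p: "real (\<kappa> i) > 0" "\<kappa> i \<ge> 1" by auto
      have "ln (real (\<kappa> i)) \<le> ln (l i)" using p \<kappa>[of i] l0[of i] by (subst ln_le_cancel_iff) auto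
      also have "\<dots> = ln (dens i) + real i * ln x - ?L"
        unfolding l_def using M Q x by (simp add: ln_mult ln_div ln_realpow)
      finally have "real (\<kappa> i) * ln (real (\<kappa> i)) \<le> real (\<kappa> i) * (ln (dens i) + real i * ln x - ?L)"
        using p by (intro mult_left_mono) auto
      moreover have "ln (real (\<kappa> i)) \<le> ln (real n)" using \<kappa>n[OF i] p by (subst ln_le_cancel_iff) (auto simp: \<kappa>'_def)
      ultimately show ?thesis using ln_fact_le[OF p(2)] by (simp add: algebra_simps)
    qed (use lnn in simp)
    have e: "ln (dens i ^ \<kappa>' i / fact (\<kappa>' i)) = real (\<kappa>' i) * ln (dens i) - ln (fact (\<kappa>' i))"
      by (simp add: ln_div ln_realpow)
    show ?thesis
    proof (cases "i = 1")
      case True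
      have "\<kappa> 1 + s \<le> n" using \<kappa>n[OF i] True by (simp add: \<kappa>'_def)
      have "fact (\<kappa> 1 + s) \<le> fact (\<kappa> 1) * (\<kappa> 1 + s) ^ s" by (rule fact_add_le_pow)
      also have "\<dots> \<le> fact (\<kappa> 1) * n ^ s" using \<open>\<kappa> 1 + s \<le> n\<close> by (intro mult_left_mono power_mono) auto
      finally have "real (fact (\<kappa> 1 + s)) \<le> real (fact (\<kappa> 1) * n ^ s)" by (simp only: of_nat_le_iff)
      then have "fact (\<kappa> 1 + s) \<le> fact (\<kappa> 1) * real n ^ s" by simp
      then have "ln (fact (\<kappa> 1 + s)) \<le> ln (fact (\<kappa> 1) * real n ^ s)" using n by (subst ln_le_cancel_iff) auto
      also have "\<dots> = ln (fact (\<kappa> 1)) + real s * ln (real n)" using n by (simp add: ln_mult ln_realpow)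
      finally show ?thesis using base e True by (simp add: \<kappa>'_def)
    next
      case False
      then show ?thesis using base e by (simp add: \<kappa>'_def)
    qed
  qed
  let ?Pr = "\<Prod>i\<in>?I. dens i ^ \<kappa>' i / fact (\<kappa>' i)"
  have Pr: "?Pr > 0" by (intro prod_pos) auto
  have sk: "(\<Sum>i\<in>?I. real (\<kappa> i)) \<ge> M - real b"
  proof -
    have "(\<Sum>i\<in>?I. l i - 1) \<le> (\<Sum>i\<in>?I. real (\<kappa> i))" by (intro sum_mono \<kappa>)
    then show ?thesis unfolding sum_subtractf suml by simp
  qed
  have "ln ?Pr = (\<Sum>i\<in>?I. ln (dens i ^ \<kappa>' i / fact (\<kappa>' i)))"
    by (rule ln_prod) auto
  also have "\<dots> \<ge> (\<Sum>i\<in>?I. real (\<kappa> i) * (?L - real i * ln x + 1) - (1 + ln (real n)) - (if i = 1 then real s * ln (real n) else 0))"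
    by (intro sum_mono term_ge)
  also have "(\<Sum>i\<in>?I. real (\<kappa> i) * (?L - real i * ln x + 1) - (1 + ln (real n)) - (if i = 1 then real s * ln (real n) else 0))
     = (\<Sum>i\<in>?I. real (\<kappa> i) * (?L - real i * ln x + 1)) - real b * (1 + ln (real n)) - real s * ln (real n)"
    using b by (simp only: sum_subtractf) simp
  also have "(\<Sum>i\<in>?I. real (\<kappa> i) * (?L - real i * ln x + 1)) = (\<Sum>i\<in>?I. real (\<kappa> i) * (?L + 1) - real i * real (\<kappa> i) * ln x)"
    by (intro sum.cong refl) (simp add: algebra_simps)
  also have "(\<Sum>i\<in>?I. real (\<kappa> i) * (?L + 1) - real i * real (\<kappa> i) * ln x) = (\<Sum>i\<in>?I. real (\<kappa> i)) * (?L + 1) - real m * ln x"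
    unfolding sum_subtractf rm by (simp add: sum_distrib_right)
  finally have 1: "ln ?Pr \<ge> (\<Sum>i\<in>?I. real (\<kappa> i)) * (?L + 1) - real m * ln x - real b * (1 + ln (real n)) - real s * ln (real n)" by simp
  \<comment> \<open>Here \<open>M \<le> Q\<close> matters: it makes \<open>ln (Q / M)\<close>
    nonnegative.\<close>
  have 2: "(\<Sum>i\<in>?I. real (\<kappa> i)) * (?L + 1) \<ge> (M - real b) * (?L + 1)" using sk L by (intro mult_right_mono) auto
  have 3: "real m * ln x \<le> real n * ln x" using mn x by (intro mult_right_mono) auto
  have 4: "real s * ln (real n) \<le> real b ^ 2 * ln (real n)" using s lnn by (intro mult_right_mono)
  have "exp (real n * ln (real n) - real n - real n * ln x
     + M * (?L + 1) - real b ^ 2 * ln (real n) - real b * (1 + ln (real n)) - real b * (?L + 1)) \<le> exp (ln (fact n) + ln ?Pr)"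
    using 1 2 3 4 ln_fact_ge[OF n] by (simp add: algebra_simps)
  also have "\<dots> = fact n * ?Pr" using Pr by (simp add: exp_add)
  also have "\<dots> \<le> E_nkt n (\<Sum>i\<in>?I. \<kappa>' i) b" by (rule E_nkt_ge_profile[OF tot])
  finally show ?thesis using k by blast
qed

section \<open>The regime of the class size\<close>

text \<open>The right side is a falling factorial, each of whose \<open>k\<close> factors is at
  least \<open>n - a\<close>.\<close>

lemma binomial_times_fact_ge: "k \<le> a \<Longrightarrow> (n - a) ^ k \<le> fact k * (n choose k)"
proof (induction k)
  case (Suc k)
  have "(n - a) ^ Suc k \<le> (n - k) * (fact k * (n choose k))"
    using Suc by (auto intro!: mult_mono)
  also have "\<dots> = fact k * ((n choose k) * (n - k))" by (simp add: mult_ac)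
  also have "\<dots> = fact (Suc k) * (n choose Suc k)"
    unfolding choose_times_diff by (simp add: algebra_simps)
  finally show ?case .
qed simp

lemma mu_eq: "mu a n = real (fact a * (n choose a)) * dens a"
  unfolding mu_def dens_def colour_weight_def by simp

lemma mu_le_power: "mu a n \<le> real n ^ a * dens a"
proof -
  have "real (fact a * (n choose a)) \<le> real (n ^ a)"
    using binomial_fact_pow[of n a] by (simp only: of_nat_le_iff mult.commute)
  then show ?thesis unfolding mu_eq by (intro mult_right_mono) auto
qed

lemma mu_ge_power: "real (n - a) ^ a * dens a \<le> mu a n"
proof -
  have "real ((n - a) ^ a) \<le> real (fact a * (n choose a))"
    using binomial_times_fact_ge[of a a n] by (simp only: of_nat_le_iff)
  then show ?thesis unfolding mu_eq by (intro mult_right_mono) auto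
qed

lemma mu_nonneg: "mu a n \<ge> 0"
  unfolding mu_def by simp

lemma mu_mono: "n \<le> m \<Longrightarrow> mu a n \<le> mu a m"
  unfolding mu_def by (intro mult_right_mono) (auto intro: binomial_right_mono)

text \<open>\<open>y ^ a * dens a\<close> is a smooth substitute for \<open>mu a\<close> at a real
  argument. The estimate rests on t \<le> exp (t - 1) with t = y / (n - a); it keeps the substitute
  within a constant factor of \<open>mu a n\<close> as long as y - n is of order n / a and a^2 at
  most of order n.\<close>

lemma power_dens_le_exp_mu:
  assumes "a < n" "y \<ge> 0"
  shows "y ^ a * dens a \<le> exp (real a * (y - real (n - a)) / real (n - a)) * mu a n"
proof -
  let ?m = "real (n - a)"
  have m: "?m > 0" using assms by simp
  have "y / ?m \<le> exp (y / ?m - 1)" using exp_ge_add_one_self[of "y / ?m - 1"] by simp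
  then have "(y / ?m) ^ a \<le> exp (y / ?m - 1) ^ a" using assms m by (intro power_mono) auto
  also have "\<dots> = exp (real a * (y - ?m) / ?m)"
    using m by (simp add: exp_of_nat_mult[symmetric] field_simps)
  finally have *: "(y / ?m) ^ a \<le> exp (real a * (y - ?m) / ?m)" .
  have "y ^ a * dens a = (y / ?m) ^ a * (?m ^ a * dens a)" using m by (simp add: power_divide)
  also have "\<dots> \<le> exp (real a * (y - ?m) / ?m) * mu a n"
    by (intro mult_mono * mu_ge_power) (auto simp: less_imp_le)
  finally show ?thesis .
qed

lemma two_powr_power: "((2::real) powr c) ^ k = 2 powr (c * real k)"
  by (subst powr_realpow[symmetric]) (simp_all add: powr_powr)

lemma mu_ge_ratio_power:
  assumes "a \<ge> 1" "a \<le> n"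
  shows "mu a n \<ge> (real n / real a * 2 powr (- (real a - 1) / 2)) ^ a"
proof -
  have "(2 powr (- (real a - 1) / 2)) ^ a = 2 powr - real (a choose 2)"
    unfolding two_powr_power choose_two_real by (rule arg_cong) (simp add: field_simps)
  moreover have "(real n / real a) ^ a \<le> real (n choose a)"
    using binomial_ge_n_over_k_pow_k[of a n, where 'a = real] assms by simp
  ultimately show ?thesis unfolding mu_def power_mult_distrib by (simp add: mult_right_mono)
qed

text \<open>The constants leave room for \<open>100 * mu a n'\<close> to stay well below \<open>n / a\<^sup>2\<close> for all
  \<open>n' \<le> n + n / a\<close>.\<close>

definition regime :: "nat \<Rightarrow> nat \<Rightarrow> bool" where
  "regime a n \<longleftrightarrow> n \<ge> 1 \<and> real n / (10000 * (real a)\<^sup>2) \<le> mu a n \<and> mu a n \<le> real n / (5000 * (real a)\<^sup>2)"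

lemma regime_gt_one:
  assumes "regime a n"
  shows "a > 1" "a \<le> n"
proof -
  have n: "real n \<ge> 1" using assms by (simp add: regime_def)
  have "a \<noteq> 0"
  proof
    \<comment> \<open>Division by zero yields 0, so the upper bound of the regime reads 1 \<le> 0
      here.\<close>
    assume "a = 0"
    then show False using assms by (simp add: regime_def mu_def)
  qed
  moreover have "a \<noteq> 1"
  proof
    assume "a = 1"
    then have "real n \<le> real n / 5000" using assms by (simp add: regime_def mu_def numeral_2_eq_2)
    then show False using n by simp
  qed
  ultimately show "a > 1" by simp
  show "a \<le> n"
  proof (rule ccontr)
    assume "\<not> a \<le> n"
    then have "mu a n = 0" by (simp add: mu_def binomial_eq_0)
    then show False using assms n \<open>a > 1\<close> by (simp add: regime_def field_simps)
  qed
qed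

lemma square_le_two_fact: "a\<^sup>2 \<le> 2 * fact a"
proof (cases a)
  case (Suc k)
  have "Suc k \<le> 2 * fact k"
  proof (induction k)
    case (Suc k)
    have "Suc (Suc k) \<le> 2 * Suc k" by simp
    also have "\<dots> \<le> 2 * (Suc k * fact k)"
      using mult_le_mono2[OF fact_ge_1[of k, where 'a = nat], of "Suc k"] by (intro mult_left_mono) auto
    finally show ?case by simp
  qed simp
  then have "Suc k * Suc k \<le> Suc k * (2 * fact k)" by (rule mult_left_mono) simp
  then show ?thesis unfolding Suc power2_eq_square by (simp add: algebra_simps)
qed simp

text \<open>If \<open>2 powr (a - 1)\<close> exceeded n^2, then \<open>n ^ a\<close> would be at
  most \<open>2 ^ (a choose 2)\<close> and \<open>mu a n\<close> at most 1 / a!, far below n /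
  a^2.\<close>

lemma two_powr_le_of_mu:
  assumes "a > 1" "real n > 20000" "real n / (10000 * (real a)\<^sup>2) \<le> mu a n"
  shows "2 powr (real a - 1) \<le> (real n)\<^sup>2"
proof (rule ccontr)
  assume "\<not> ?thesis"
  then have "2 powr (real a - 1) > (real n)\<^sup>2" by simp
  then have "(2 powr (real a - 1)) powr (1/2) \<ge> ((real n)\<^sup>2) powr (1/2)" by (intro powr_mono2) auto
  then have "2 powr ((real a - 1)/2) \<ge> real n" using assms by (simp add: powr_powr powr_half_sqrt)
  then have "real n ^ a \<le> (2 powr ((real a - 1)/2)) ^ a" by (intro power_mono) auto
  also have "\<dots> = 2 powr real (a choose 2)"
    unfolding two_powr_power choose_two_real by (rule arg_cong) (simp add: field_simps)
  finally have "real n ^ a * dens a \<le> 2 powr real (a choose 2) * dens a" by (intro mult_right_mono) auto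
  also have "\<dots> = 1 / fact a" by (simp add: dens_def colour_weight_def powr_minus)
  also have "\<dots> \<le> 2 / (real a)\<^sup>2"
  proof -
    have "real (a\<^sup>2) \<le> real (2 * fact a)" using square_le_two_fact by (simp only: of_nat_le_iff)
    then show ?thesis using assms by (simp add: field_simps)
  qed
  finally have "real n / (10000 * (real a)\<^sup>2) \<le> 2 / (real a)\<^sup>2"
    using assms(3) mu_le_power[of a n] by linarith
  then show False using assms by (simp add: field_simps)
qed

lemma eventually_nat_real:
  "eventually P at_top \<Longrightarrow> eventually (\<lambda>n. P (real n)) sequentially"
  using filterlim_real_sequentially unfolding filterlim_iff by blast

lemma ln2_bounds: "2/3 \<le> ln (2::real)" "ln (2::real) \<le> 7/10"
  using ln2_ge_two_thirds ln2_le_25_over_36 by auto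

text \<open>In the regime, \<open>a\<close> lies within \<open>O(ln (ln n))\<close> of \<open>2 * log 2 n\<close>, and \<open>2 / ln 2\<close> is
  between \<open>2.5\<close> and \<open>3.1\<close>.\<close>

lemma regime_bounds:
  "\<forall>\<^sub>F n in sequentially. \<forall>a. regime a n \<longrightarrow>
     2 powr (real a - 1) \<le> (real n)\<^sup>2 \<and> exp (-2) * (real n)\<^sup>2 / (real a)\<^sup>2 \<le> 2 powr (real a - 1) \<and>
     5/2 * ln (real n) \<le> real a \<and> real a \<le> 31/10 * ln (real n)"
proof -
  have "\<forall>\<^sub>F n in sequentially. real n > 20000"
    by (rule eventually_nat_real) real_asymp
  moreover have "\<forall>\<^sub>F n in sequentially. ln (real n) > 20"
    by (rule eventually_nat_real) real_asymp
  moreover have "\<forall>\<^sub>F n in sequentially. 2 * ln (ln (real n)) \<le> 3/10 * ln (real n)"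
    by (rule eventually_nat_real) real_asymp
  moreover have "\<forall>\<^sub>F n in sequentially. 7/10 * (5/2 * ln (real n)) \<le> 2 * ln (real n) - 2 - 2 * ln (31/10 * ln (real n))"
    by (rule eventually_nat_real) real_asymp
  ultimately show ?thesis
  proof eventually_elim
    case (elim n)
    let ?L = "ln (real n)"
    have n0: "real n > 0" using elim by simp
    show ?case
    proof (intro allI impI)
      fix a assume reg: "regime a n"
      note a = regime_gt_one[OF reg]
      have mu: "real n / (10000 * (real a)\<^sup>2) \<le> mu a n" "mu a n \<le> real n / (5000 * (real a)\<^sup>2)"
        using reg by (auto simp: regime_def)
      have a1: "real a > 1" using a by simp
      have up: "2 powr (real a - 1) \<le> (real n)\<^sup>2"
        by (rule two_powr_le_of_mu) (use a elim mu in auto)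
      then have "ln (2 powr (real a - 1)) \<le> ln ((real n)\<^sup>2)" using n0 by (subst ln_le_cancel_iff) auto
      then have lnup: "(real a - 1) * ln 2 \<le> 2 * ?L" using n0 by (simp add: ln_powr ln_realpow)
      have "(real a - 1) * (2/3) \<le> (real a - 1) * ln 2" using a1 ln2_bounds by (intro mult_left_mono) auto
      with lnup have a31: "real a \<le> 31/10 * ?L" using elim by (simp add: field_simps)
      \<comment> \<open>\<open>B ^ a\<close> bounds \<open>mu a n\<close> from below, so an upper
        bound on \<open>ln B\<close> gives the lower bound on \<open>2 powr (a - 1)\<close>.\<close>
      define B where "B = real n / real a * 2 powr (- (real a - 1) / 2)"
      have B0: "B > 0" using n0 a1 by (simp add: B_def)
      have lnB: "ln B = ?L - ln (real a) - (real a - 1) / 2 * ln 2"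
        unfolding B_def using n0 a1 by (simp add: ln_mult ln_div ln_powr field_simps)
      have Bmu: "B ^ a \<le> mu a n" unfolding B_def by (rule mu_ge_ratio_power) (use a in auto)
      have aa: "(real a)\<^sup>2 \<ge> 1" using a1 by (simp add: one_le_power)
      have "mu a n \<le> real n / (5000 * (real a)\<^sup>2)" by (rule mu)
      also have "\<dots> \<le> real n / 5000" using aa n0 a by (intro divide_left_mono) auto
      also have "\<dots> < real n" using n0 by simp
      finally have mun: "mu a n < real n" .
      \<comment> \<open>A crude bound first: if a < ln n, then B \<ge> sqrt n and already
        \<open>B ^ 2\<close> is too large. It then turns \<open>a * ln B \<le> ln n\<close> into
        \<open>ln B \<le> 1\<close>.\<close>
      have aL: "real a \<ge> ?L"
      proof (rule ccontr)
        assume "\<not> ?thesis"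
        then have aL: "real a < ?L" by simp
        then have "ln (real a) \<le> ln ?L" using a1 by (subst ln_le_cancel_iff) auto
        moreover have "(real a - 1) / 2 * ln 2 \<le> ?L / 2 * (7/10)"
          using a1 aL ln2_bounds by (intro mult_mono) auto
        ultimately have "ln B \<ge> ?L / 2" unfolding lnB using elim by linarith
        then have "exp (?L / 2) \<le> exp (ln B)" by (simp only: exp_le_cancel_iff)
        then have "exp (?L / 2) \<le> B" using B0 by simp
        then have "exp (?L / 2) ^ 2 \<le> B ^ 2" by (intro power_mono) auto
        then have B2: "real n \<le> B ^ 2" using n0 by (simp add: exp_double[symmetric])
        have "1 \<le> exp (?L / 2)" using elim by simp
        then have "B \<ge> 1" using \<open>exp (?L / 2) \<le> B\<close> by linarith
        then have "B ^ 2 \<le> B ^ a" using a by (intro power_increasing) auto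
        then show False using B2 Bmu mun by linarith
      qed
      have "B ^ a < real n" using Bmu mun by linarith
      then have "ln (B ^ a) \<le> ln (real n)" using B0 n0 by (subst ln_le_cancel_iff) auto
      then have "real a * ln B \<le> ?L" using B0 by (simp add: ln_realpow)
      also have "\<dots> \<le> real a * 1" using aL by simp
      finally have "ln B \<le> 1" using a1 by simp
      then have lnlow: "(real a - 1) * ln 2 \<ge> 2 * ?L - 2 - 2 * ln (real a)" unfolding lnB by (simp add: field_simps)
      have "exp (2 * ?L - 2 - 2 * ln (real a)) \<le> exp ((real a - 1) * ln 2)" using lnlow by simp
      also have "exp (2 * ?L - 2 - 2 * ln (real a)) = exp (-2) * (real n)\<^sup>2 / (real a)\<^sup>2"
        using n0 a1 by (simp add: exp_diff exp_add exp_double exp_minus field_simps)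
      also have "exp ((real a - 1) * ln 2) = 2 powr (real a - 1)" by (simp add: powr_def)
      finally have low: "exp (-2) * (real n)\<^sup>2 / (real a)\<^sup>2 \<le> 2 powr (real a - 1)" .
      have "ln (real a) \<le> ln (31/10 * ?L)" using a31 a1 by (subst ln_le_cancel_iff) auto
      then have "7/10 * (5/2 * ?L) \<le> (real a - 1) * ln 2" using lnlow elim by linarith
      also have "\<dots> \<le> (real a - 1) * (7/10)" using a1 ln2_bounds by (intro mult_left_mono) auto
      finally have "5/2 * ?L \<le> real a" by simp
      with up low a31 show "2 powr (real a - 1) \<le> (real n)\<^sup>2 \<and> exp (-2) * (real n)\<^sup>2 / (real a)\<^sup>2 \<le> 2 powr (real a - 1) \<and>
     5/2 * ?L \<le> real a \<and> real a \<le> 31/10 * ?L" by simp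
    qed
  qed
qed

lemma exp_2_le_9: "exp 2 \<le> (9::real)"
proof -
  have "exp (2::real) = exp 1 ^ 2" by (simp add: exp_double[symmetric])
  also have "\<dots> \<le> 3 ^ 2" using exp_le by (intro power_mono) auto
  finally show ?thesis by simp
qed

text \<open>For y up to n + n / a the exponent in \<open>power_dens_le_exp_mu\<close> is at most (n
  + a^2) / (n - a) \<le> 2, and 9 is an upper bound for exp 2.\<close>

lemma regime_growth:
  "\<forall>\<^sub>F n in sequentially. \<forall>a. regime a n \<longrightarrow> real n \<ge> 1000 * (real a)\<^sup>2 \<and> 
     (\<forall>y. 0 \<le> y \<longrightarrow> y \<le> real n + real n / real a \<longrightarrow> y ^ a * dens a \<le> 9 * mu a n)"
proof -
  have "\<forall>\<^sub>F n in sequentially. real n \<ge> 1000 * (31/10 * ln (real n))\<^sup>2"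
    by (rule eventually_nat_real) real_asymp
  then show ?thesis using regime_bounds
  proof eventually_elim
    case (elim n)
    show ?case
    proof (intro allI impI)
      fix a assume reg: "regime a n"
      have a: "a > 1" using regime_gt_one[OF reg] by simp
      have a31: "real a \<le> 31/10 * ln (real n)" using elim reg by auto
      have "1000 * (real a)\<^sup>2 \<le> 1000 * (31/10 * ln (real n))\<^sup>2" using a31 a by (intro mult_left_mono power_mono) auto
      then have na: "real n \<ge> 1000 * (real a)\<^sup>2" using elim(1) by linarith
      have aa: "real a * 1 \<le> (real a)\<^sup>2" unfolding power2_eq_square using a by (intro mult_left_mono) auto
      then have an: "a < n" using na a by linarith
      have "y ^ a * dens a \<le> 9 * mu a n" if y: "0 \<le> y" "y \<le> real n + real n / real a" for y
      proof -
        have "real a * (y - real (n - a)) \<le> real a * (real n / real a + real a)"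
          using y an by (intro mult_left_mono) (auto simp: of_nat_diff)
        also have "\<dots> = real n + (real a)\<^sup>2" using a by (simp add: field_simps power2_eq_square)
        also have "\<dots> \<le> 2 * real (n - a)"
        proof -
          have "real (n - a) = real n - real a" using an by simp
          then show ?thesis using na aa by linarith
        qed
        finally have "real a * (y - real (n - a)) / real (n - a) \<le> 2" using an by (simp add: divide_le_eq)
        then have "exp (real a * (y - real (n - a)) / real (n - a)) \<le> exp 2" by simp
        then have "exp (real a * (y - real (n - a)) / real (n - a)) * mu a n \<le> 9 * mu a n"
          using exp_2_le_9 by (intro mult_right_mono mu_nonneg) linarith
        then show ?thesis using power_dens_le_exp_mu[OF an y(1)] by linarith
      qed
      then show "real n \<ge> 1000 * (real a)\<^sup>2 \<and> 
         (\<forall>y. 0 \<le> y \<longrightarrow> y \<le> real n + real n / real a \<longrightarrow> y ^ a * dens a \<le> 9 * mu a n)"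
        using na by blast
    qed
  qed
qed

lemma power_dens_le:
  assumes "regime a n" "\<forall>y. 0 \<le> y \<longrightarrow> y \<le> real n + real n / real a \<longrightarrow> y ^ a * dens a \<le> 9 * mu a n"
  shows "real n ^ a * dens a \<le> real n / (500 * (real a)\<^sup>2)"
proof -
  have a: "a > 1" using regime_gt_one[OF assms(1)] by simp
  have "real n ^ a * dens a \<le> 9 * mu a n" using assms(2) by simp
  also have "\<dots> \<le> 9 * (real n / (5000 * (real a)\<^sup>2))" using assms(1) by (simp add: regime_def)
  also have "\<dots> \<le> real n / (500 * (real a)\<^sup>2)" using a by (simp add: field_simps)
  finally show ?thesis .
qed

text \<open>Parametrise the saddle point as \<open>x = a * 2 powr (a - 1) / R\<close>. Then \<open>tilt a t * R ^ t\<close> is the weight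
  of the class size \<open>a - t\<close> relative to that of \<open>a\<close>, see \<open>dens_tilt\<close>, and \<open>R\<close> stays bounded.\<close>

definition tilt :: "nat \<Rightarrow> nat \<Rightarrow> real" where
  "tilt a t = real ((a choose t) * fact t) / real a ^ t / 2 ^ (t choose 2)"

lemma tilt_nonneg: "tilt a t \<ge> 0"
  unfolding tilt_def by simp

lemma tilt_1: "a \<ge> 1 \<Longrightarrow> tilt a 1 = 1"
  unfolding tilt_def by (simp add: numeral_2_eq_2)

lemma fact_le_two_power_choose: "fact t \<le> (2::nat) ^ (t choose 2)"
proof (induction t)
  case (Suc t)
  have "fact (Suc t) = Suc t * fact t" by simp
  also have "\<dots> \<le> 2 ^ t * 2 ^ (t choose 2)"
    using Suc less_exp[of t] by (intro mult_mono) (auto simp: Suc_le_eq)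
  also have "\<dots> = 2 ^ (Suc t choose 2)" by (simp add: numeral_2_eq_2 flip: power_add)
  finally show ?case .
qed simp

text \<open>The falling factorial is at most a^t, and \<open>2 ^ (t choose 2)\<close> is at least
  t!. The comparison with the exponential series bounds tilted sums independently of
  \<open>a\<close>.\<close>

lemma tilt_le: "a \<ge> 1 \<Longrightarrow> tilt a t \<le> 1 / fact t"
proof -
  assume a: "a \<ge> 1"
  have "real ((a choose t) * fact t) \<le> real (a ^ t)"
    using binomial_fact_pow[of a t] by (simp only: of_nat_le_iff)
  then have "real ((a choose t) * fact t) / real a ^ t \<le> 1" using a by simp
  moreover have "(fact t::real) \<le> 2 ^ (t choose 2)"
    using fact_le_two_power_choose[of t] by (metis of_nat_fact of_nat_le_iff of_nat_numeral of_nat_power)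
  ultimately show ?thesis unfolding tilt_def by (intro frac_le) auto
qed

lemma dens_tilt:
  assumes "t \<le> a" "R > 0" "a \<ge> 1" and x: "x = real a * 2 powr (real a - 1) / R"
  shows "dens (a - t) * x ^ (a - t) = dens a * x ^ a * (tilt a t * R ^ t)"
proof -
  have x0: "x > 0" unfolding x using assms(2,3) by simp
  have "real (fact t * fact (a - t) * (a choose t)) = real (fact a)"
    using binomial_fact_lemma[OF assms(1)] by (rule arg_cong)
  then have f: "real ((a choose t) * fact t) = fact a / fact (a - t)"
    by (simp add: field_simps)
  have e: "- real ((a - t) choose 2) = - real (a choose 2) + real t * (real a - 1) - real (t choose 2)"
    using assms(1) by (simp add: choose_two_real of_nat_diff field_simps)
  have cw: "colour_weight (a - t) = colour_weight a * (2 powr (real a - 1)) ^ t / 2 ^ (t choose 2)"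
    unfolding colour_weight_def e two_powr_power
    by (simp add: powr_diff powr_add powr_minus powr_realpow field_simps)
  have xa: "x ^ a = x ^ (a - t) * x ^ t" using assms(1) by (simp flip: power_add)
  have xt: "x ^ t = real a ^ t * (2 powr (real a - 1)) ^ t / R ^ t"
    unfolding x by (simp add: power_mult_distrib power_divide)
  show ?thesis
    unfolding dens_def tilt_def cw f xa xt using assms(2,3) by (simp add: field_simps)
qed

section \<open>The saddle point\<close>

text \<open>The sum starts at t = 1 because the saddle point belongs to colourings with classes of
  size at most \<open>a - 1\<close>.\<close>

definition tilt_sum :: "nat \<Rightarrow> real \<Rightarrow> real" where
  "tilt_sum a R = (\<Sum>t\<in>{1..<a}. tilt a t * R ^ t)"

text \<open>The mean of \<open>a\<close> minus the class size under the tilted weights.\<close>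

definition tilt_mean :: "nat \<Rightarrow> real \<Rightarrow> real" where
  "tilt_mean a R = (\<Sum>t\<in>{1..<a}. real t * (tilt a t * R ^ t)) / tilt_sum a R"

lemma tilt_sum_ge: "a \<ge> 2 \<Longrightarrow> R \<ge> 0 \<Longrightarrow> tilt_sum a R \<ge> R"
proof -
  assume a: "a \<ge> 2" and R: "R \<ge> 0"
  have "tilt a 1 * R ^ 1 \<le> tilt_sum a R"
    unfolding tilt_sum_def using a R tilt_nonneg by (intro member_le_sum) auto
  then show ?thesis using tilt_1[of a] a by simp
qed

lemma tilt_sum_le: "a \<ge> 1 \<Longrightarrow> R \<ge> 0 \<Longrightarrow> tilt_sum a R \<le> exp R"
proof -
  assume a: "a \<ge> 1" and R: "R \<ge> 0"
  have "tilt_sum a R \<le> (\<Sum>t\<in>{1..<a}. R ^ t / fact t)"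
    unfolding tilt_sum_def
  proof (rule sum_mono)
    fix t
    show "tilt a t * R ^ t \<le> R ^ t / fact t"
      using mult_right_mono[OF tilt_le[OF a, of t], of "R ^ t"] R by simp
  qed
  also have "\<dots> \<le> exp R" using R by (intro sum_power_div_fact_le_exp) auto
  finally show ?thesis .
qed

lemma tilt_mean_bounds:
  assumes "a \<ge> 2" "R > 0"
  shows "tilt_mean a R \<ge> 1" "tilt_mean a R \<le> real a - 1"
proof -
  have W: "tilt_sum a R > 0" using tilt_sum_ge[of a R] assms by simp
  have "tilt_sum a R \<le> (\<Sum>t\<in>{1..<a}. real t * (tilt a t * R ^ t))"
    unfolding tilt_sum_def
  proof (rule sum_mono)
    fix t assume "t \<in> {1..<a}"
    then have "1 * (tilt a t * R ^ t) \<le> real t * (tilt a t * R ^ t)"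
      using tilt_nonneg assms by (intro mult_right_mono) auto
    then show "tilt a t * R ^ t \<le> real t * (tilt a t * R ^ t)" by simp
  qed
  then show "tilt_mean a R \<ge> 1" unfolding tilt_mean_def using W by simp
  have "(\<Sum>t\<in>{1..<a}. real t * (tilt a t * R ^ t)) \<le> (\<Sum>t\<in>{1..<a}. (real a - 1) * (tilt a t * R ^ t))"
  proof (rule sum_mono)
    fix t assume "t \<in> {1..<a}"
    then show "real t * (tilt a t * R ^ t) \<le> (real a - 1) * (tilt a t * R ^ t)"
      using tilt_nonneg assms by (intro mult_right_mono) auto
  qed
  also have "\<dots> = (real a - 1) * tilt_sum a R" by (simp add: tilt_sum_def sum_distrib_left)
  finally show "tilt_mean a R \<le> real a - 1" unfolding tilt_mean_def using W by (simp add: field_simps)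
qed

lemma exp_half_le_2: "exp (1/2 :: real) \<le> 2"
proof -
  have "exp (1/2 :: real) ^ 2 = exp 1" by (simp add: exp_double[symmetric])
  also have "\<dots> \<le> 2 ^ 2" using exp_le by simp
  finally show ?thesis by (rule power2_le_imp_le) simp
qed

text \<open>The left end for the intermediate value argument. In the sum of (t - 2) times the
  weights, t = 1 counts negatively; the other terms are majorised by the exponential series, and exp
  (1/2) \<le> 2 balances the two.\<close>

lemma tilt_mean_half_le:
  assumes "a \<ge> 2"
  shows "tilt_mean a (1/2) \<le> 2"
proof -
  let ?R = "1/2 :: real"
  have W: "tilt_sum a ?R > 0" using tilt_sum_ge[of a ?R] assms by simp
  have "(\<Sum>t\<in>{1..<a}. (real t - 2) * (tilt a t * ?R ^ t)) \<le> (\<Sum>t\<in>{1..<a}. ?R * (?R ^ (t - 1) / fact (t - 1)) - (if t = 1 then 2 * ?R else 0))"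
  proof (rule sum_mono)
    fix t assume t: "t \<in> {1..<a}"
    show "(real t - 2) * (tilt a t * ?R ^ t) \<le> ?R * (?R ^ (t - 1) / fact (t - 1)) - (if t = 1 then 2 * ?R else 0)"
    proof (cases "t = 1")
      case True
      then show ?thesis using tilt_1[of a] assms by simp
    next
      case False
      then obtain s where s: "t = Suc s" using t by (cases t) auto
      have "(real t - 2) * (tilt a t * ?R ^ t) \<le> real t * (1 / fact t * ?R ^ t)"
        using tilt_le[of a t] tilt_nonneg[of a t] assms False t by (intro mult_mono mult_right_mono) auto
      also have "\<dots> = ?R * (?R ^ (t - 1) / fact (t - 1))"
        unfolding s by (simp add: field_simps del: of_nat_Suc)
      finally show ?thesis using False by simp
    qed
  qed
  also have "\<dots> = ?R * (\<Sum>t\<in>{1..<a}. ?R ^ (t - 1) / fact (t - 1)) - 2 * ?R"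
    using assms by (simp add: sum_subtractf sum_distrib_left)
  also have "(\<Sum>t\<in>{1..<a}. ?R ^ (t - 1) / fact (t - 1)) = (\<Sum>s\<in>{0..<a-1}. ?R ^ s / fact s)"
    by (rule sum.reindex_bij_witness[of _ Suc "\<lambda>t. t - 1"]) auto
  also have "?R * \<dots> - 2 * ?R \<le> ?R * exp ?R - 2 * ?R"
    by (intro diff_right_mono mult_left_mono sum_power_div_fact_le_exp) auto
  also have "\<dots> \<le> 0" using exp_half_le_2 by simp
  finally have "(\<Sum>t\<in>{1..<a}. real t * (tilt a t * ?R ^ t)) \<le> 2 * tilt_sum a ?R"
    by (simp add: left_diff_distrib sum_subtractf tilt_sum_def sum_distrib_left)
  then show ?thesis unfolding tilt_mean_def using W by (simp add: field_simps)
qed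

lemma tilt_5_ge:
  assumes "a \<ge> 10"
  shows "tilt a 5 \<ge> 1 / 2 ^ 15"
proof -
  have "(a - 5) ^ 5 \<le> fact 5 * (a choose 5)" 
    by (rule binomial_times_fact_ge) (rule order.refl)
  then have "real ((a - 5) ^ 5) \<le> real (fact 5 * (a choose 5))" by (simp only: of_nat_le_iff)
  moreover have "(real a / 2) ^ 5 \<le> real (a - 5) ^ 5" using assms by (intro power_mono) auto
  ultimately have "(real a / 2) ^ 5 \<le> real (fact 5 * (a choose 5))"
    unfolding of_nat_power by (rule order.trans[rotated])
  then have *: "(real a / 2) ^ 5 \<le> real ((a choose 5) * fact 5)"
    by (simp only: mult.commute)
  have "real a ^ 5 > 0" using assms by simp
  then have "(1/2) ^ 5 \<le> real ((a choose 5) * fact 5) / real a ^ 5"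
    using * by (simp add: field_simps power_divide)
  moreover have "(5 choose 2) = (10::nat)" by (simp add: choose_two)
  ultimately show ?thesis unfolding tilt_def by (simp add: power_divide mult_ac)
qed

text \<open>The right end. At R = 2^10 the term t = 5, at least 2^50 / 2^15, outweighs the negative
  terms t = 1, 2, 3, the largest of which is at most 2^30 in absolute value; t = 4 contributes
  0.\<close>

lemma tilt_mean_large_ge:
  assumes "a \<ge> 10"
  shows "tilt_mean a 1024 \<ge> 4"
proof -
  let ?R = "1024 :: real"
  have W: "tilt_sum a ?R > 0" using tilt_sum_ge[of a ?R] assms by simp
  let ?f = "\<lambda>t. (real t - 4) * (tilt a t * ?R ^ t)"
  have b: "tilt a t \<le> 1" for t
  proof -
    have "tilt a t \<le> 1 / fact t" using assms by (intro tilt_le) auto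
    also have "\<dots> \<le> 1" using fact_ge_1[of t, where 'a = real] by (simp add: divide_le_eq)
    finally show ?thesis .
  qed
  have "(\<Sum>t\<in>{1,2,3,4,5}. ?f t) \<le> (\<Sum>t\<in>{1..<a}. ?f t)"
    using assms tilt_nonneg by (intro sum_mono2) (auto intro!: mult_nonneg_nonneg)
  moreover have "(\<Sum>t\<in>{1,2,3,4,5}. ?f t) = - 3 * ?R * tilt a 1 - 2 * ?R ^ 2 * tilt a 2 - ?R ^ 3 * tilt a 3 + ?R ^ 5 * tilt a 5"
    by simp
  moreover have "?R ^ 5 * tilt a 5 \<ge> ?R ^ 5 * (1 / 2 ^ 15)"
    using tilt_5_ge[OF assms] by (intro mult_left_mono) auto
  ultimately have "(\<Sum>t\<in>{1..<a}. ?f t) \<ge> 0" using b[of 1] b[of 2] b[of 3] by simp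
  then have "(\<Sum>t\<in>{1..<a}. real t * (tilt a t * ?R ^ t)) \<ge> 4 * tilt_sum a ?R"
    by (simp add: left_diff_distrib sum_subtractf tilt_sum_def sum_distrib_left)
  then show ?thesis unfolding tilt_mean_def using W by (simp add: field_simps)
qed

text \<open>After substituting t = a - i the factor \<open>dens a * x ^ a\<close> comes out. The
  quotient of the two sums is the mean class size \<open>a - tilt_mean a R\<close>, whence M = n /
  (a - tilt_mean a R).\<close>

lemma dens_sums_tilt:
  assumes "a \<ge> 2" "R > 0" and x: "x = real a * 2 powr (real a - 1) / R"
  shows "(\<Sum>i\<in>{1..<a}. dens i * x ^ i) = dens a * x ^ a * tilt_sum a R"
    and "(\<Sum>i\<in>{1..<a}. real i * (dens i * x ^ i)) = dens a * x ^ a * tilt_sum a R * (real a - tilt_mean a R)"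
proof -
  have W: "tilt_sum a R > 0" using tilt_sum_ge[of a R] assms(1,2) by simp
  have *: "(\<Sum>i\<in>{1..<a}. h i * (dens i * x ^ i)) = (\<Sum>t\<in>{1..<a}. h (a - t) * (dens a * x ^ a * (tilt a t * R ^ t)))" for h :: "nat \<Rightarrow> real"
  proof (rule sum.reindex_bij_witness[of _ "\<lambda>t. a - t" "\<lambda>i. a - i"])
    fix i assume i: "i \<in> {1..<a}"
    then have "dens (a - (a - i)) * x ^ (a - (a - i)) = dens a * x ^ a * (tilt a (a - i) * R ^ (a - i))"
      by (intro dens_tilt) (use assms in auto)
    then show "h (a - (a - i)) * (dens a * x ^ a * (tilt a (a - i) * R ^ (a - i))) = h i * (dens i * x ^ i)"
      using i by simp
  qed auto
  show "(\<Sum>i\<in>{1..<a}. dens i * x ^ i) = dens a * x ^ a * tilt_sum a R"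
    using *[of "\<lambda>_. 1"] by (simp add: tilt_sum_def sum_distrib_left)
  have "(\<Sum>i\<in>{1..<a}. real i * (dens i * x ^ i)) = 
      (\<Sum>t\<in>{1..<a}. dens a * x ^ a * (real a * (tilt a t * R ^ t) - real t * (tilt a t * R ^ t)))"
    unfolding * by (intro sum.cong refl) (auto simp: of_nat_diff algebra_simps)
  also have "\<dots> = dens a * x ^ a * (real a * tilt_sum a R - tilt_mean a R * tilt_sum a R)"
  proof -
    have "tilt_mean a R * tilt_sum a R = (\<Sum>t\<in>{1..<a}. real t * (tilt a t * R ^ t))"
      unfolding tilt_mean_def using W by simp
    moreover have "real a * tilt_sum a R = (\<Sum>t\<in>{1..<a}. real a * (tilt a t * R ^ t))"
      unfolding tilt_sum_def by (rule sum_distrib_left)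
    ultimately show ?thesis by (simp only: sum_distrib_left[symmetric] sum_subtractf)
  qed
  finally show "(\<Sum>i\<in>{1..<a}. real i * (dens i * x ^ i)) = dens a * x ^ a * tilt_sum a R * (real a - tilt_mean a R)"
    by (simp add: algebra_simps)
qed

text \<open>At \<open>saddle_fun a n R = 0\<close> the exponential growth rate of the expected number of
  \<open>(a - 1)\<close>-bounded colourings vanishes, when the class sizes are distributed as \<open>a - t\<close> with
  weights \<open>tilt a t * R ^ t\<close>.\<close>

definition saddle_fun :: "nat \<Rightarrow> nat \<Rightarrow> real \<Rightarrow> real" where
  "saddle_fun a n R = ln (real n ^ a * dens a) + tilt_mean a R * ln (real a * 2 powr (real a - 1) / R / real n)
     + ln (tilt_sum a R) + ln (real a - tilt_mean a R) - ln (real n) + 1 - real a + tilt_mean a R"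

text \<open>To leading order \<open>saddle_fun\<close> is \<open>tilt_mean a R * ln n - a\<close>,
  and \<open>a\<close> lies between 5/2 and 31/10 times ln n; a mean of at most 2 makes it negative,
  a mean of at least 4 positive. The target is 1 / sqrt n instead of 0: the resulting slack
  \<open>M / sqrt n\<close> later absorbs the rounding losses in the first moment at
  \<open>n\<close>.\<close>

lemma saddle_fun_root:
  "\<forall>\<^sub>F n in sequentially. \<forall>a. regime a n \<longrightarrow> (\<exists>R. 1/2 \<le> R \<and> R \<le> 1024 \<and> saddle_fun a n R = 1 / sqrt (real n))"
proof -
  have "\<forall>\<^sub>F n in sequentially. ln (real n) > 10"
    by (rule eventually_nat_real) real_asymp
  moreover have "\<forall>\<^sub>F n in sequentially. real n > 100"
    by (rule eventually_nat_real) real_asymp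
  moreover have "\<forall>\<^sub>F n in sequentially. 6 + 4 * ln (31/10 * ln (real n)) < 1/2 * ln (real n)"
    by (rule eventually_nat_real) real_asymp
  moreover have "\<forall>\<^sub>F n in sequentially. 9/10 * ln (real n) > 6 * ln (31/10 * ln (real n)) + ln 10000 + 4 * ln 1024 + 10"
    by (rule eventually_nat_real) real_asymp
  ultimately show ?thesis using regime_bounds regime_growth
  proof eventually_elim
    case (elim n)
    let ?L = "ln (real n)"
    have n0: "real n > 0" using elim by simp
    show ?case
    proof (intro allI impI)
      fix a assume reg: "regime a n"
      have bd: "2 powr (real a - 1) \<le> (real n)\<^sup>2" "exp (-2) * (real n)\<^sup>2 / (real a)\<^sup>2 \<le> 2 powr (real a - 1)"
        "5/2 * ?L \<le> real a" "real a \<le> 31/10 * ?L" using elim(5) reg by auto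
      have a10: "a \<ge> 10" using bd(3) elim(1) by linarith
      then have a: "a \<ge> 2" "real a > 0" by auto
      have lna: "ln (real a) \<le> ln (31/10 * ?L)" using a bd(4) by (subst ln_le_cancel_iff) auto
      have lna0: "ln (real a) \<ge> 0" using a by simp
      let ?X = "real a * 2 powr (real a - 1)"
      have lny: "ln (?X / R / real n) = ln (real a) + (real a - 1) * ln 2 - ln R - ?L" if "R > 0" for R
        using that a n0 by (simp add: ln_mult ln_div ln_powr)
      have "ln (2 powr (real a - 1)) \<le> ln ((real n)\<^sup>2)" using bd(1) n0 by (subst ln_le_cancel_iff) auto
      then have l2u: "(real a - 1) * ln 2 \<le> 2 * ?L" using n0 by (simp add: ln_powr ln_realpow)
      have "ln (exp (-2) * (real n)\<^sup>2 / (real a)\<^sup>2) \<le> ln (2 powr (real a - 1))" using bd(2) n0 a by (subst ln_le_cancel_iff) auto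
      then have l2l: "2 * ?L - 2 - 2 * ln (real a) \<le> (real a - 1) * ln 2"
        using n0 a by (simp add: ln_powr ln_realpow ln_div ln_mult)
      have mu: "real n / (10000 * (real a)\<^sup>2) \<le> mu a n" "mu a n \<le> real n / (5000 * (real a)\<^sup>2)"
        using reg by (auto simp: regime_def)
      have mup: "mu a n > 0"
      proof -
        have "0 < real n / (10000 * (real a)\<^sup>2)" using n0 a by simp
        then show ?thesis using mu(1) by linarith
      qed
      have mus_l: "ln (real n ^ a * dens a) \<ge> ?L - ln 10000 - 2 * ln (real a)"
      proof -
        have "ln (real n / (10000 * (real a)\<^sup>2)) \<le> ln (real n ^ a * dens a)"
          using mu(1) mu_le_power[of a n] n0 a by (subst ln_le_cancel_iff) auto
        then show ?thesis using n0 a by (simp add: ln_div ln_mult ln_realpow)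
      qed
      have mus_u: "ln (real n ^ a * dens a) \<le> ?L"
      proof -
        have "real n ^ a * dens a \<le> real n / (500 * (real a)\<^sup>2)"
          by (rule power_dens_le[OF reg]) (use elim(6) reg in blast)
        also have "\<dots> \<le> real n / 1"
        proof (rule divide_left_mono)
          have "(real a)\<^sup>2 \<ge> 1" using a by (intro one_le_power) auto
          then show "1 \<le> 500 * (real a)\<^sup>2" by linarith
        qed (use a in auto)
        also have "\<dots> = real n" by simp
        finally show ?thesis using n0 by (subst ln_le_cancel_iff) auto
      qed
      have lo: "saddle_fun a n (1/2) \<le> 1 / sqrt (real n)"
      proof -
        define D where "D = tilt_mean a (1/2)"
        have D: "1 \<le> D" "D \<le> 2" "D \<le> real a - 1"
          unfolding D_def using tilt_mean_bounds[of a "1/2"] tilt_mean_half_le[of a] a by auto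
        let ?y = "ln (?X / (1/2) / real n)"
        have "ln 2 \<le> (1::real)" using ln2_bounds by simp
        then have "?y \<le> ?L + ln (real a) + 1" using lny[of "1/2"] l2u by (simp add: ln_div)
        have y0: "?y \<ge> 0" using lny[of "1/2"] l2l elim lna ln2_bounds by (simp add: ln_div)
        have "D * ?y \<le> 2 * (?L + ln (real a) + 1)" using D y0 \<open>?y \<le> _\<close> by (intro mult_mono) auto
        moreover have "ln (tilt_sum a (1/2)) \<le> 1/2"
        proof -
          have "ln (tilt_sum a (1/2)) \<le> ln (exp (1/2))"
            using tilt_sum_le[of a "1/2"] tilt_sum_ge[of a "1/2"] a by (subst ln_le_cancel_iff) auto
          then show ?thesis by simp
        qed
        moreover have "ln (real a - D) \<le> ln (real a)" using D by (subst ln_le_cancel_iff) auto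
        moreover have "u + p + w + v - l + 1 - b + d \<le> 0"
          if "p \<le> 2 * (l + k + 1)" "w \<le> 1/2" "v \<le> k" "d \<le> 2" "u \<le> l" "5/2 * l \<le> b" "k \<le> m" "0 \<le> k" "6 + 4 * m < 1/2 * l"
          for u p w v l b d k m :: real
          using that by argo
        ultimately have "saddle_fun a n (1/2) \<le> 0"
          unfolding saddle_fun_def D_def[symmetric] using D(2) mus_u bd(3) lna lna0 elim(3) by blast
        also have "0 \<le> 1 / sqrt (real n)" by simp
        finally show ?thesis .
      qed
      have hi: "1 / sqrt (real n) \<le> saddle_fun a n 1024"
      proof -
        define D where "D = tilt_mean a 1024"
        have D: "4 \<le> D" "D \<le> real a - 1"
          unfolding D_def using tilt_mean_bounds[of a 1024] tilt_mean_large_ge[of a] a10 a by auto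
        let ?y = "ln (?X / 1024 / real n)"
        have y: "?y \<ge> ?L - ln (real a) - 2 - ln 1024" using lny[of 1024] l2l by simp
        moreover have "ln (10000::real) \<ge> 0" "ln (1024::real) \<ge> 0" by simp_all
        ultimately have "?y \<ge> 0" using elim(1,4) lna lna0 by argo
        then have "D * ?y \<ge> 4 * (?L - ln (real a) - 2 - ln 1024)" using D y by (meson mult_mono' order.trans mult_left_mono mult_right_mono zero_le_numeral)
        moreover have "ln (tilt_sum a 1024) \<ge> 0"
          using tilt_sum_ge[of a 1024] a by (intro ln_ge_zero) auto
        moreover have "ln (real a - D) \<ge> 0" using D by (intro ln_ge_zero) auto
        moreover have "1 \<le> u + p + w + v - l + 1 - b + d"
          if "4 * (l - k - 2 - c) \<le> p" "0 \<le> w" "0 \<le> v" "4 \<le> d" "l - e - 2 * k \<le> u" "b \<le> 31/10 * l" "k \<le> m" "0 \<le> k" "6 * m + e + 4 * c + 10 < 9/10 * l"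
          for u p w v l b d k m c e :: real
          using that by argo
        ultimately have "saddle_fun a n 1024 \<ge> 1"
          unfolding saddle_fun_def D_def[symmetric] using D(1) mus_l bd(4) lna lna0 elim(4) by blast
        moreover have "1 / sqrt (real n) \<le> 1" using n0 elim by simp
        ultimately show ?thesis by linarith
      qed
      have cont: "continuous_on {1/2..1024} (saddle_fun a n)"
      proof -
        have W: "tilt_sum a R > 0" if "R \<in> {1/2..1024}" for R using tilt_sum_ge[of a R] a that by auto
        have cW: "continuous_on {1/2..1024} (tilt_sum a)" unfolding tilt_sum_def by (intro continuous_intros)
        have cD: "continuous_on {1/2..1024} (tilt_mean a)"
          unfolding tilt_mean_def by (intro continuous_intros cW) (use W in force)
        have D: "tilt_mean a R \<le> real a - 1" if "R \<in> {1/2..1024}" for R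
          using tilt_mean_bounds[of a R] a that by auto
        show ?thesis unfolding saddle_fun_def
          by (intro continuous_intros cW cD) (use W D a n0 in \<open>force+\<close>)
      qed
      show "\<exists>R. 1/2 \<le> R \<and> R \<le> 1024 \<and> saddle_fun a n R = 1 / sqrt (real n)"
        by (rule IVT'[OF lo hi _ cont]) simp
    qed
  qed
qed

text \<open>\<open>M\<close> is the number of colours for which the mean class size at \<open>x\<close> is \<open>n / M\<close>, and \<open>exp \<beta>\<close> is the
  ratio between the number of \<open>a\<close>-classes that the saddle point would prefer and
  \<open>n ^ a * dens a\<close>, which is close to \<open>mu a n\<close>.\<close>

definition saddle :: "nat \<Rightarrow> nat \<Rightarrow> real \<Rightarrow> real \<Rightarrow> real \<Rightarrow> real \<Rightarrow> bool" where
  "saddle a n x Q M \<beta> \<longleftrightarrow> Q = (\<Sum>i\<in>{1..<a}. dens i * x ^ i) \<and>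
     M = real n * Q / (\<Sum>i\<in>{1..<a}. real i * (dens i * x ^ i)) \<and>
     real n \<le> x \<and> 0 < M \<and> real n / real a \<le> M \<and> M \<le> real n \<and> M \<le> Q \<and> 0 < Q \<and>
     ln (x / real n) \<le> 2 * ln (real n) \<and> ln (real a) - 1024 \<le> \<beta> \<and>
     M * (dens a * x ^ a) / Q = exp \<beta> * (real n ^ a * dens a) \<and>
     ln (Q / M) = real a * ln (x / real n) - \<beta> \<and>
     M * (ln (Q / M) + 1) = real n * ln x - real n * ln (real n) + real n + M / sqrt (real n)"

lemma saddle_exists:
  "\<forall>\<^sub>F n in sequentially. \<forall>a. regime a n \<longrightarrow> (\<exists>x Q M \<beta>. saddle a n x Q M \<beta>)"
proof -
  have "\<forall>\<^sub>F n in sequentially. ln (real n) > 20"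
    by (rule eventually_nat_real) real_asymp
  moreover have "\<forall>\<^sub>F n in sequentially. real n > 100"
    by (rule eventually_nat_real) real_asymp
  moreover have "\<forall>\<^sub>F n in sequentially. ln (31/10 * ln (real n)) + ln 1024 + 2 \<le> ln (real n)"
    by (rule eventually_nat_real) real_asymp
  ultimately show ?thesis using regime_bounds regime_growth saddle_fun_root
  proof eventually_elim
    case (elim n)
    let ?L = "ln (real n)"
    have n0: "real n > 0" using elim(2) by simp
    show ?case
    proof (intro allI impI)
      fix a assume reg: "regime a n"
      have bd: "2 powr (real a - 1) \<le> (real n)\<^sup>2" "exp (-2) * (real n)\<^sup>2 / (real a)\<^sup>2 \<le> 2 powr (real a - 1)"
        "5/2 * ?L \<le> real a" "real a \<le> 31/10 * ?L" using elim(4) reg by auto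
      obtain R where R: "1/2 \<le> R" "R \<le> 1024" "saddle_fun a n R = 1 / sqrt (real n)" using elim(6) reg by blast
      have a: "a \<ge> 2" "real a > 0" using regime_gt_one[OF reg] by auto
      have R0: "R > 0" using R by simp
      define x where "x = real a * 2 powr (real a - 1) / R"
      define D where "D = tilt_mean a R"
      define W where "W = tilt_sum a R"
      define S where "S = dens a * x ^ a"
      define Q where "Q = S * W"
      define M where "M = real n / (real a - D)"
      have D: "1 \<le> D" "D \<le> real a - 1" unfolding D_def using tilt_mean_bounds[OF a(1) R0] by auto
      have W: "W \<ge> 1/2" "W \<le> exp 1024"
        unfolding W_def using tilt_sum_ge[OF a(1), of R] tilt_sum_le[of a R] R a by (auto intro: order.trans)
      have x0: "x > 0" unfolding x_def using a R0 by simp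
      have S0: "S > 0" unfolding S_def using x0 by simp
      have Q0: "Q > 0" unfolding Q_def using S0 W by simp
      have M0: "M > 0" unfolding M_def using n0 D by simp
      have Qs: "Q = (\<Sum>i\<in>{1..<a}. dens i * x ^ i)"
        unfolding Q_def S_def W_def by (rule dens_sums_tilt(1)[symmetric]) (use a R0 x_def in auto)
      have "(\<Sum>i\<in>{1..<a}. real i * (dens i * x ^ i)) = Q * (real a - D)"
        unfolding Q_def S_def W_def D_def by (rule dens_sums_tilt(2)) (use a R0 x_def in auto)
      then have Ms: "M = real n * Q / (\<Sum>i\<in>{1..<a}. real i * (dens i * x ^ i))"
        unfolding M_def using Q0 by simp
      define y where "y = ln (x / real n)"
      have y_eq: "y = ln (real a) + (real a - 1) * ln 2 - ln R - ?L"
        unfolding y_def x_def using R0 a n0 by (simp add: ln_mult ln_div ln_powr)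
      have xe: "ln x = y + ?L" unfolding y_def using x0 n0 by (simp add: ln_div)
      have lna: "ln (real a) \<le> ln (31/10 * ?L)" using a bd(4) by (subst ln_le_cancel_iff) auto
      have lna0: "ln (real a) \<ge> 0" using a by simp
      have "ln (2 powr (real a - 1)) \<le> ln ((real n)\<^sup>2)" using bd(1) n0 by (subst ln_le_cancel_iff) auto
      then have l2u: "(real a - 1) * ln 2 \<le> 2 * ?L" using n0 by (simp add: ln_powr ln_realpow)
      have "ln (exp (-2) * (real n)\<^sup>2 / (real a)\<^sup>2) \<le> ln (2 powr (real a - 1))" using bd(2) n0 a by (subst ln_le_cancel_iff) auto
      then have l2l: "2 * ?L - 2 - 2 * ln (real a) \<le> (real a - 1) * ln 2"
        using n0 a by (simp add: ln_powr ln_realpow ln_div ln_mult)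
      have lnR: "- 1 \<le> ln R" "ln R \<le> ln 1024"
      proof -
        have "ln (1/2) \<le> ln R" using R by (subst ln_le_cancel_iff) auto
        then show "- 1 \<le> ln R" using ln2_bounds by (simp add: ln_div)
        show "ln R \<le> ln 1024" using R by (subst ln_le_cancel_iff) auto
      qed
      have y0: "0 \<le> y" using y_eq l2l lnR elim(3) lna by linarith
      have "ln (1024::real) \<ge> 1"
      proof -
        have "exp (1::real) \<le> 1024" using exp_le by simp
        then show ?thesis by (subst ln_ge_iff) auto
      qed
      then have y2: "y \<le> 2 * ?L" using y_eq l2u lnR elim(3) lna by linarith
      have xn: "real n \<le> x"
      proof -
        have "ln (real n) \<le> ln x" using xe y0 by simp
        then show ?thesis using x0 n0 by simp
      qed
      have mus: "real n ^ a * dens a \<le> real n / (500 * (real a)\<^sup>2)"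
        by (rule power_dens_le[OF reg]) (use elim(5) reg in blast)
      have mus0: "real n ^ a * dens a > 0" using n0 by simp
      \<comment> \<open>Here M * S / Q = n / ((a - D) * W). As W \<le> exp R \<le> exp 1024 and
        \<open>n ^ a * dens a\<close> is at most n / a^2, the ratio \<open>exp \<beta>\<close> is at
        least a / exp 1024. So the constant 1024 is the upper end of the range of
        \<open>R\<close>.\<close>
      define \<beta> where "\<beta> = ?L - ln (real a - D) - ln W - ln (real n ^ a * dens a)"
      have lW: "ln W \<le> 1024"
      proof -
        have "ln W \<le> ln (exp 1024)" using W by (subst ln_le_cancel_iff) auto
        then show ?thesis by simp
      qed
      have lD: "ln (real a - D) \<le> ln (real a)" using D by (subst ln_le_cancel_iff) auto
      have lmus: "ln (real n ^ a * dens a) \<le> ?L - 2 * ln (real a)"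
      proof -
        have "real n ^ a * dens a \<le> real n / (real a)\<^sup>2"
          by (rule order.trans[OF mus]) (use a n0 in \<open>auto intro!: divide_left_mono\<close>)
        then have "ln (real n ^ a * dens a) \<le> ln (real n / (real a)\<^sup>2)" using mus0 n0 a by (subst ln_le_cancel_iff) auto
        then show ?thesis using n0 a by (simp add: ln_div ln_realpow)
      qed
      have b: "ln (real a) - 1024 \<le> \<beta>" unfolding \<beta>_def using lW lD lmus by linarith
      have Beq: "M * S / Q = exp \<beta> * (real n ^ a * dens a)"
      proof -
        have "exp \<beta> = real n / (real a - D) / W / (real n ^ a * dens a)"
          unfolding \<beta>_def using n0 D W mus0 by (simp only: exp_diff) simp
        moreover have "M * S / Q = real n / (real a - D) / W" unfolding M_def Q_def using S0 by simp
        ultimately show ?thesis using mus0 by simp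
      qed
      have lS: "ln S = ln (real n ^ a * dens a) + real a * y"
        unfolding S_def y_def using x0 n0 a by (simp add: ln_mult ln_realpow ln_div algebra_simps)
      have "ln (Q / M) = ln S + ln W + ln (real a - D) - ?L"
        unfolding Q_def M_def using S0 W D n0 by (simp add: ln_mult ln_div)
      then have lQM: "ln (Q / M) = real a * y - \<beta>" unfolding \<beta>_def lS by simp
      have "saddle_fun a n R = ln (real n ^ a * dens a) + D * y + ln W + ln (real a - D) - ?L + 1 - real a + D"
        unfolding saddle_fun_def D_def W_def y_def x_def ..
      \<comment> \<open>The root equation, solved for \<open>ln (Q / M) + 1\<close>. Multiplied by
        \<open>M\<close>, with M * (a - D) = n, it becomes the balance of the first moment with
        surplus \<open>M / sqrt n\<close>.\<close>
      then have Phi: "ln (Q / M) + 1 = (real a - D) * (y + 1) + 1 / sqrt (real n)"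
        unfolding lQM \<beta>_def using R(3) by (simp add: algebra_simps)
      have "M * (ln (Q / M) + 1) = (M * (real a - D)) * (y + 1) + M / sqrt (real n)"
        unfolding Phi by (simp add: algebra_simps)
      also have "M * (real a - D) = real n" unfolding M_def using D by simp
      finally have MPhi: "M * (ln (Q / M) + 1) = real n * ln x - real n * ln (real n) + real n + M / sqrt (real n)"
        unfolding xe by (simp add: algebra_simps)
      \<comment> \<open>Leads to \<open>M \<le> Q\<close>, so that \<open>M / Q\<close> can serve as
        the tilting parameter \<theta> \<le> 1.\<close>
      have "1 * 1 \<le> (real a - D) * (y + 1)" using D y0 by (intro mult_mono) auto
      then have "0 \<le> ln (Q / M)" using Phi n0 by (smt (verit) divide_nonneg_nonneg real_sqrt_ge_zero)
      then have QM: "M \<le> Q" using Q0 M0 by (simp add: field_simps)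
      have Mn: "M \<le> real n" "real n / real a \<le> M"
      proof -
        have "real n / (real a - D) \<le> real n / 1" using D n0 by (intro divide_left_mono) auto
        then show "M \<le> real n" unfolding M_def by simp
        show "real n / real a \<le> M" unfolding M_def using D n0 by (intro divide_left_mono) auto
      qed
      have "saddle a n x Q M \<beta>"
        unfolding saddle_def using Qs Ms xn M0 Mn QM Q0 y2 b Beq lQM MPhi
        unfolding S_def y_def by blast
      then show "\<exists>x Q M \<beta>. saddle a n x Q M \<beta>" by blast
    qed
  qed
qed

text \<open>The surplus \<open>M / sqrt n\<close> is at least of order sqrt n / ln n and beats the
  polylogarithmic losses of \<open>E_nkt_ge_exp\<close>. So some k \<le> M + a^2 has expectation at
  least 1.\<close>

lemma k_t_le:
  "\<forall>\<^sub>F n in sequentially. \<forall>a x Q M \<beta>. regime a n \<longrightarrow> saddle a n x Q M \<beta> \<longrightarrow> real (k_t (a - 1) n) \<le> M + (real a)\<^sup>2"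
proof -
  have "\<forall>\<^sub>F n in sequentially. real n > 100"
    by (rule eventually_nat_real) real_asymp
  moreover have "\<forall>\<^sub>F n in sequentially. ln (real n) > 2"
    by (rule eventually_nat_real) real_asymp
  moreover have "\<forall>\<^sub>F n in sequentially. sqrt (real n) / (31/10 * ln (real n)) \<ge> 
     3 * (31/10 * ln (real n))\<^sup>2 * ln (real n) + 31/10 * ln (real n) * (1026 + ln (real n))"
    by (rule eventually_nat_real) real_asymp
  ultimately show ?thesis using regime_bounds
  proof eventually_elim
    case (elim n)
    let ?L = "ln (real n)"
    have n0: "real n > 0" using elim(1) by simp
    show ?case
    proof (intro allI impI)
      fix a x Q M \<beta> assume reg: "regime a n" and sad: "saddle a n x Q M \<beta>"
      have bd: "real a \<le> 31/10 * ?L" using elim(4) reg by auto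
      have a: "a \<ge> 2" "real a > 0" using regime_gt_one[OF reg] by auto
      have ba: "real (a - 1) \<le> real a" by simp
      have I: "{1..<a} = {1..a-1}" by auto
      have Q: "Q = (\<Sum>i=1..a-1. dens i * x ^ i)" and M: "M = real n * Q / (\<Sum>i=1..a-1. real i * (dens i * x ^ i))"
        and s: "real n \<le> x" "0 < M" "real n / real a \<le> M" "M \<le> Q" "0 < Q" "ln (x / real n) \<le> 2 * ?L" "ln (real a) - 1024 \<le> \<beta>"
        "ln (Q / M) = real a * ln (x / real n) - \<beta>"
        "M * (ln (Q / M) + 1) = real n * ln x - real n * ln (real n) + real n + M / sqrt (real n)"
        using sad unfolding saddle_def I by blast+
      let ?q = "ln (Q / M)"
      have L0: "?L > 0" using elim(2) by simp
      have lna0: "ln (real a) \<ge> 0" using a by simp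
      have "\<exists>k. real k \<le> M + real (a - 1) ^ 2 \<and> E_nkt n k (a - 1) \<ge> exp (real n * ln (real n) - real n - real n * ln x
         + M * (?q + 1) - real (a - 1) ^ 2 * ln (real n) - real (a - 1) * (1 + ln (real n)) - real (a - 1) * (?q + 1))"
      proof (rule E_nkt_ge_exp[of "a - 1" n x, folded Q, folded M])
        show "M \<le> Q" by (rule s(4))
        show "1 \<le> x" using s(1) elim(1) by linarith
        show "1 \<le> n" using elim(1) by linarith
        show "1 \<le> a - 1" using a(1) by linarith
      qed
      then obtain k where k: "real k \<le> M + real (a - 1) ^ 2"
        "E_nkt n k (a - 1) \<ge> exp (real n * ln (real n) - real n - real n * ln x
         + M * (?q + 1) - real (a - 1) ^ 2 * ?L - real (a - 1) * (1 + ?L) - real (a - 1) * (?q + 1))"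
        by blast
      have q: "?q \<le> real a * (2 * ?L) + 1024"
      proof -
        have "real a * ln (x / real n) \<le> real a * (2 * ?L)" using s(6) a by (intro mult_left_mono) auto
        then show ?thesis using s(7,8) lna0 by linarith
      qed
      have q0: "?q \<ge> 0" using s(2,4,5) by (intro ln_ge_zero) (simp add: field_simps)
      have 1: "real (a - 1) ^ 2 * ?L \<le> (real a)\<^sup>2 * ?L" using ba L0 by (intro mult_right_mono power_mono) auto
      have 2: "real (a - 1) * (1 + ?L) \<le> real a * (1 + ?L)" using ba L0 by (intro mult_right_mono) auto
      have 3: "real (a - 1) * (?q + 1) \<le> real a * (real a * (2 * ?L) + 1024 + 1)" using ba q q0 by (intro mult_mono) auto
      have 4: "(real a)\<^sup>2 * ?L \<le> (31/10 * ?L)\<^sup>2 * ?L" using bd L0 a by (intro mult_right_mono power_mono) auto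
      have 5: "real a * (1026 + ?L) \<le> 31/10 * ?L * (1026 + ?L)" using bd L0 by (intro mult_right_mono) auto
      have 6: "sqrt (real n) / (31/10 * ?L) \<le> M / sqrt (real n)"
      proof -
        have "sqrt (real n) / (31/10 * ?L) \<le> sqrt (real n) / real a"
          using bd a L0 by (intro divide_left_mono) auto
        also have "\<dots> = real n / sqrt (real n) / real a" by (simp only: real_div_sqrt of_nat_0_le_iff)
        also have "\<dots> = real n / real a / sqrt (real n)" by simp
        also have "\<dots> \<le> M / sqrt (real n)" using s(3) by (intro divide_right_mono) auto
        finally show ?thesis .
      qed
      have "0 \<le> real n * ln (real n) - real n - real n * ln x
         + M * (?q + 1) - real (a - 1) ^ 2 * ?L - real (a - 1) * (1 + ?L) - real (a - 1) * (?q + 1)"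
      proof -
        have "real a * (real a * (2 * ?L) + 1024 + 1) + real a * (1 + ?L) = 2 * ((real a)\<^sup>2 * ?L) + real a * (1026 + ?L)"
          by (simp add: algebra_simps power2_eq_square)
        then show ?thesis unfolding s(9) using 1 2 3 4 5 6 elim(3) by linarith
      qed
      then have "E_nkt n k (a - 1) \<ge> 1"
        using k(2) by (meson one_le_exp_iff order.trans)
      then have "k_t (a - 1) n \<le> k" unfolding k_t_def by (rule Least_le)
      moreover have "real (a - 1) ^ 2 \<le> (real a)\<^sup>2" using ba by (intro power_mono) auto
      ultimately show "real (k_t (a - 1) n) \<le> M + (real a)\<^sup>2" using k(1) by linarith
    qed
  qed
qed

section \<open>First moment and planting in the regime\<close>

lemma card_classes_le_num_indep:
  assumes "partition_on {..<n} P" "\<forall>S\<in>P. indep E S"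
  shows "card {S\<in>P. card S = a} \<le> num_indep n a E"
  unfolding num_indep_def
  by (rule card_mono) (use assms in \<open>auto simp: subsets_of_def partition_on_def\<close>)

lemma num_indep_pos:
  assumes "S \<subseteq> {..<n}" "indep E S" "b \<le> card S"
  shows "num_indep n b E \<ge> 1"
proof -
  obtain T where T: "T \<subseteq> S" "card T = b" using obtain_subset_with_card_n[OF assms(3)] by blast
  have "T \<in> {S \<in> subsets_of n b. indep E S}"
    using T assms by (auto simp: subsets_of_def indep_def)
  moreover have "finite {S \<in> subsets_of n b. indep E S}" by simp
  ultimately show ?thesis unfolding num_indep_def by (metis One_nat_def Suc_leI card_gt_0_iff empty_iff)
qed

text \<open>A colouring that violates the restrictions on class sizes exhibits more than
  \<open>J\<close> independent \<open>a\<close>-sets or an independent set of size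
  \<open>a + 1\<close>; Markov's inequality bounds both.\<close>

lemma gnp_prob_chromatic_le:
  fixes J K :: real
  assumes "real k \<le> K" "J > 0"
  shows "gnp_prob n (\<lambda>E. chromatic n E \<le> k) \<le> 
     gnp_prob n (\<lambda>E. \<exists>P. partition_on {..<n} P \<and> real (card P) \<le> K \<and> (\<forall>S\<in>P. card S \<le> a) \<and>
            real (card {S\<in>P. card S = a}) \<le> J \<and> (\<forall>S\<in>P. indep E S)) + mu a n / J + mu (Suc a) n"
    (is "_ \<le> gnp_prob n ?main + _ + _")
proof -
  have "gnp_prob n (\<lambda>E. chromatic n E \<le> k) \<le> gnp_prob n (\<lambda>E. (?main E \<or> real (num_indep n a E) \<ge> J) \<or> real (num_indep n (Suc a) E) \<ge> 1)"
  proof (rule gnp_prob_mono)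
    fix E assume "chromatic n E \<le> k"
    then obtain P where P: "partition_on {..<n} P" "card P \<le> k" "\<forall>S\<in>P. indep E S"
      unfolding chromatic_le_iff colourable_def by auto
    have K: "real (card P) \<le> K" using P(2) assms(1) by linarith
    show "(?main E \<or> real (num_indep n a E) \<ge> J) \<or> real (num_indep n (Suc a) E) \<ge> 1"
    proof (cases "\<forall>S\<in>P. card S \<le> a")
      case True
      show ?thesis
      proof (cases "real (card {S\<in>P. card S = a}) \<le> J")
        case True
        then have "?main E" using P K \<open>\<forall>S\<in>P. card S \<le> a\<close> by blast
        then show ?thesis by blast
      next
        case False
        then have "J \<le> real (num_indep n a E)" using card_classes_le_num_indep[OF P(1,3), of a] by linarith
        then show ?thesis by blast
      qed
    next
      case False
      then obtain S where S: "S \<in> P" "Suc a \<le> card S" by auto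
      have "num_indep n (Suc a) E \<ge> 1"
        by (rule num_indep_pos[of S]) (use S P in \<open>auto simp: partition_on_def\<close>)
      then show ?thesis by simp
    qed
  qed
  also have "\<dots> \<le> gnp_prob n (\<lambda>E. ?main E \<or> real (num_indep n a E) \<ge> J) + gnp_prob n (\<lambda>E. real (num_indep n (Suc a) E) \<ge> 1)"
    by (rule gnp_prob_disj_le)
  also have "gnp_prob n (\<lambda>E. ?main E \<or> real (num_indep n a E) \<ge> J) \<le> gnp_prob n ?main + gnp_prob n (\<lambda>E. real (num_indep n a E) \<ge> J)"
    by (rule gnp_prob_disj_le)
  also have "gnp_prob n (\<lambda>E. real (num_indep n a E) \<ge> J) \<le> mu a n / J"
    using markov[of n "\<lambda>E. real (num_indep n a E)" J] assms by (simp add: mean_num_indep)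
  also have "gnp_prob n (\<lambda>E. real (num_indep n (Suc a) E) \<ge> 1) \<le> mu (Suc a) n"
    using markov[of n "\<lambda>E. real (num_indep n (Suc a) E)" 1] by (simp add: mean_num_indep)
  finally show ?thesis by simp
qed

lemma mu_Suc_le:
  assumes "a \<ge> 1"
  shows "mu (Suc a) n \<le> mu a n * (real n / real a) * 2 powr - real a"
proof -
  have "real (Suc a * (n choose Suc a)) = real ((n choose a) * (n - a))" by (simp only: choose_times_diff)
  then have "real (n choose Suc a) = real (n choose a) * real (n - a) / real (Suc a)"
    by (simp add: field_simps)
  also have "\<dots> \<le> real (n choose a) * real n / real a"
    using assms by (intro frac_le mult_left_mono) auto
  finally have h1: "real (n choose Suc a) \<le> real (n choose a) * real n / real a" .
  have h2: "2 powr - real (Suc a choose 2) = 2 powr - real (a choose 2) * 2 powr - real a"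
  proof -
    have "- real (Suc a choose 2) = - real (a choose 2) + - real a" by (simp add: choose_two_real field_simps)
    then show ?thesis by (simp only: powr_add)
  qed
  have "mu (Suc a) n \<le> (real (n choose a) * real n / real a) * (2 powr - real (a choose 2) * 2 powr - real a)"
    unfolding mu_def h2 by (intro mult_right_mono h1) auto
  then show ?thesis unfolding mu_def by (simp add: mult_ac)
qed

text \<open>Passing from \<open>a\<close> to \<open>a + 1\<close> multiplies \<open>mu\<close> by at
  most n' / (a * 2^a). As 2^a is at least of order n^2 / a^2, this factor is at most of order a / n,
  against \<open>mu a n'\<close> of order n / a^2. Larger independent sets are therefore unlikely
  throughout the stretch.\<close>

lemma regime_mu_Suc:
  "\<forall>\<^sub>F n in sequentially. \<forall>a n'. regime a n \<longrightarrow> n \<le> n' \<longrightarrow> real n' \<le> real n + real n / real a \<longrightarrow>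
     mu a n' \<le> 9 * mu a n \<and> mu (Suc a) n' \<le> 1 / 10"
  using regime_bounds regime_growth
proof eventually_elim
  case (elim n)
  show ?case
  proof (intro allI impI)
    fix a n' assume reg: "regime a n" and n': "n \<le> n'" "real n' \<le> real n + real n / real a"
    have a: "a \<ge> 2" using regime_gt_one[OF reg] by simp
    have n0: "real n > 0" using reg by (simp add: regime_def)
    have "mu a n' \<le> real n' ^ a * dens a" by (rule mu_le_power)
    also have "\<dots> \<le> 9 * mu a n" using elim(2) reg n'(2) by auto
    finally have mu9: "mu a n' \<le> 9 * mu a n" .
    also have "\<dots> \<le> 9 * (real n / (5000 * (real a)\<^sup>2))" using reg by (simp add: regime_def)
    finally have mu': "mu a n' \<le> 9 * real n / (5000 * (real a)\<^sup>2)" by simp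
    have "real n / real a \<le> real n / 1" using a by (intro divide_left_mono) auto
    then have n2: "real n' \<le> 2 * real n" using n'(2) by simp
    have pw: "2 powr - real a \<le> exp 2 * (real a)\<^sup>2 / (2 * (real n)\<^sup>2)"
    proof -
      have "2 powr - real a = 1 / (2 * 2 powr (real a - 1))"
        by (simp add: powr_diff powr_minus field_simps)
      also have "\<dots> \<le> 1 / (2 * (exp (-2) * (real n)\<^sup>2 / (real a)\<^sup>2))"
        using elim(1) reg a n0 by (intro divide_left_mono mult_left_mono) auto
      also have "\<dots> = exp 2 * (real a)\<^sup>2 / (2 * (real n)\<^sup>2)" by (simp add: exp_minus field_simps)
      finally show ?thesis .
    qed
    have "mu (Suc a) n' \<le> mu a n' * (real n' / real a) * 2 powr - real a" by (rule mu_Suc_le) (use a in simp)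
    also have "\<dots> \<le> 9 * real n / (5000 * (real a)\<^sup>2) * (2 * real n / real a) * (exp 2 * (real a)\<^sup>2 / (2 * (real n)\<^sup>2))"
      by (intro mult_mono mu' pw divide_right_mono n2) (auto simp: mu_nonneg)
    also have "\<dots> = 9 * exp 2 / (5000 * real a)" using n0 a by (simp add: field_simps power2_eq_square)
    also have "\<dots> \<le> 9 * 9 / (5000 * 1)" using exp_2_le_9 a by (intro frac_le) auto
    also have "\<dots> \<le> 1 / 10" by simp
    finally show "mu a n' \<le> 9 * mu a n \<and> mu (Suc a) n' \<le> 1 / 10" using mu9 by simp
  qed
qed

text \<open>Write \<open>n' = n + N\<close>. In the logarithm of the first moment bound of
  \<open>gnp_prob_colouring_le\<close> at \<open>n'\<close> the terms of order \<open>n * ln n\<close> cancel by the choice of the saddle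
  point at \<open>n\<close>, and \<open>- (N / a - J) * \<beta>\<close> with \<open>\<beta> \<ge> ln (ln n) - O(1)\<close> remains.\<close>

lemma first_moment_bound:
  assumes sad: "saddle a n x Q M \<beta>" and a: "a \<ge> 2" "a \<le> n'" and n: "n \<ge> 1" "n \<le> n'"
    and \<beta>: "\<beta> \<ge> 0" and N: "N = real n' - real n"
  shows "gnp_prob n' (\<lambda>E. \<exists>P. partition_on {..<n'} P \<and> real (card P) \<le> M + N / real a + g \<and> (\<forall>S\<in>P. card S \<le> a) \<and>
            real (card {S\<in>P. card S = a}) \<le> J \<and> (\<forall>S\<in>P. indep E S))
      \<le> exp (1 + ln (real n') + N\<^sup>2 / real n + M / sqrt (real n) - (N / real a - J) * \<beta> + g * ln (Q / M) + real n ^ a * dens a)"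
proof -
  define K where "K = M + N / real a + g"
  have Q: "Q = (\<Sum>i\<in>{1..<a}. dens i * x ^ i)"
    and s: "real n \<le> x" "0 < M" "M \<le> Q" "0 < Q"
    "M * (dens a * x ^ a) / Q = exp \<beta> * (real n ^ a * dens a)"
    "ln (Q / M) = real a * ln (x / real n) - \<beta>"
    "M * (ln (Q / M) + 1) = real n * ln x - real n * ln (real n) + real n + M / sqrt (real n)"
    using sad unfolding saddle_def by blast+
  have n0: "real n > 0" "real n' > 0" using n by auto
  have x0: "x > 0" using s(1) n0 by linarith
  \<comment> \<open>\<theta> = M / Q makes the bulk \<theta> * Q equal to \<open>M\<close>; \<eta> =
    exp (-\<beta>) lowers the contribution of the classes of size \<open>a\<close> from what the
    saddle point would prefer to \<open>n ^ a * dens a\<close>.\<close>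
  let ?\<theta> = "M / Q" and ?\<eta> = "exp (- \<beta>)" and ?q = "ln (Q / M)" and ?y = "ln (x / real n)"
  let ?mus = "real n ^ a * dens a"
  have main: "gnp_prob n' (\<lambda>E. \<exists>P. partition_on {..<n'} P \<and> real (card P) \<le> K \<and> (\<forall>S\<in>P. card S \<le> a) \<and>
            real (card {S\<in>P. card S = a}) \<le> J \<and> (\<forall>S\<in>P. indep E S))
    \<le> fact n' / x ^ n' * ?\<theta> powr (-K) * ?\<eta> powr (-J) * exp (?\<theta> * ((\<Sum>i\<in>{1..<a}. dens i * x ^ i) + ?\<eta> * dens a * x ^ a))"
    by (rule gnp_prob_colouring_le) (use a x0 s \<beta> in auto)
  have e1: "?\<theta> * ((\<Sum>i\<in>{1..<a}. dens i * x ^ i) + ?\<eta> * dens a * x ^ a) = M + ?mus"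
  proof -
    have "?\<theta> * (Q + ?\<eta> * dens a * x ^ a) = M + ?\<eta> * (M * (dens a * x ^ a) / Q)"
      using s by (simp add: field_simps)
    also have "\<dots> = M + ?mus" unfolding s(5) by (simp add: exp_minus)
    finally show ?thesis unfolding Q[symmetric] .
  qed
  have e2: "?\<theta> powr (-K) = exp (K * ?q)"
    using s by (simp add: powr_def ln_div algebra_simps)
  have e3: "?\<eta> powr (-J) = exp (J * \<beta>)" by (simp add: powr_def)
  have e4: "fact n' / x ^ n' = exp (ln (fact n') - real n' * ln x)"
    using x0 by (simp add: exp_diff exp_of_nat_mult)
  have lx: "ln x = ?y + ln (real n)" using x0 n0 by (simp add: ln_div)
  have "ln (real n') - ln (real n) = ln (real n' / real n)" using n0 by (simp add: ln_div)
  also have "\<dots> \<le> real n' / real n - 1" using n0 by (intro ln_le_minus_one) auto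
  also have "\<dots> = N / real n" unfolding N using n0 by (simp add: field_simps)
  finally have "real n' * (ln (real n') - ln (real n)) \<le> real n' * (N / real n)" by (intro mult_left_mono) auto
  also have "\<dots> = N + N\<^sup>2 / real n" unfolding N using n0 by (simp add: field_simps power2_eq_square)
  finally have l: "real n' * (ln (real n') - ln (real n)) \<le> N + N\<^sup>2 / real n" .
  have 1: "M * ?q + M = real n * ?y + real n + M / sqrt (real n)"
    using s(7) unfolding lx by (simp add: algebra_simps)
  \<comment> \<open>The source of the gain: a colour brings a * y - \<beta>, while the
    \<open>a\<close> additional vertices that it should serve cost a * y. So N / a colours for N
    vertices fall short by N / a * \<beta>, of which the factor in \<eta> gives back J *
    \<beta>.\<close>
  have 2: "N / real a * ?q = N * ?y - N / real a * \<beta>"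
    unfolding s(6) using a by (simp add: field_simps)
  have 3: "N * ?y = real n' * ?y - real n * ?y" unfolding N by (rule left_diff_distrib)
  have 4: "real n' * ln x = real n' * ?y + real n' * ln (real n)" unfolding lx by (rule distrib_left)
  have 5: "real n' * (ln (real n') - ln (real n)) = real n' * ln (real n') - real n' * ln (real n)"
    by (rule right_diff_distrib)
  have 6: "K * ?q = M * ?q + N / real a * ?q + g * ?q" unfolding K_def by (simp add: distrib_right)
  have 7: "(N / real a - J) * \<beta> = N / real a * \<beta> - J * \<beta>" by (rule left_diff_distrib)
  have "ln (fact n') \<le> 1 + ln (real n') + real n' * ln (real n') - real n'"
    using n by (intro ln_fact_le) auto
  then have "ln (fact n') - real n' * ln x + K * ?q + J * \<beta> + (M + ?mus) \<le> 
     1 + ln (real n') + N\<^sup>2 / real n + M / sqrt (real n) - (N / real a - J) * \<beta> + g * ?q + ?mus"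
    using 1 2 3 4 5 6 7 l N by argo
  then have "exp (ln (fact n') - real n' * ln x + K * ?q + J * \<beta> + (M + ?mus)) \<le> 
     exp (1 + ln (real n') + N\<^sup>2 / real n + M / sqrt (real n) - (N / real a - J) * \<beta> + g * ?q + ?mus)"
    by simp
  moreover have "exp (ln (fact n') - real n' * ln x + K * ?q + J * \<beta> + (M + ?mus)) =
     fact n' / x ^ n' * ?\<theta> powr (-K) * ?\<eta> powr (-J) * exp (?\<theta> * ((\<Sum>i\<in>{1..<a}. dens i * x ^ i) + ?\<eta> * dens a * x ^ a))"
    unfolding e1 e2 e3 e4 by (simp only: exp_add)
  ultimately show ?thesis using main unfolding K_def by linarith
qed

text \<open>In units of U = n / a^2 the shortfall (N / a - J) * \<beta> is at least U / 2 * (ln a -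
  1024). The surplus \<open>g\<close> of colours is priced at
  \<open>ln (Q / M) \<le> 2 * a * ln n\<close> and may use up U / 8 * ln a; the other terms are
  O(U). The threshold ln a \<ge> 2000 lets 3/8 * ln a win against the constant 512.\<close>

lemma chromatic_lower_bound:
  "\<forall>\<^sub>F n in sequentially. \<forall>a x Q M \<beta> n' k g. regime a n \<longrightarrow> saddle a n x Q M \<beta> \<longrightarrow> n \<le> n' \<longrightarrow>
     real n' \<le> real n + real n / real a \<longrightarrow> 3/4 * (real n / real a) \<le> real n' - real n \<longrightarrow>
     real k \<le> M + (real n' - real n) / real a + g \<longrightarrow> 0 \<le> g \<longrightarrow>
     g * (2 * real a * ln (real n)) \<le> 1/8 * (real n / (real a)\<^sup>2) * ln (real a) \<longrightarrow>
     gnp_prob n' (\<lambda>E. chromatic n' E \<le> k) \<le> 1/2"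
proof -
  have "\<forall>\<^sub>F n in sequentially. ln (5/2 * ln (real n)) \<ge> 2000"
    by (rule eventually_nat_real) real_asymp
  moreover have "\<forall>\<^sub>F n in sequentially. ln (real n) > 20"
    by (rule eventually_nat_real) real_asymp
  moreover have "\<forall>\<^sub>F n in sequentially. real n / (31/10 * ln (real n))\<^sup>2 \<ge> ln (real n) + sqrt (real n) + 5"
    by (rule eventually_nat_real) real_asymp
  ultimately show ?thesis using regime_bounds regime_growth regime_mu_Suc
  proof eventually_elim
    case (elim n)
    let ?L = "ln (real n)"
    show ?case
    proof (intro allI impI)
      fix a x Q M \<beta> n' k g
      assume reg: "regime a n" and sad: "saddle a n x Q M \<beta>" and n': "n \<le> n'" "real n' \<le> real n + real n / real a"
        and N34: "3/4 * (real n / real a) \<le> real n' - real n" and k: "real k \<le> M + (real n' - real n) / real a + g"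
        and g: "0 \<le> g" "g * (2 * real a * ?L) \<le> 1/8 * (real n / (real a)\<^sup>2) * ln (real a)"
      have a: "a \<ge> 2" "a \<le> n" "real a > 0" using regime_gt_one[OF reg] by auto
      have n0: "n \<ge> 1" "real n > 0" using reg by (auto simp: regime_def)
      have s: "M \<le> real n" "0 < M" "ln (x / real n) \<le> 2 * ?L" "ln (real a) - 1024 \<le> \<beta>"
        "ln (Q / M) = real a * ln (x / real n) - \<beta>"
        using sad unfolding saddle_def by blast+
      have bd: "5/2 * ?L \<le> real a" "real a \<le> 31/10 * ?L" using elim(4) reg by auto
      have "ln (5/2 * ?L) \<le> ln (real a)" using bd(1) elim(2) a by (subst ln_le_cancel_iff) auto
      then have lna: "ln (real a) \<ge> 2000" using elim(1) by linarith
      then have b0: "\<beta> \<ge> 0" using s(4) by linarith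
      define N where "N = real n' - real n"
      define U where "U = real n / (real a)\<^sup>2"
      \<comment> \<open>The factor 100 makes Markov's inequality lose only 1 / 100. Then J \<le> 100
        * 9 * U / 5000 = 18/100 * U, which leaves more than U / 2 of the 3/4 * U from N / a.\<close>
      define J where "J = 100 * mu a n'"
      have U0: "U > 0" unfolding U_def using n0 a by simp
      have mu: "mu a n' \<le> 9 * mu a n" "mu (Suc a) n' \<le> 1/10" using elim(6) reg n' by auto
      have "mu a n \<ge> real n / (10000 * (real a)\<^sup>2)" using reg by (simp add: regime_def)
      moreover have "real n / (10000 * (real a)\<^sup>2) > 0" using n0 a by simp
      ultimately have "mu a n > 0" by linarith
      then have J0: "J > 0" "mu a n' > 0" unfolding J_def using mu_mono[OF n'(1), of a] by auto
      have JU: "J \<le> 18/100 * U"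
      proof -
        have "mu a n \<le> real n / (5000 * (real a)\<^sup>2)" using reg by (simp add: regime_def)
        also have "\<dots> = U / 5000" unfolding U_def by simp
        finally show ?thesis unfolding J_def using mu(1) by simp
      qed
      have "3/4 * (real n / real a) / real a \<le> N / real a" unfolding N_def using N34 a by (intro divide_right_mono) auto
      then have NU: "3/4 * U \<le> N / real a" unfolding U_def by (simp add: power2_eq_square)
      have "1/2 * U * (ln (real a) - 1024) \<le> (N / real a - J) * \<beta>"
      proof (rule mult_mono)
        show "1/2 * U \<le> N / real a - J" using NU JU U0 by linarith
        then show "0 \<le> N / real a - J" using U0 by linarith
      qed (use s(4) lna in auto)
      then have t1: "1/2 * (U * ln (real a)) - 512 * U \<le> (N / real a - J) * \<beta>" by (simp add: algebra_simps)
      have N0: "0 \<le> N" unfolding N_def using n' by simp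
      have "N\<^sup>2 \<le> (real n / real a)\<^sup>2" using N0 n'(2) unfolding N_def by (intro power_mono) auto
      then have "N\<^sup>2 / real n \<le> (real n / real a)\<^sup>2 / real n" by (rule divide_right_mono) simp
      also have "\<dots> = U" unfolding U_def using n0 by (simp add: power2_eq_square)
      finally have t2: "N\<^sup>2 / real n \<le> U" .
      have "M / sqrt (real n) \<le> real n / sqrt (real n)" using s(1) by (intro divide_right_mono) auto
      then have t3: "M / sqrt (real n) \<le> sqrt (real n)" by (simp only: real_div_sqrt of_nat_0_le_iff)
      have "real a * ln (x / real n) \<le> real a * (2 * ?L)" using s(3) a by (intro mult_left_mono) auto
      then have "ln (Q / M) \<le> 2 * real a * ?L" using s(5) b0 by linarith
      then have "g * ln (Q / M) \<le> g * (2 * real a * ?L)" using g(1) by (rule mult_left_mono)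
      then have t4: "g * ln (Q / M) \<le> 1/8 * (U * ln (real a))" using g(2) unfolding U_def by (simp add: mult.assoc)
      have "real n ^ a * dens a \<le> real n / (500 * (real a)\<^sup>2)"
        by (rule power_dens_le[OF reg]) (use elim(5) reg in blast)
      also have "\<dots> = U / 500" unfolding U_def by simp
      finally have t5: "real n ^ a * dens a \<le> U / 500" .
      have t6: "ln (real n') \<le> ?L + 1"
      proof -
        have "real n / real a \<le> real n / 1" using a by (intro divide_left_mono) auto
        then have "real n' \<le> real n * 2" using n'(2) by simp
        also have "\<dots> \<le> real n * exp 1" using exp_ge_add_one_self[of 1] by (intro mult_left_mono) auto
        finally have "ln (real n') \<le> ln (real n * exp 1)" using n0 n' by (subst ln_le_cancel_iff) auto
        then show ?thesis using n0 by (simp add: ln_mult)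
      qed
      have t7: "U \<ge> ?L + sqrt (real n) + 5"
      proof -
        have "real n / (31/10 * ?L)\<^sup>2 \<le> U" unfolding U_def
          using bd a elim(2) by (intro divide_left_mono power_mono) auto
        then show ?thesis using elim(3) by linarith
      qed
      have t8: "U * 2000 \<le> U * ln (real a)" using U0 lna by (intro mult_left_mono) auto
      have "gnp_prob n' (\<lambda>E. \<exists>P. partition_on {..<n'} P \<and> real (card P) \<le> M + N / real a + g \<and> (\<forall>S\<in>P. card S \<le> a) \<and>
            real (card {S\<in>P. card S = a}) \<le> J \<and> (\<forall>S\<in>P. indep E S))
      \<le> exp (1 + ln (real n') + N\<^sup>2 / real n + M / sqrt (real n) - (N / real a - J) * \<beta> + g * ln (Q / M) + real n ^ a * dens a)"
        by (rule first_moment_bound[OF sad]) (use a n0 n' b0 N_def in auto)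
      also have "\<dots> \<le> exp (-2)" using t1 t2 t3 t4 t5 t6 t7 t8 U0 by (subst exp_le_cancel_iff) argo
      also have "exp (-2) \<le> (1/3 :: real)"
        using exp_ge_add_one_self[of "2::real"] by (simp add: exp_minus field_simps)
      finally have main: "gnp_prob n' (\<lambda>E. \<exists>P. partition_on {..<n'} P \<and> real (card P) \<le> M + N / real a + g \<and> (\<forall>S\<in>P. card S \<le> a) \<and>
            real (card {S\<in>P. card S = a}) \<le> J \<and> (\<forall>S\<in>P. indep E S)) \<le> 1/3" .
      have "mu a n' / J = 1/100" unfolding J_def using J0 by simp
      then show "gnp_prob n' (\<lambda>E. chromatic n' E \<le> k) \<le> 1/2"
        using gnp_prob_chromatic_le[of k "M + N / real a + g" J n' a] k J0 main mu(2) unfolding N_def by simp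
    qed
  qed
qed

text \<open>Up to logarithmic factors 2^a is n^2. Hence 2^(a/6) is about n^(1/3) and
  \<open>q\<close> about n^(-2/3), so mu * q^2 tends to 0; and 2^(-2a/3) is about n^(-4/3), so
  \<open>z\<close> tends to 0. The standard deviation is then at most 2 * sqrt mu, and one planting
  loses at most 2 / sqrt mu.\<close>

lemma regime_planting:
  "\<forall>\<^sub>F n in sequentially. \<forall>a n' m. regime a n \<longrightarrow> n \<le> n' \<longrightarrow> real (n' + a) \<le> real n + real n / real a \<longrightarrow>
     gnp_prob (n' + a) (\<lambda>E. chromatic (n' + a) E \<le> Suc m) \<ge> gnp_prob n' (\<lambda>E. chromatic n' E \<le> m) - 2 / sqrt (mu a n)"
proof -
  have "\<forall>\<^sub>F n in sequentially. ln (real n) > 20"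
    by (rule eventually_nat_real) real_asymp
  moreover have "\<forall>\<^sub>F n in sequentially. 2 * (31/10 * ln (real n))\<^sup>2 * real n powr (-2/3) \<le> 1/4"
    by (rule eventually_nat_real) real_asymp
  moreover have "\<forall>\<^sub>F n in sequentially. (2 * (2 * (31/10 * ln (real n))\<^sup>2 * real n powr (-2/3)))\<^sup>2 * real n \<le> 1/2"
    by (rule eventually_nat_real) real_asymp
  moreover have "\<forall>\<^sub>F n in sequentially. 4 * (31/10 * ln (real n)) * real n * (exp (-2) * (real n)\<^sup>2 / (31/10 * ln (real n))\<^sup>2) powr (-2/3) \<le> 1/2"
    by (rule eventually_nat_real) real_asymp
  ultimately show ?thesis using regime_bounds regime_growth regime_mu_Suc
  proof eventually_elim
    case (elim n)
    let ?L = "ln (real n)"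
    show ?case
    proof (intro allI impI)
      fix a n' m assume reg: "regime a n" and n': "n \<le> n'" and na: "real (n' + a) \<le> real n + real n / real a"
      let ?n = "n' + a" and ?T = "2 powr (real a - 1)"
      have a: "a \<ge> 2" "a \<le> n" "real a > 0" using regime_gt_one[OF reg] by auto
      have n0: "n \<ge> 1" "real n > 0" using reg by (auto simp: regime_def)
      have bd: "?T \<le> (real n)\<^sup>2" "exp (-2) * (real n)\<^sup>2 / (real a)\<^sup>2 \<le> ?T" "real a \<le> 31/10 * ?L" using elim(5) reg by auto
      have mu9: "mu a ?n \<le> 9 * mu a n" using elim(7) reg n' na by auto
      have "mu a n \<ge> real n / (10000 * (real a)\<^sup>2)" using reg by (simp add: regime_def)
      moreover have "real n / (10000 * (real a)\<^sup>2) > 0" using n0 a by simp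
      ultimately have mu0: "mu a n > 0" by linarith
      have mule: "mu a n \<le> mu a ?n" using n' by (intro mu_mono) simp
      have "real n / real a \<le> real n / 1" using a by (intro divide_left_mono) auto
      then have n2: "real ?n \<le> 2 * real n" using na by simp
      have aa: "(real a)\<^sup>2 \<le> (31/10 * ?L)\<^sup>2" using bd a by (intro power_mono) auto
      have a1: "(real a)\<^sup>2 \<ge> 1" using a by (intro one_le_power) auto
      have mun: "mu a ?n \<le> real n"
      proof -
        have "mu a n \<le> real n / (5000 * (real a)\<^sup>2)" using reg by (simp add: regime_def)
        also have "\<dots> \<le> real n / (5000 * 1)" using a1 n0 a by (intro divide_left_mono) auto
        finally show ?thesis using mu9 n0 by simp
      qed
      define q where "q = real a ^ 2 / real (?n - a) * 2 powr (real a / 6)"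
      define q0 where "q0 = 2 * (31/10 * ?L)\<^sup>2 * real n powr (-2/3)"
      have q: "q \<le> 2 * q0"
      proof -
        have "2 powr (real a / 6) = 2 powr (1/6) * ?T powr (1/6)"
          by (simp add: powr_powr flip: powr_add) (simp add: field_simps)
        also have "\<dots> \<le> 2 powr 1 * ((real n)\<^sup>2) powr (1/6)"
          using bd(1) by (intro mult_mono powr_mono powr_mono2) auto
        also have "\<dots> = 2 * real n powr (1/3)" using n0 by (simp add: powr_powr flip: powr_numeral)
        finally have 1: "2 powr (real a / 6) \<le> 2 * real n powr (1/3)" .
        have "q \<le> (31/10 * ?L)\<^sup>2 / real n * (2 * real n powr (1/3))"
          unfolding q_def using aa n0 n' by (intro mult_mono frac_le 1) auto
        also have "\<dots> = q0"
        proof -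
          have "real n powr (-2/3) = real n powr (1/3) / real n"
          proof -
            have "real n powr (-2/3) = real n powr (1/3 - 1)" by simp
            also have "\<dots> = real n powr (1/3) / real n" using n0 by (simp only: powr_diff powr_one_gt_zero_iff) simp
            finally show ?thesis .
          qed
          then show ?thesis unfolding q0_def by simp
        qed
        finally have "q \<le> q0" .
        moreover have "q0 \<ge> 0" unfolding q0_def by simp
        ultimately show ?thesis by simp
      qed
      have qpos: "q \<ge> 0" unfolding q_def by simp
      have q1: "q \<le> 1/2" using q elim(2) unfolding q0_def by linarith
      have q2: "2 * mu a ?n * q\<^sup>2 \<le> 1"
      proof -
        have "2 * mu a ?n * q\<^sup>2 \<le> 2 * real n * (2 * q0)\<^sup>2"
          using q qpos mun by (intro mult_mono power_mono) (auto simp: mu_nonneg)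
        also have "\<dots> \<le> 1" using elim(3) unfolding q0_def by (simp add: mult_ac)
        finally show ?thesis .
      qed
      have z: "real a * real ?n * 2 powr (1/2 - 2 * real a / 3) \<le> 1/2"
      proof -
        have "2 powr (1/2 - 2 * real a / 3) = 2 powr (- 1/6) * ?T powr (-2/3)"
          by (simp add: powr_powr flip: powr_add) (simp add: field_simps)
        also have "\<dots> \<le> 1 * (exp (-2) * (real n)\<^sup>2 / (real a)\<^sup>2) powr (-2/3)"
        proof (intro mult_mono powr_mono2')
          show "2 powr (- 1/6) \<le> (1::real)" using powr_mono[of "- 1/6" 0 "2::real"] by simp
        qed (use bd(2) n0 a in auto)
        also have "\<dots> \<le> (exp (-2) * (real n)\<^sup>2 / (31/10 * ?L)\<^sup>2) powr (-2/3)"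
          unfolding mult_1 using aa n0 a elim(1) by (intro powr_mono2' divide_left_mono) auto
        finally have 1: "2 powr (1/2 - 2 * real a / 3) \<le> (exp (-2) * (real n)\<^sup>2 / (31/10 * ?L)\<^sup>2) powr (-2/3)" .
        have "real a * real ?n * 2 powr (1/2 - 2 * real a / 3) \<le> 31/10 * ?L * (2 * real n) * (exp (-2) * (real n)\<^sup>2 / (31/10 * ?L)\<^sup>2) powr (-2/3)"
          using bd n2 elim(1) by (intro mult_mono 1) auto
        also have "\<dots> \<le> 4 * (31/10 * ?L) * real n * (exp (-2) * (real n)\<^sup>2 / (31/10 * ?L)\<^sup>2) powr (-2/3)"
          using elim(1) by (simp add: mult_ac)
        finally show ?thesis using elim(4) by linarith
      qed
      have "mean ?n (\<lambda>E. (real (num_indep ?n a E) - mu a ?n)\<^sup>2) \<le> 4 * mu a ?n"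
        by (rule variance_num_indep_le_four_mu) (use n0 n' a q1 q2 z in \<open>auto simp: q_def\<close>)
      then have "sqrt (mean ?n (\<lambda>E. (real (num_indep ?n a E) - mu a ?n)\<^sup>2)) \<le> sqrt (4 * mu a ?n)" by simp
      then have "sqrt (mean ?n (\<lambda>E. (real (num_indep ?n a E) - mu a ?n)\<^sup>2)) / mu a ?n \<le> 2 * sqrt (mu a ?n) / mu a ?n"
        using mu_nonneg[of a ?n] by (intro divide_right_mono) (auto simp: real_sqrt_mult)
      also have "\<dots> = 2 / sqrt (mu a ?n)"
        using mu0 mule by (simp add: field_simps) 
      also have "\<dots> \<le> 2 / sqrt (mu a n)" using mu0 mule by (intro divide_left_mono) auto
      finally show "gnp_prob ?n (\<lambda>E. chromatic ?n E \<le> Suc m) \<ge> gnp_prob n' (\<lambda>E. chromatic n' E \<le> m) - 2 / sqrt (mu a n)"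
        using planting[of a n' m] a mu0 mule by simp
    qed
  qed
qed

section \<open>Iterating along a stretch of n\<close>

text \<open>The least \<open>n\<close> at which \<open>mu a n\<close> reaches the lower bound of the
  regime will do. There \<open>mu a n\<close> is at most twice \<open>mu a (n - 1)\<close>, which is
  still below that bound; this is why the two constants of the regime differ by a factor 2.\<close>

lemma regime_exists:
  assumes "a > 20000"
  shows "\<exists>n\<ge>a. regime a n"
proof -
  define R where "R = (\<lambda>n. n \<ge> 1 \<and> real n / (10000 * (real a)\<^sup>2) \<le> mu a n)"
  have a: "real a \<ge> 20000" using assms by simp
  \<comment> \<open>With n = a * m and m = 2 ^ (a choose 2), the binomial coefficient is at least
    m^a \<ge> m^2, whence \<open>mu a n \<ge> m\<close>.\<close>
  have "R (a * 2 ^ (a choose 2))"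
  proof -
    define m where "m = (2::nat) ^ (a choose 2)"
    have m: "real m \<ge> 1" unfolding m_def by simp
    have "real m ^ a \<le> real ((a * m) choose a)"
      using binomial_ge_n_over_k_pow_k[of a "a * m", where 'a = real] assms m by simp
    moreover have "real m ^ 2 \<le> real m ^ a" using m assms by (intro power_increasing) auto
    ultimately have "real m ^ 2 \<le> real ((a * m) choose a)" by linarith
    then have "real m ^ 2 * 2 powr - real (a choose 2) \<le> mu a (a * m)"
      unfolding mu_def by (intro mult_right_mono) auto
    also have "real m ^ 2 * 2 powr - real (a choose 2) = real m"
      unfolding m_def by (simp add: powr_minus powr_realpow power2_eq_square)
    finally have "real m \<le> mu a (a * m)" .
    moreover have "real (a * m) / (10000 * (real a)\<^sup>2) \<le> real m"
    proof -
      have "real m * (real a * 1) \<le> real m * (real a * (10000 * real a))"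
        using a m by (intro mult_left_mono) auto
      then show ?thesis using a by (simp add: divide_le_eq power2_eq_square mult_ac)
    qed
    ultimately show ?thesis unfolding R_def using m assms by (simp add: m_def)
  qed
  define n where "n = (LEAST n. R n)"
  have Rn: "R n" unfolding n_def using \<open>R _\<close> by (rule LeastI)
  then have n1: "n \<ge> 1" "real n / (10000 * (real a)\<^sup>2) \<le> mu a n" by (auto simp: R_def)
  have na: "n \<ge> a"
  proof (rule ccontr)
    assume "\<not> ?thesis"
    then have "mu a n = 0" by (simp add: mu_def binomial_eq_0)
    moreover have "real n / (10000 * (real a)\<^sup>2) > 0" using n1 a by simp
    ultimately show False using n1 by linarith
  qed
  \<comment> \<open>Comparing (2 * a)^2 with n^2 through \<open>2 powr (a - 1)\<close> yields n
    \<ge> 2 * a, which gives n / (n - a) \<le> 2 below.\<close>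
  have "2 powr (real a - 1) \<le> (real n)\<^sup>2"
    by (rule two_powr_le_of_mu) (use assms na n1 in auto)
  moreover have "(2 * real a)\<^sup>2 \<le> 2 powr (real a - 1)"
  proof -
    have "(2 * Suc k)\<^sup>2 \<le> 2 ^ k" if "k \<ge> 20" for k :: nat
      using that
    proof (induction k rule: dec_induct)
      case (step k)
      have "2 * 1 \<le> k * k" using step by (intro mult_mono) auto
      then have "Suc (Suc k) * Suc (Suc k) \<le> 2 * (Suc k * Suc k)" by (simp add: algebra_simps)
      then show ?case using step by (simp add: power2_eq_square)
    qed simp
    from this[of "a - 1"] have "(2 * a)\<^sup>2 \<le> 2 ^ (a - 1)" using assms by simp
    then have "real ((2 * a)\<^sup>2) \<le> real (2 ^ (a - 1))" by (simp only: of_nat_le_iff)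
    then have "(2 * real a)\<^sup>2 \<le> 2 ^ (a - 1)" by simp
    also have "\<dots> = 2 powr real (a - 1)" by (simp add: powr_realpow)
    also have "real (a - 1) = real a - 1" using assms by simp
    finally show ?thesis .
  qed
  ultimately have "(2 * real a)\<^sup>2 \<le> (real n)\<^sup>2" by linarith
  then have n2a: "2 * real a \<le> real n" by (rule power2_le_imp_le) simp
  have "n - 1 < n" using n1 by simp
  then have "\<not> R (n - 1)" unfolding n_def by (rule not_less_Least)
  then have lt: "mu a (n - 1) < real (n - 1) / (10000 * (real a)\<^sup>2)"
    using na assms by (auto simp: R_def not_le)
  have "real ((n - a) * (n choose a)) = real (n * ((n - 1) choose a))"
    using binomial_absorb_comp[of n a] by simp
  then have "real (n - a) * mu a n = real n * mu a (n - 1)"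
    unfolding mu_def by simp
  moreover have "real n / 2 * mu a n \<le> real (n - a) * mu a n"
    using n2a na by (intro mult_right_mono) (auto simp: mu_nonneg of_nat_diff)
  ultimately have "real n * (mu a n / 2) \<le> real n * mu a (n - 1)" by simp
  then have "mu a n / 2 \<le> mu a (n - 1)" using n1 by simp
  also have "\<dots> \<le> real n / (10000 * (real a)\<^sup>2)"
    using lt by (rule order.trans[OF less_imp_le]) (intro divide_right_mono, auto)
  finally have "mu a n \<le> real n / (5000 * (real a)\<^sup>2)" by (simp add: field_simps)
  then show ?thesis using na n1 unfolding regime_def by blast
qed

lemma infinite_regime: "infinite {n. \<exists>a. regime a n}"
  unfolding infinite_nat_iff_unbounded_le
proof
  fix m
  obtain n where "n \<ge> m + 20001" "regime (m + 20001) n" using regime_exists[of "m + 20001"] by auto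
  then show "\<exists>n\<ge>m. n \<in> {n. \<exists>a. regime a n}" by (intro exI[of _ n]) auto
qed

lemma regime_bigtheta:
  assumes "filterlim \<sigma> at_top sequentially" "\<And>i. regime (a (\<sigma> i)) (\<sigma> i)"
  shows "(\<lambda>i. mu (a (\<sigma> i)) (\<sigma> i)) \<in> \<Theta>(\<lambda>i. real (\<sigma> i) / (ln (real (\<sigma> i)))\<^sup>2)"
proof -
  have "\<forall>\<^sub>F n in sequentially. ln (real n) > 1"
    by (rule eventually_nat_real) real_asymp
  then have "\<forall>\<^sub>F n in sequentially. \<forall>a. regime a n \<longrightarrow> mu a n \<le> 1 * (real n / (ln (real n))\<^sup>2) \<and>
      real n / (ln (real n))\<^sup>2 \<le> 100000 * mu a n"
    using regime_bounds
  proof eventually_elim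
    case (elim n)
    let ?L = "ln (real n)"
    show ?case
    proof (intro allI impI)
      fix a assume reg: "regime a n"
      have a: "real a > 0" using regime_gt_one[OF reg] by simp
      have bd: "5/2 * ?L \<le> real a" "real a \<le> 31/10 * ?L" using elim(2) reg by auto
      have mu: "real n / (10000 * (real a)\<^sup>2) \<le> mu a n" "mu a n \<le> real n / (5000 * (real a)\<^sup>2)"
        using reg by (auto simp: regime_def)
      have "?L \<le> real a" using bd(1) elim(1) by linarith
      then have "?L\<^sup>2 \<le> (real a)\<^sup>2" using elim(1) by (intro power_mono) auto
      then have "?L\<^sup>2 \<le> 5000 * (real a)\<^sup>2" by (smt (verit) zero_le_power2)
      then have "real n / (5000 * (real a)\<^sup>2) \<le> real n / ?L\<^sup>2"
        using elim(1) a by (intro divide_left_mono) auto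
      then have 1: "mu a n \<le> 1 * (real n / ?L\<^sup>2)" using mu by linarith
      have "(real a)\<^sup>2 \<le> (31/10 * ?L)\<^sup>2" using bd(2) a by (intro power_mono) auto
      then have "(real a)\<^sup>2 \<le> 10 * ?L\<^sup>2" by (simp add: power_mult_distrib power_divide) (smt (verit) zero_le_power2)
      then have "real n / (10 * ?L\<^sup>2) \<le> real n / (real a)\<^sup>2"
        using elim(1) a by (intro divide_left_mono) auto
      moreover have "real n / (real a)\<^sup>2 \<le> 10000 * mu a n" using mu(1) a by (simp add: field_simps)
      ultimately have "real n / ?L\<^sup>2 \<le> 100000 * mu a n" by simp
      then show "mu a n \<le> 1 * (real n / ?L\<^sup>2) \<and> real n / ?L\<^sup>2 \<le> 100000 * mu a n" using 1 by blast
    qed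
  qed
  then have ev: "\<forall>\<^sub>F i in sequentially. \<forall>a. regime a (\<sigma> i) \<longrightarrow> mu a (\<sigma> i) \<le> 1 * (real (\<sigma> i) / (ln (real (\<sigma> i)))\<^sup>2) \<and>
      real (\<sigma> i) / (ln (real (\<sigma> i)))\<^sup>2 \<le> 100000 * mu a (\<sigma> i)"
    using assms(1) by (rule eventually_compose_filterlim)
  show ?thesis
  proof (rule bigthetaI)
    show "(\<lambda>i. mu (a (\<sigma> i)) (\<sigma> i)) \<in> O(\<lambda>i. real (\<sigma> i) / (ln (real (\<sigma> i)))\<^sup>2)"
      by (rule bigoI[of _ 1], rule eventually_mono[OF ev]) (use assms(2) mu_nonneg in auto)
    show "(\<lambda>i. mu (a (\<sigma> i)) (\<sigma> i)) \<in> \<Omega>(\<lambda>i. real (\<sigma> i) / (ln (real (\<sigma> i)))\<^sup>2)"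
      unfolding bigomega_iff_bigo
      by (rule bigoI[of _ 100000], rule eventually_mono[OF ev]) (use assms(2) mu_nonneg in auto)
  qed
qed

lemma regime_planting_iterate:
  "\<forall>\<^sub>F n in sequentially. \<forall>a n' m r. regime a n \<longrightarrow> n \<le> n' \<longrightarrow> real (n' + r * a) \<le> real n + real n / real a \<longrightarrow>
     gnp_prob (n' + r * a) (\<lambda>E. chromatic (n' + r * a) E \<le> m + r) \<ge>
       gnp_prob n' (\<lambda>E. chromatic n' E \<le> m) - real r * (2 / sqrt (mu a n))"
  using regime_planting
proof eventually_elim
  case (elim n)
  show ?case
  proof (intro allI impI)
    fix a n' m r assume reg: "regime a n" and n': "n \<le> n'" and "real (n' + r * a) \<le> real n + real n / real a"
    then show "gnp_prob (n' + r * a) (\<lambda>E. chromatic (n' + r * a) E \<le> m + r) \<ge>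
       gnp_prob n' (\<lambda>E. chromatic n' E \<le> m) - real r * (2 / sqrt (mu a n))"
    proof (induction r)
      case (Suc r)
      have le: "real (n' + r * a + a) \<le> real n + real n / real a" using Suc.prems by (simp add: algebra_simps)
      then have "real (n' + r * a) \<le> real n + real n / real a" by simp
      note IH = Suc.IH[OF reg n' this]
      have "n \<le> n' + r * a" using n' by simp
      then have "gnp_prob (n' + r * a + a) (\<lambda>E. chromatic (n' + r * a + a) E \<le> Suc (m + r)) \<ge>
        gnp_prob (n' + r * a) (\<lambda>E. chromatic (n' + r * a) E \<le> m + r) - 2 / sqrt (mu a n)"
        using elim reg le by blast
      moreover have "n' + r * a + a = n' + Suc r * a" by simp
      moreover have "real (Suc r) * (2 / sqrt (mu a n)) = real r * (2 / sqrt (mu a n)) + 2 / sqrt (mu a n)"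
        by (simp add: distrib_right add_divide_distrib)
      ultimately show ?case using IH by (simp only: add_Suc_right)
    qed simp
  qed
qed

text \<open>Events of probability at least 0.9 and more than 0.1 share a graph, whose chromatic
  number lies between \<open>s n\<close> and \<open>B\<close>.\<close>

lemma s_le_of_prob:
  fixes s t :: "nat \<Rightarrow> real"
  assumes st: "gnp_prob n (\<lambda>E. s n \<le> real (chromatic n E) \<and> real (chromatic n E) \<le> t n) \<ge> 0.9"
    and Q: "gnp_prob n Q > 0.1" and QB: "\<And>E. Q E \<Longrightarrow> real (chromatic n E) \<le> B"
  shows "s n \<le> B"
proof -
  obtain E where "s n \<le> real (chromatic n E)" "Q E"
    using gnp_prob_both[of n "\<lambda>E. s n \<le> real (chromatic n E) \<and> real (chromatic n E) \<le> t n" Q] st Q by auto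
  then show ?thesis using QB by fastforce
qed

lemma upper_end_prob:
  fixes s t :: "nat \<Rightarrow> real"
  assumes st: "gnp_prob n (\<lambda>E. s n \<le> real (chromatic n E) \<and> real (chromatic n E) \<le> t n) \<ge> 0.9"
  shows "t n \<ge> 0" "gnp_prob n (\<lambda>E. chromatic n E \<le> nat \<lfloor>t n\<rfloor>) \<ge> 0.9"
proof -
  obtain E where "real (chromatic n E) \<le> t n"
    using gnp_prob_both[of n "\<lambda>E. s n \<le> real (chromatic n E) \<and> real (chromatic n E) \<le> t n" "\<lambda>_. True"] st
    by (auto simp: gnp_prob_eq_mean mean_const)
  then show "t n \<ge> 0" using of_nat_0_le_iff order.trans by blast
  have "gnp_prob n (\<lambda>E. s n \<le> real (chromatic n E) \<and> real (chromatic n E) \<le> t n) \<le> gnp_prob n (\<lambda>E. chromatic n E \<le> nat \<lfloor>t n\<rfloor>)"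
    by (rule gnp_prob_mono) (auto simp: le_nat_floor)
  then show "gnp_prob n (\<lambda>E. chromatic n E \<le> nat \<lfloor>t n\<rfloor>) \<ge> 0.9" using st by linarith
qed

text \<open>The three summands are losses in colours: rounding, the error of the hypothesis, and the
  accumulated interval lengths. Each, priced at 2 * a * ln n, has to fit into a third of the gain.
  The first two are of smaller order; the third has the order of the gain itself, so here the
  constant 1 / 10000000 is decided. The multiples 31/10 and 5/2 of ln n stand in for
  \<open>a\<close>.\<close>

lemma small_errors:
  fixes C :: real
  assumes "C > 0"
  shows "\<forall>\<^sub>F x::real in at_top. ((31/10 * ln x)\<^sup>2 + C * x powr 0.99 + 641 * (sqrt x / ln x) * (1 / 10000000 * (2 * sqrt x) * ln (ln (2 * x)) / ln x ^ 3))
     * (2 * (31/10 * ln x) * ln x) \<le> 1/8 * (x / (31/10 * ln x)\<^sup>2) * ln (5/2 * ln x)"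
proof -
  let ?E = "\<lambda>x::real. 2 * (31/10 * ln x) * ln x" and ?R = "\<lambda>x::real. x / (31/10 * ln x)\<^sup>2 * ln (5/2 * ln x)"
  have "\<forall>\<^sub>F x::real in at_top. (31/10 * ln x)\<^sup>2 * ?E x \<le> 1/24 * ?R x"
    by real_asymp
  moreover have "\<forall>\<^sub>F x::real in at_top. C * x powr (99/100) * ?E x \<le> 1/24 * ?R x"
    using assms by real_asymp
  moreover have "\<forall>\<^sub>F x::real in at_top. 641 * (sqrt x / ln x) * (1 / 10000000 * (2 * sqrt x) * ln (ln (2 * x)) / ln x ^ 3) * ?E x \<le> 1/24 * ?R x"
  proof -
    have "\<forall>\<^sub>F x::real in at_top. ln (ln (2 * x)) \<le> 2 * ln (5/2 * ln x)" by real_asymp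
    moreover have "\<forall>\<^sub>F x::real in at_top. ln x > 1" by real_asymp
    ultimately show ?thesis using eventually_gt_at_top[of 0]
    proof eventually_elim
      case (elim x)
      have lr: "ln (5/2 * ln x) \<ge> 0" using elim(2) by (intro ln_ge_zero) auto
      have xx: "sqrt x * sqrt x = x" using elim(3) by simp
      have "641 * (sqrt x / ln x) * (1 / 10000000 * (2 * sqrt x) * ln (ln (2 * x)) / ln x ^ 3) * ?E x
         = 641 * 2 * (31/5) / 10000000 * ((sqrt x * sqrt x) / (ln x)\<^sup>2) * ln (ln (2 * x))"
        using elim(2) by (simp add: field_simps power2_eq_square power3_eq_cube)
      also have "\<dots> \<le> 641 * 2 * (31/5) / 10000000 * (x / (ln x)\<^sup>2) * (2 * ln (5/2 * ln x))"
        unfolding xx using elim by (intro mult_left_mono) auto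
      also have "\<dots> \<le> 1/240 * (x / (ln x)\<^sup>2 * ln (5/2 * ln x))"
        using mult_nonneg_nonneg[OF _ lr, of "x / (ln x)\<^sup>2"] elim(3) by simp
      also have "\<dots> \<le> 1/24 * ?R x"
        using mult_nonneg_nonneg[OF _ lr, of "x / (ln x)\<^sup>2"] elim(3) by (simp add: power_mult_distrib power_divide)
      finally show ?case .
    qed
  qed
  ultimately show ?thesis
  proof eventually_elim
    case (elim x)
    have "x powr 0.99 = x powr (99/100)" by simp
    then show ?case unfolding distrib_right using elim by simp
  qed
qed

lemma interval_length_contradiction:
  fixes s t :: "nat \<Rightarrow> real" and C :: real
  assumes C: "C > 0"
    and st: "\<And>n. gnp_prob n (\<lambda>E. s n \<le> real (chromatic n E) \<and> real (chromatic n E) \<le> t n) \<ge> 0.9"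
    and short: "\<forall>\<^sub>F n in sequentially. t n - s n < 1 / 10000000 * sqrt (real n) * ln (ln (real n)) / (ln (real n)) ^ 3"
  shows "\<forall>\<^sub>F n in sequentially. \<forall>a. regime a n \<longrightarrow> gnp_prob n (\<lambda>E.
             \<bar>real (chi_bounded (a - 1) n E) - real (k_t (a - 1) n)\<bar> \<le> C * real n powr 0.99) < 1 / 2"
proof -
  let ?g = "\<lambda>x::real. 1 / 10000000 * sqrt x * ln (ln x) / (ln x) ^ 3"
  \<comment> \<open>A uniform bound for \<open>?g\<close> on [n, 2 * n]: the square root grows by
    less than a factor 2, the double logarithm is taken at the right end and the denominator at the
    left.\<close>
  let ?G = "\<lambda>x::real. 1 / 10000000 * (2 * sqrt x) * ln (ln (2 * x)) / (ln x) ^ 3"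
  obtain n0 where n0: "\<And>n. n \<ge> n0 \<Longrightarrow> t n - s n < ?g (real n)"
    using short unfolding eventually_sequentially by blast
  have "\<forall>\<^sub>F n in sequentially. n \<ge> n0" by (rule eventually_ge_at_top)
  moreover have "\<forall>\<^sub>F n in sequentially. ln (real n) > 20"
    by (rule eventually_nat_real) real_asymp
  moreover have "\<forall>\<^sub>F n in sequentially. 4 * (31/10 * ln (real n))\<^sup>2 * sqrt (real n) \<le> real n"
    by (rule eventually_nat_real) real_asymp
  moreover have "\<forall>\<^sub>F n in sequentially. sqrt (real n) / (100 * (31/10 * ln (real n))) \<ge> 16"
    by (rule eventually_nat_real) real_asymp
  moreover have "\<forall>\<^sub>F n in sequentially. ((31/10 * ln (real n))\<^sup>2 + C * real n powr 0.99 + 641 * (sqrt (real n) / ln (real n)) * ?G (real n))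
     * (2 * (31/10 * ln (real n)) * ln (real n)) \<le> 1/8 * (real n / (31/10 * ln (real n))\<^sup>2) * ln (5/2 * ln (real n))"
    by (rule eventually_nat_real) (rule small_errors[OF C])
  ultimately show ?thesis
    using regime_bounds saddle_exists k_t_le chromatic_lower_bound regime_planting_iterate
  proof eventually_elim
    case (elim n)
    let ?L = "ln (real n)"
    show ?case
    proof (intro allI impI, rule ccontr)
      fix a assume reg: "regime a n" and "\<not> gnp_prob n (\<lambda>E. \<bar>real (chi_bounded (a - 1) n E) - real (k_t (a - 1) n)\<bar> \<le> C * real n powr 0.99) < 1 / 2"
      then have hyp: "gnp_prob n (\<lambda>E. \<bar>real (chi_bounded (a - 1) n E) - real (k_t (a - 1) n)\<bar> \<le> C * real n powr 0.99) \<ge> 1 / 2" by simp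
      have a: "a \<ge> 2" "real a > 0" using regime_gt_one[OF reg] by auto
      have npos: "real n > 0" using reg by (simp add: regime_def)
      define G where "G = ?G (real n)"
      have L: "?L > 20" by (rule elim(2))
      have bd: "5/2 * ?L \<le> real a" "real a \<le> 31/10 * ?L" using elim(6) reg by auto
      have mu: "real n / (10000 * (real a)\<^sup>2) \<le> mu a n" "mu a n \<le> real n / (5000 * (real a)\<^sup>2)"
        using reg by (auto simp: regime_def)
      obtain x Q M \<beta> where sad: "saddle a n x Q M \<beta>" using elim(7) reg by blast
      have kt: "real (k_t (a - 1) n) \<le> M + (real a)\<^sup>2" using elim(8) reg sad by blast

      \<comment> \<open>\<open>chi_bounded (a - 1)\<close> bounds the chromatic number from above,
        and probability 1/2 is more than the required 0.1.\<close>
      have s0: "s n \<le> M + (real a)\<^sup>2 + C * real n powr 0.99"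
      proof (rule s_le_of_prob[OF st])
        show "gnp_prob n (\<lambda>E. \<bar>real (chi_bounded (a - 1) n E) - real (k_t (a - 1) n)\<bar> \<le> C * real n powr 0.99) > 0.1"
          using hyp by simp
        fix E assume "\<bar>real (chi_bounded (a - 1) n E) - real (k_t (a - 1) n)\<bar> \<le> C * real n powr 0.99"
        moreover have "chromatic n E \<le> chi_bounded (a - 1) n E" by (rule chromatic_le_chi_bounded) (use a in simp)
        ultimately show "real (chromatic n E) \<le> M + (real a)\<^sup>2 + C * real n powr 0.99" using kt by linarith
      qed

      define q where "q = sqrt (mu a n)"
      have "sqrt (real n / (10000 * (real a)\<^sup>2)) \<le> q" unfolding q_def using mu(1) by simp
      then have q1: "sqrt (real n) / (100 * real a) \<le> q" using a by (simp add: real_sqrt_divide real_sqrt_mult)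
      have "sqrt (real n) / (100 * (31/10 * ?L)) \<le> sqrt (real n) / (100 * real a)"
        using bd a L by (intro divide_left_mono) auto
      then have q16: "q \<ge> 16" using q1 elim(4) by linarith
      have qn: "q \<le> sqrt (real n)"
      proof -
        have "(real a)\<^sup>2 \<ge> 1" using a by (intro one_le_power) auto
        then have "1 \<le> 5000 * (real a)\<^sup>2" by linarith
        then have "real n / (5000 * (real a)\<^sup>2) \<le> real n / 1"
          using npos a by (intro divide_left_mono) auto
        then show ?thesis unfolding q_def using mu(2) by simp
      qed
      \<comment> \<open>A block of \<open>r\<close> plantings loses at most r * 2 / q \<le> 1/4 in
        probability, which leaves 0.9 - 1/4 > 0.1.\<close>
      define r where "r = nat \<lfloor>q / 8\<rfloor>"
      have r: "real r \<le> q / 8" "q / 16 \<le> real r" unfolding r_def using q16 by linarith+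
      then have r0: "real r > 0" using q16 by linarith
      have rd: "real r * (2 / q) \<le> 1 / 4" using r(1) q16 by (simp add: field_simps)

      have nan: "real n / real a \<le> real n"
        using divide_left_mono[of 1 "real a" "real n"] a npos by simp
      have short': "t v - s v \<le> G" if v: "n \<le> v" "real v \<le> real n + real n / real a" for v
      proof -
        have v2: "real v \<le> 2 * real n" using v(2) nan by linarith
        have lv: "?L \<le> ln (real v)" "ln (real v) \<le> ln (2 * real n)" using v npos v2 by auto
        have "ln 1 \<le> ln (ln (real v))" using lv L by (subst ln_le_cancel_iff) auto
        then have ll0: "0 \<le> ln (ln (real v))" by simp
        have ll: "ln (ln (real v)) \<le> ln (ln (2 * real n))" using lv L by (subst ln_le_cancel_iff) auto
        have "sqrt (real v) \<le> sqrt (2\<^sup>2 * real n)" using v2 npos by simp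
        then have sv: "sqrt (real v) \<le> 2 * sqrt (real n)" by (simp only: real_sqrt_mult real_sqrt_abs)
        have "t v - s v \<le> ?g (real v)" using n0[of v] elim(1) v by simp
        also have "\<dots> \<le> G"
          unfolding G_def using sv ll ll0 lv L by (intro frac_le mult_mono power_mono) auto
        finally show ?thesis .
      qed
      have step: "s (v + r * a) \<le> t v + real r" if v: "n \<le> v" "real (v + r * a) \<le> real n + real n / real a" for v
      proof (rule s_le_of_prob[OF st])
        have "gnp_prob (v + r * a) (\<lambda>E. chromatic (v + r * a) E \<le> nat \<lfloor>t v\<rfloor> + r) \<ge>
            gnp_prob v (\<lambda>E. chromatic v E \<le> nat \<lfloor>t v\<rfloor>) - real r * (2 / q)"
          unfolding q_def using elim(10) reg v by blast
        then show "gnp_prob (v + r * a) (\<lambda>E. chromatic (v + r * a) E \<le> nat \<lfloor>t v\<rfloor> + r) > 0.1"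
          using upper_end_prob(2)[of v s t, OF st] rd by linarith
        fix E assume "chromatic (v + r * a) E \<le> nat \<lfloor>t v\<rfloor> + r"
        then have "real (chromatic (v + r * a) E) \<le> real (nat \<lfloor>t v\<rfloor>) + real r" by linarith
        then show "real (chromatic (v + r * a) E) \<le> t v + real r"
          using upper_end_prob(1)[of v s t, OF st] by linarith
      qed
      \<comment> \<open>Each block raises the lower end by at most G + r: first from
        \<open>s\<close> to \<open>t\<close> at the same number of vertices, then by
        \<open>r\<close> plantings.\<close>
      have walk: "real (n + j * (r * a)) \<le> real n + real n / real a \<Longrightarrow> s (n + j * (r * a)) \<le> s n + real j * (G + real r)" for j
      proof (induction j)
        case (Suc j)
        let ?v = "n + j * (r * a)"
        have vr: "?v + r * a = n + Suc j * (r * a)" by simp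
        have "real (?v + r * a) \<le> real n + real n / real a" unfolding vr by (rule Suc.prems)
        moreover have "real ?v \<le> real (?v + r * a)" by (simp only: of_nat_le_iff le_add1)
        ultimately have v: "real ?v \<le> real n + real n / real a" by linarith
        have "real (?v + r * a) \<le> real n + real n / real a" unfolding vr by (rule Suc.prems)
        then have "s (?v + r * a) \<le> t ?v + real r" by (intro step) auto
        also have "t ?v \<le> s ?v + G" using short'[of ?v] v by simp
        also have "s ?v \<le> s n + real j * (G + real r)" by (rule Suc.IH[OF v])
        finally show ?case unfolding vr by (simp add: algebra_simps)
      qed simp

      \<comment> \<open>The number of whole blocks of r * a vertices in a stretch of n / a vertices.
        An incomplete last block is less than a quarter of the stretch, because 4 * a^2 * r \<le>
        n.\<close>
      define T where "T = nat \<lfloor>real n / (real r * (real a)\<^sup>2)\<rfloor>"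
      have T0: "real n / (real r * (real a)\<^sup>2) \<ge> 0" by simp
      then have T: "real T \<le> real n / (real r * (real a)\<^sup>2)" "real n / (real r * (real a)\<^sup>2) - 1 \<le> real T"
        unfolding T_def by linarith+
      define n' where "n' = n + T * (r * a)"
      have n'1: "n \<le> n'" unfolding n'_def by simp
      have n'N: "real n' - real n = real T * (real r * real a)" unfolding n'_def by simp
      have "real T * (real r * real a) \<le> real n / (real r * (real a)\<^sup>2) * (real r * real a)"
        using T(1) by (intro mult_right_mono) auto
      also have "\<dots> = real n / real a" using r0 a by (simp add: power2_eq_square)
      finally have n'2: "real n' \<le> real n + real n / real a" using n'N by linarith
      have n'3: "3/4 * (real n / real a) \<le> real n' - real n"
      proof -
        have "4 * (real a)\<^sup>2 * real r \<le> 4 * (31/10 * ?L)\<^sup>2 * sqrt (real n)"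
          using bd a r(1) qn q16 by (intro mult_mono power_mono) auto
        also have "\<dots> \<le> real n" by (rule elim(3))
        finally have "4 * (real a)\<^sup>2 * real r \<le> real n" .
        then have "real r * real a \<le> 1/4 * (real n / real a)"
          using a by (simp add: field_simps power2_eq_square)
        then have "3/4 * (real n / real a) \<le> real n / real a - real r * real a" by simp
        also have "\<dots> = (real n / (real r * (real a)\<^sup>2) - 1) * (real r * real a)"
          using r0 a by (simp add: left_diff_distrib power2_eq_square)
        also have "\<dots> \<le> real T * (real r * real a)"
          using T(2) by (intro mult_right_mono) auto
        also have "\<dots> = real n' - real n" by (rule n'N[symmetric])
        finally show ?thesis .
      qed

      \<comment> \<open>All losses against the slope 1 / a: \<open>T\<close> interval lengths from
        the walk and one more to pass from \<open>s n'\<close> to \<open>t n'\<close>.\<close>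
      define g where "g = (real a)\<^sup>2 + C * real n powr 0.99 + (real T + 1) * G"
      have G0: "G \<ge> 0"
      proof -
        have "ln 1 \<le> ln (ln (2 * real n))" using L npos ln_le_cancel_iff[of "real n" "2 * real n"]
          by (subst ln_le_cancel_iff) linarith+
        then have "0 \<le> ln (ln (2 * real n))" by simp
        then show ?thesis unfolding G_def using L by (intro divide_nonneg_nonneg mult_nonneg_nonneg) auto
      qed
      have g0: "0 \<le> g" unfolding g_def using G0 C by (intro add_nonneg_nonneg mult_nonneg_nonneg) auto
      \<comment> \<open>640 = 1600 / (5/2), where 1600 = 16 * 100 comes from r \<ge> q / 16 and q
        \<ge> sqrt n / (100 * a); the last unit pays for the + 1.\<close>
      have T1: "real T + 1 \<le> 641 * (sqrt (real n) / ?L)"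
      proof -
        have "sqrt (real n) / (1600 * real a) \<le> real r" using q1 r(2) by simp
        then have "real n / (real r * (real a)\<^sup>2) \<le> real n / (sqrt (real n) / (1600 * real a) * (real a)\<^sup>2)"
          using npos a r0 by (intro divide_left_mono mult_right_mono) auto
        also have "\<dots> = 1600 * (real n / sqrt (real n)) / real a"
          using a npos by (simp add: power2_eq_square)
        also have "\<dots> = 1600 * sqrt (real n) / real a" by (simp only: real_div_sqrt of_nat_0_le_iff)
        also have "\<dots> \<le> 1600 * sqrt (real n) / (5/2 * ?L)"
          using bd(1) L a by (intro divide_left_mono) auto
        also have "\<dots> = 640 * (sqrt (real n) / ?L)" by simp
        finally have "real T \<le> 640 * (sqrt (real n) / ?L)" using T(1) by linarith
        moreover have "1 \<le> sqrt (real n) / ?L" using elim(4) L by (simp add: field_simps)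
        ultimately show ?thesis by linarith
      qed
      have g1: "g * (2 * real a * ?L) \<le> 1/8 * (real n / (real a)\<^sup>2) * ln (real a)"
      proof -
        have "g \<le> (31/10 * ?L)\<^sup>2 + C * real n powr 0.99 + 641 * (sqrt (real n) / ?L) * G"
          unfolding g_def using bd(2) a T1 G0 by (intro add_mono mult_right_mono power_mono) auto
        then have "g * (2 * real a * ?L) \<le> ((31/10 * ?L)\<^sup>2 + C * real n powr 0.99 + 641 * (sqrt (real n) / ?L) * G) * (2 * (31/10 * ?L) * ?L)"
          using bd(2) a L g0 by (intro mult_mono) auto
        also have "\<dots> \<le> 1/8 * (real n / (31/10 * ?L)\<^sup>2) * ln (5/2 * ?L)" unfolding G_def by (rule elim(5))
        also have "\<dots> \<le> 1/8 * (real n / (real a)\<^sup>2) * ln (real a)"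
        proof (intro mult_mono divide_left_mono power_mono)
          show "ln (5/2 * ?L) \<le> ln (real a)" using bd(1) L a by (subst ln_le_cancel_iff) auto
          show "0 \<le> ln (5/2 * ?L)" using L by (intro ln_ge_zero) auto
        qed (use bd a L in auto)
        finally show ?thesis .
      qed

      have "t n' \<le> s n' + G" using short'[OF n'1 n'2] by linarith
      also have "s n' \<le> s n + real T * (G + real r)" using walk[of T] n'2 unfolding n'_def by blast
      finally have "t n' \<le> M + real T * real r + g" unfolding g_def using s0 by (simp add: algebra_simps)
      moreover have "(real n' - real n) / real a = real T * real r" unfolding n'N using a by simp
      ultimately have "real (nat \<lfloor>t n'\<rfloor>) \<le> M + (real n' - real n) / real a + g"
        using upper_end_prob(1)[of n' s t, OF st] by linarith
      \<comment> \<open>The first moment leaves probability at most 1/2 to an event that the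
        interval property guarantees with probability 0.9.\<close>
      then have "gnp_prob n' (\<lambda>E. chromatic n' E \<le> nat \<lfloor>t n'\<rfloor>) \<le> 1/2"
        using elim(9) reg sad n'1 n'2 n'3 g0 g1 by blast
      then show False using upper_end_prob(2)[of n' s t, OF st] by linarith
    qed
  qed
qed

theorem theorem8:
  assumes hyp: "\<And>(a :: nat \<Rightarrow> nat) (\<sigma> :: nat \<Rightarrow> nat).
     strict_mono \<sigma> \<Longrightarrow>
     (\<lambda>i. mu (a (\<sigma> i)) (\<sigma> i)) \<in> \<Theta>(\<lambda>i. real (\<sigma> i) / (ln (real (\<sigma> i)))^2) \<Longrightarrow>
     \<exists>C. ((\<lambda>i. gnp_prob (\<sigma> i) (\<lambda>E.
             \<bar>real (chi_bounded (a (\<sigma> i) - 1) (\<sigma> i) E) - real (k_t (a (\<sigma> i) - 1) (\<sigma> i))\<bar>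
               \<le> C * real (\<sigma> i) powr 0.99)) \<longlongrightarrow> 1) sequentially"
  shows "\<exists>c > 0. \<forall>s t :: nat \<Rightarrow> real.
     (\<forall>n. gnp_prob n (\<lambda>E. s n \<le> real (chromatic n E) \<and> real (chromatic n E) \<le> t n) \<ge> 0.9) \<longrightarrow>
     (\<exists>\<^sub>F n in sequentially.
        t n - s n \<ge> c * sqrt (real n) * ln (ln (real n)) / (ln (real n))^3)"
proof (intro exI[of _ "1/10000000"] conjI allI impI)
  fix s t :: "nat \<Rightarrow> real"
  assume st: "\<forall>n. gnp_prob n (\<lambda>E. s n \<le> real (chromatic n E) \<and> real (chromatic n E) \<le> t n) \<ge> 0.9"
  \<comment> \<open>The hypothesis is applied along the increasing enumeration of all
    \<open>n\<close> that are in the regime for some class size.\<close>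
  define \<sigma> where "\<sigma> = enumerate {n. \<exists>a. regime a n}"
  define a where "a = (\<lambda>n. SOME a. regime a n)"
  have \<sigma>: "strict_mono \<sigma>" unfolding \<sigma>_def by (rule strict_mono_enumerate[OF infinite_regime])
  have reg: "regime (a (\<sigma> i)) (\<sigma> i)" for i
  proof -
    have "\<exists>a. regime a (\<sigma> i)" using enumerate_in_set[OF infinite_regime, of i] by (simp add: \<sigma>_def)
    then show ?thesis unfolding a_def by (rule someI_ex)
  qed
  have lim: "filterlim \<sigma> at_top sequentially" using \<sigma> by (rule filterlim_subseq)
  obtain C where C: "((\<lambda>i. gnp_prob (\<sigma> i) (\<lambda>E.
             \<bar>real (chi_bounded (a (\<sigma> i) - 1) (\<sigma> i) E) - real (k_t (a (\<sigma> i) - 1) (\<sigma> i))\<bar>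
               \<le> C * real (\<sigma> i) powr 0.99)) \<longlongrightarrow> 1) sequentially"
    using hyp[of \<sigma> a, OF \<sigma> regime_bigtheta[of \<sigma> a, OF lim reg]] by blast
  show "\<exists>\<^sub>F n in sequentially. t n - s n \<ge> 1/10000000 * sqrt (real n) * ln (ln (real n)) / (ln (real n))^3"
  proof (rule ccontr)
    assume "\<not> ?thesis"
    then have short: "\<forall>\<^sub>F n in sequentially. t n - s n < 1 / 10000000 * sqrt (real n) * ln (ln (real n)) / (ln (real n)) ^ 3"
      by (simp add: not_frequently not_le)
    have "\<forall>\<^sub>F n in sequentially. \<forall>a. regime a n \<longrightarrow> gnp_prob n (\<lambda>E.
             \<bar>real (chi_bounded (a - 1) n E) - real (k_t (a - 1) n)\<bar> \<le> (\<bar>C\<bar> + 1) * real n powr 0.99) < 1 / 2"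
      \<comment> \<open>The constant of the hypothesis may have any sign; |C| + 1 is positive and
        only enlarges the event.\<close>
      by (rule interval_length_contradiction[OF _ _ short]) (use st in auto)
    then have "\<forall>\<^sub>F i in sequentially. \<forall>a. regime a (\<sigma> i) \<longrightarrow> gnp_prob (\<sigma> i) (\<lambda>E.
             \<bar>real (chi_bounded (a - 1) (\<sigma> i) E) - real (k_t (a - 1) (\<sigma> i))\<bar> \<le> (\<bar>C\<bar> + 1) * real (\<sigma> i) powr 0.99) < 1 / 2"
      using lim by (rule eventually_compose_filterlim)
    moreover have "\<forall>\<^sub>F i in sequentially. gnp_prob (\<sigma> i) (\<lambda>E.
             \<bar>real (chi_bounded (a (\<sigma> i) - 1) (\<sigma> i) E) - real (k_t (a (\<sigma> i) - 1) (\<sigma> i))\<bar>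
               \<le> C * real (\<sigma> i) powr 0.99) > 1 / 2"
      by (rule order_tendstoD(1)[OF C]) simp
    ultimately have "\<forall>\<^sub>F i in sequentially. False"
    proof eventually_elim
      case (elim i)
      have "C * real (\<sigma> i) powr 0.99 \<le> (\<bar>C\<bar> + 1) * real (\<sigma> i) powr 0.99" by (intro mult_right_mono) auto
      then have "gnp_prob (\<sigma> i) (\<lambda>E. \<bar>real (chi_bounded (a (\<sigma> i) - 1) (\<sigma> i) E) - real (k_t (a (\<sigma> i) - 1) (\<sigma> i))\<bar>
               \<le> C * real (\<sigma> i) powr 0.99) \<le> gnp_prob (\<sigma> i) (\<lambda>E. \<bar>real (chi_bounded (a (\<sigma> i) - 1) (\<sigma> i) E) - real (k_t (a (\<sigma> i) - 1) (\<sigma> i))\<bar>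
               \<le> (\<bar>C\<bar> + 1) * real (\<sigma> i) powr 0.99)"
        by (intro gnp_prob_mono) auto
      then show False using elim reg[of i] by fastforce
    qed
    then show False by simp
  qed
qed simp

end
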